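(* Let $1\le m<n$, $r\ge1$ with $m\ge r(n-m+1)$, and put $a=n-m$. The number of $\mathcal{A}$-isotopy classes contained in the $\mathcal{A}$-equivalence class of the $r$-Morin singularity $(\mathbb{R}^m,0)\to(\mathbb{R}^n,0)$ is as follows. If $m>r(n-m+1)$, the number is $1$. If $m=r(n-m+1)$, the number is: - $2$ if $r\equiv0\pmod 4$; - $1$ if $r\equiv1\pmod4$ and $a$ is odd, and $2$ if $r\equiv1\pmod4$ and $a$ is even; - $2$ if $r\equiv2\pmod4$ and $a$ is odd, and $1$ if $r\equiv2\pmod4$ and $a$ is even; - $1$ if $r\equiv3\pmod4$.
   Context: All germs are $C^\infty$. Two germs $f,g:(\mathbb{R}^m,0)\to(\mathbb{R}^n,0)$ are $\mathcal{A}$-equivalent if $\Phi\circ f\circ\varphi=g$ for some diffeomorphism-germs $\varphi$ of $(\mathbb{R}^m,0)$ and $\Phi$ of $(\mathbb{R}^n,0)$. An $r$-Morin singularity is a germ $\mathcal{A}$-equivalent to $$h_{0,r}:x=(x_1,\ldots,x_m)\mapsto\big(x_1,\ldots,x_{m-1},h_1(x),\ldots,h_{n-m+1}(x)\big),$$ where $h_i(x)=\sum_{j=1}^r x_{(i-1)r+j}\,x_m^j$ for $i=1,\ldots,n-m$, and $h_{n-m+1}(x)=\sum_{j=1}^{r-1}x_{(n-m)r+j}\,x_m^j+x_m^{r+1}$. A germ $f$ is $d$-determined if every germ $g:(\mathbb{R}^m,0)\to(\mathbb{R}^n,0)$ with the same $d$-jet at $0$ is $\mathcal{A}$-equivalent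 to $f$. Let $\operatorname{Diff}^d(k)$ be the set of $d$-jets at $0$ of diffeomorphism-germs $(\mathbb{R}^k,0)\to(\mathbb{R}^k,0)$, with the topology induced from the Euclidean space $J^d(k,k)$ of $d$-jets. Two $\mathcal{A}$-equivalent, $d$-determined germs $f,g$ are $\mathcal{A}$-isotopic if there are continuous curves $\sigma:[0,1]\to\operatorname{Diff}^d(m)$ and $\tau:[0,1]\to\operatorname{Diff}^d(n)$ with $\sigma(0),\tau(0)$ the $d$-jets of the identities and $j^dg(0)=j^d(\tau(1)\circ f\circ\sigma(1))(0)$. Equivalently, there are orientation-preserving diffeomorphism-germs $\sigma^+$ of $(\mathbb{R}^m,0)$ and $\tau^+$ of $(\mathbb{R}^n,0)$ with $j^dg(0)=j^d(\tau^+\circ f\circ\sigma^+)(0)$. Morin singularities are stable, hence $d$-determined for some $d$; such a $d$ is fixed. *)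

theory Defs
  imports "HOL-Analysis.Analysis"
begin

(* A germ at 0 is represented by a total function of which only the restriction to a
   neighbourhood of 0 matters; equality of germs is "eventually equal in nhds 0". *)

primrec higher_partial ::
    "'m::finite list \<Rightarrow> (real^'m \<Rightarrow> real^'n::finite) \<Rightarrow> real^'m \<Rightarrow> real^'n" where
  "higher_partial [] f = f"
| "higher_partial (i # I) f =
     (\<lambda>x. frechet_derivative (higher_partial I f) (at x) (axis i 1))"

(* Every iterated partial derivative is (totally) differentiable, hence continuous, on one
   common neighbourhood of 0: this is C^infinity near 0. *)
definition smooth_germ :: "(real^'m::finite \<Rightarrow> real^'n::finite) \<Rightarrow> bool" where
  "smooth_germ f \<longleftrightarrow> f 0 = 0 \<and>
     (\<exists>U. open U \<and> 0 \<in> U \<and> (\<forall>I. \<forall>x\<in>U. higher_partial I f differentiable (at x)))"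

definition diffeo_germ :: "(real^'k::finite \<Rightarrow> real^'k) \<Rightarrow> bool" where
  "diffeo_germ \<phi> \<longleftrightarrow> smooth_germ \<phi> \<and>
     (\<exists>\<psi>. smooth_germ \<psi> \<and> (\<forall>\<^sub>F x in nhds 0. \<psi> (\<phi> x) = x) \<and> (\<forall>\<^sub>F y in nhds 0. \<phi> (\<psi> y) = y))"

definition A_equivalent ::
    "(real^'m::finite \<Rightarrow> real^'n::finite) \<Rightarrow> (real^'m \<Rightarrow> real^'n) \<Rightarrow> bool" where
  "A_equivalent f g \<longleftrightarrow> smooth_germ f \<and> smooth_germ g \<and>
     (\<exists>\<phi> \<Phi>. diffeo_germ \<phi> \<and> diffeo_germ \<Phi> \<and> (\<forall>\<^sub>F x in nhds 0. (\<Phi> \<circ> f \<circ> \<phi>) x = g x))"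

(* The d-jet at 0 is recorded as the family of all partial derivatives at 0 of order at most d,
   padded by 0 to a function on all index lists.  Since only finitely many entries are nonzero,
   the product topology of the function type restricts to the Euclidean topology on the
   finite-dimensional space of d-jets; the repetition of mixed partials is harmless. *)
type_synonym ('m, 'n) jet = "'m list \<Rightarrow> real^'n"

definition jet :: "nat \<Rightarrow> (real^'m::finite \<Rightarrow> real^'n::finite) \<Rightarrow> ('m, 'n) jet" where
  "jet d f = (\<lambda>I. if length I \<le> d then higher_partial I f 0 else 0)"

definition Diff_jets :: "nat \<Rightarrow> ('k::finite, 'k) jet set" where
  "Diff_jets d = {jet d \<phi> | \<phi>. diffeo_germ \<phi>}"

definition determined :: "nat \<Rightarrow> (real^'m::finite \<Rightarrow> real^'n::finite) \<Rightarrow> bool" where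
  "determined d f \<longleftrightarrow> smooth_germ f \<and>
     (\<forall>g. smooth_germ g \<and> jet d g = jet d f \<longrightarrow> A_equivalent g f)"

(* The jet of the composite in the last line depends only on the jets \<sigma> 1 and \<tau> 1, so the
   choice of representatives \<phi> and \<Phi> is immaterial. *)
definition A_isotopic ::
    "nat \<Rightarrow> (real^'m::finite \<Rightarrow> real^'n::finite) \<Rightarrow> (real^'m \<Rightarrow> real^'n) \<Rightarrow> bool" where
  "A_isotopic d f g \<longleftrightarrow> A_equivalent f g \<and> determined d f \<and> determined d g \<and>
     (\<exists>(\<sigma> :: real \<Rightarrow> ('m, 'm) jet) (\<tau> :: real \<Rightarrow> ('n, 'n) jet).
        continuous_on {0..1} \<sigma> \<and> \<sigma> ` {0..1} \<subseteq> Diff_jets d \<and> \<sigma> 0 = jet d id \<and>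
        continuous_on {0..1} \<tau> \<and> \<tau> ` {0..1} \<subseteq> Diff_jets d \<and> \<tau> 0 = jet d id \<and>
        (\<exists>\<phi> \<Phi>. diffeo_germ \<phi> \<and> jet d \<phi> = \<sigma> 1 \<and> diffeo_germ \<Phi> \<and> jet d \<Phi> = \<tau> 1 \<and>
               jet d g = jet d (\<Phi> \<circ> f \<circ> \<phi>)))"

definition A_isotopy_classes ::
    "nat \<Rightarrow> (real^'m::finite \<Rightarrow> real^'n::finite) set \<Rightarrow> (real^'m \<Rightarrow> real^'n) set set" where
  "A_isotopy_classes d C = C // {(f, g). A_isotopic d f g}"

(* e and e' number the coordinates of source and target, starting from 1.
   morin_component is the h_i of the normal form, with a = n - m, the last one being
   h_(a+1).  It is applied to X = (x_1, x_2, ...) and t = x_m. *)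
definition morin_component :: "nat \<Rightarrow> nat \<Rightarrow> nat \<Rightarrow> (nat \<Rightarrow> real) \<Rightarrow> real \<Rightarrow> real" where
  "morin_component a r i X t =
     (if i \<le> a then \<Sum>j=1..r. X ((i - 1) * r + j) * t ^ j
      else (\<Sum>j=1..r - 1. X (a * r + j) * t ^ j) + t ^ (r + 1))"

definition morin_normal_form ::
    "(nat \<Rightarrow> 'm::finite) \<Rightarrow> (nat \<Rightarrow> 'n::finite) \<Rightarrow> nat \<Rightarrow> real^'m \<Rightarrow> real^'n" where
  "morin_normal_form e e' r x =
     (let m = CARD('m); n = CARD('n); X = (\<lambda>k. x $ e k)
      in \<chi> q. let k = inv_into {1..n} e' q
              in if k < m then X k
                 else morin_component (n - m) r (k - (m - 1)) X (X m))"

definition morin_singularity ::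
    "(nat \<Rightarrow> 'm::finite) \<Rightarrow> (nat \<Rightarrow> 'n::finite) \<Rightarrow> nat \<Rightarrow> (real^'m \<Rightarrow> real^'n) \<Rightarrow> bool" where
  "morin_singularity e e' r f \<longleftrightarrow> A_equivalent f (morin_normal_form e e' r)"

end

theory Submission
  imports Defs "HOL-Library.Landau_Symbols"
begin

text \<open>Let \<open>h\<close> be the normal form. An isotopy of jets is the same as a coordinate change by
  orientation preserving germs: \<open>\<phi>(t x) / t\<close> joins a diffeomorphism germ to its linear part, and the
  matrices of positive determinant are connected. Hence the classes correspond to the cosets, in the
  group \<open>{1, -1}\<^sup>2\<close> of pairs of orientations, of the pairs realised by the coordinate
  changes that preserve the \<open>d\<close>-jet of \<open>h\<close>. Sign changes of coordinates produce such pairs.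

  Conversely, let \<open>m = r (a + 1)\<close>, let \<open>h \<circ> \<phi> = \<Psi> \<circ> h\<close> up to order \<open>r + 1\<close>, and let
  \<open>K\<close> and \<open>C\<close> be the kernel and the cokernel of the derivative of \<open>h\<close> at \<open>0\<close>. Comparing
  derivatives along \<open>K\<close> shows that the linear part of \<open>\<phi>\<close> preserves a flag with quotients
  \<open>Hom(K\<^sup>p, C)\<close>, \<open>p = 1, \<dots>, r\<close>. If it acts on \<open>K\<close> by \<open>\<kappa>\<close> and that of \<open>\<Psi>\<close> acts on \<open>C\<close> with
  determinant \<open>b\<close>, then its determinant is \<open>b^r / \<kappa>^((a + 1) r (r + 1) / 2)\<close>, and the determinant
  for \<open>\<Psi>\<close> is \<open>b / \<kappa>\<close> times as large. The signs of these two numbers are the only constraints.\<close>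

subsection \<open>Smooth maps and their jets\<close>

text \<open>The number of classes is the index of a subgroup of a group of order four. One
  nontrivial symmetry is always available, so the index is 1 or 2, and each case needs just one more
  fact: a second symmetry, or a single excluded pair. The converse meets two obstacles. Since
  \<open>d\<close> is any order of determinacy, the identity of jets becomes usable only after
  determinacy has been shown to force \<open>r + 1 \<le> d\<close>. And the maps are merely smooth,
  so orders of vanishing as \<open>t\<close> tends to 0 replace power series. They are compared at
  the points \<open>t\<close> times the last basis vector. There the derivative of \<open>h\<close>
  in the direction of the coordinate \<open>(i - 1) * r + p\<close> is, apart from the target copy
  of a coordinate below \<open>m\<close>, a multiple of \<open>t ^ p\<close> in the
  \<open>i\<close>-th of the last \<open>a + 1\<close> components; this is the origin of the
  filtration by \<open>p\<close>. Equal \<open>(r + 1)\<close>-jets make the first derivatives agree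
  up to \<open>O(t ^ (r + 1))\<close>, one order beyond the last relevant power
  \<open>t ^ r\<close>.\<close>

abbreviation partial :: "'m::finite \<Rightarrow> (real^'m \<Rightarrow> real^'n::finite) \<Rightarrow> real^'m \<Rightarrow> real^'n" where
  "partial i f \<equiv> (\<lambda>x. frechet_derivative f (at x) (axis i 1))"

text \<open>The last entry of an index list is differentiated first, so appending at the end passes
  to a partial derivative of the function itself. Inductions that change the function therefore peel
  lists from the right.\<close>

lemma higher_partial_append: "higher_partial (I @ J) f = higher_partial I (higher_partial J f)"
  by (induction I) auto

lemma has_derivative_cong_open:
  assumes "open U" "x \<in> U" "\<And>y. y \<in> U \<Longrightarrow> f y = g y"
  shows "(f has_derivative D) (at x) \<longleftrightarrow> (g has_derivative D) (at x)"
  using assms by (metis has_derivative_transform_within_open)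

lemma differentiable_cong_open:
  assumes "open U" "x \<in> U" "\<And>y. y \<in> U \<Longrightarrow> f y = g y"
  shows "f differentiable (at x) \<longleftrightarrow> g differentiable (at x)"
  unfolding differentiable_def using has_derivative_cong_open[OF assms] by simp

lemma frechet_derivative_cong_open:
  assumes "open U" "x \<in> U" "\<And>y. y \<in> U \<Longrightarrow> f y = g y"
  shows "frechet_derivative f (at x) = frechet_derivative g (at x)"
  unfolding frechet_derivative_def using has_derivative_cong_open[OF assms] by simp

lemma higher_partial_cong_open:
  assumes "open U" "\<And>y. y \<in> U \<Longrightarrow> f y = g y" "x \<in> U"
  shows "higher_partial I f x = higher_partial I g x"
  using assms(3)
proof (induction I arbitrary: x)
  case (Cons i I)
  show ?case
    using frechet_derivative_cong_open[OF assms(1) Cons.prems, of "higher_partial I f" "higher_partial I g"]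
      Cons.IH by simp
qed (use assms in simp)

definition smooth_on :: "(real^'m::finite) set \<Rightarrow> (real^'m \<Rightarrow> real^'n::finite) \<Rightarrow> bool" where
  "smooth_on U f \<longleftrightarrow> (\<forall>I. \<forall>x\<in>U. higher_partial I f differentiable (at x))"

lemma smooth_germ_iff:
  "smooth_germ f \<longleftrightarrow> f 0 = 0 \<and> (\<exists>U. open U \<and> 0 \<in> U \<and> smooth_on U f)"
  by (auto simp: smooth_germ_def smooth_on_def)

lemma smooth_on_subset: "smooth_on U f \<Longrightarrow> V \<subseteq> U \<Longrightarrow> smooth_on V f"
  unfolding smooth_on_def by blast

lemma smooth_on_differentiable: "smooth_on U f \<Longrightarrow> x \<in> U \<Longrightarrow> f differentiable (at x)"
  unfolding smooth_on_def by (metis higher_partial.simps(1))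

lemma smooth_on_partial: "smooth_on U f \<Longrightarrow> smooth_on U (partial i f)"
  unfolding smooth_on_def
proof (intro allI ballI)
  fix I x assume *: "\<forall>I. \<forall>x\<in>U. higher_partial I f differentiable at x" "x \<in> U"
  have "higher_partial (I @ [i]) f differentiable at x" using * by blast
  then show "higher_partial I (partial i f) differentiable at x"
    by (simp add: higher_partial_append)
qed

lemma smooth_on_cong:
  assumes "open U" "\<And>y. y \<in> U \<Longrightarrow> f y = g y" "smooth_on U f"
  shows "smooth_on U g"
  unfolding smooth_on_def
proof (intro allI ballI)
  fix I x assume x: "x \<in> U"
  have "higher_partial I f differentiable at x" using assms x unfolding smooth_on_def by blast
  then show "higher_partial I g differentiable at x"
    by (subst (asm) differentiable_cong_open[OF assms(1) x, of _ "higher_partial I g"])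
      (use higher_partial_cong_open[OF assms(1,2)] in auto)
qed

lemma higher_partial_zero: "higher_partial I (\<lambda>x. 0) = (\<lambda>x. 0)"
  by (induction I) auto

lemma higher_partial_const: "higher_partial I (\<lambda>x. c) = (if I = [] then (\<lambda>x. c) else (\<lambda>x. 0))"
proof (induction I)
  case (Cons i I) then show ?case by (cases I) auto
qed auto

lemma smooth_on_const: "smooth_on U (\<lambda>x. c)"
  unfolding smooth_on_def by (auto simp: higher_partial_const)

section \<open>Equality of jets and its behaviour under composition\<close>

definition jet_eq :: "nat \<Rightarrow> (real^'m::finite \<Rightarrow> real^'n::finite) \<Rightarrow> (real^'m \<Rightarrow> real^'n) \<Rightarrow> bool" where
  "jet_eq d f g \<longleftrightarrow> (\<forall>I. length I \<le> d \<longrightarrow> higher_partial I f 0 = higher_partial I g 0)"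

lemma jet_eq_iff: "jet_eq d f g \<longleftrightarrow> jet d f = jet d g"
  unfolding jet_eq_def jet_def fun_eq_iff by auto

lemma jet_eq_mono: "jet_eq d f g \<Longrightarrow> d' \<le> d \<Longrightarrow> jet_eq d' f g"
  unfolding jet_eq_def by auto

lemma jet_eq_0: "jet_eq d f g \<Longrightarrow> f 0 = g 0"
  unfolding jet_eq_def by (metis higher_partial.simps(1) le0 list.size(3))

lemma jet_eq_partial: "jet_eq (Suc d) f g \<Longrightarrow> jet_eq d (partial i f) (partial i g)"
  unfolding jet_eq_def
proof (intro allI impI)
  fix I :: "'a list"
  assume *: "\<forall>I. length I \<le> Suc d \<longrightarrow> higher_partial I f 0 = higher_partial I g 0" "length I \<le> d"
  then have "higher_partial (I @ [i]) f 0 = higher_partial (I @ [i]) g 0" by simp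
  then show "higher_partial I (partial i f) 0 = higher_partial I (partial i g) 0"
    by (simp add: higher_partial_append)
qed

lemma jet_eq_refl: "jet_eq d f f" by (simp add: jet_eq_def)
lemma jet_eq_sym: "jet_eq d f g \<Longrightarrow> jet_eq d g f" by (simp add: jet_eq_def)
lemma jet_eq_trans: "jet_eq d f g \<Longrightarrow> jet_eq d g h \<Longrightarrow> jet_eq d f h" by (simp add: jet_eq_def)

lemma jet_eq_cong_open:
  assumes "open U" "0 \<in> U" "\<And>y. y \<in> U \<Longrightarrow> f y = g y"
  shows "jet_eq d f g"
  using higher_partial_cong_open[OF assms(1,3,2)] by (simp add: jet_eq_def)

text \<open>Pairs of functions with the same \<open>d\<close>-jet, closed under the operations which occur when
  a composite is differentiated: comparing a function with itself for all \<open>d\<close> yields its smoothness,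
  so smoothness and jets of composites are treated by one induction.\<close>

inductive jet_pair ::
    "(real^'m::finite) set \<Rightarrow> (real^'n::finite) set \<Rightarrow> (real^'m \<Rightarrow> real^'n) \<Rightarrow> (real^'m \<Rightarrow> real^'n) \<Rightarrow>
     nat \<Rightarrow> (real^'m \<Rightarrow> real^'p::finite) \<Rightarrow> (real^'m \<Rightarrow> real^'p) \<Rightarrow> bool"
  for U V f f' where
  base: "smooth_on U w \<Longrightarrow> smooth_on U w' \<Longrightarrow> jet_eq d w w' \<Longrightarrow> jet_pair U V f f' d w w'"
| comp: "smooth_on V \<Phi> \<Longrightarrow> smooth_on V \<Phi>' \<Longrightarrow> jet_eq d \<Phi> \<Phi>' \<Longrightarrow> jet_eq d f f' \<Longrightarrow>
    jet_pair U V f f' d (\<lambda>x. \<Phi> (f x)) (\<lambda>x. \<Phi>' (f' x))"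
| mult: "smooth_on U g \<Longrightarrow> smooth_on U g' \<Longrightarrow> jet_eq d g g' \<Longrightarrow> jet_pair U V f f' d w w' \<Longrightarrow>
    jet_pair U V f f' d (\<lambda>x. ((g::real^'m \<Rightarrow> real^'n) x $ k) *\<^sub>R w x) (\<lambda>x. (g' x $ k) *\<^sub>R w' x)"
| add: "jet_pair U V f f' d w w' \<Longrightarrow> jet_pair U V f f' d v v' \<Longrightarrow>
    jet_pair U V f f' d (\<lambda>x. w x + v x) (\<lambda>x. w' x + v' x)"

lemma jet_pair_mono: "jet_pair U V f f' d w w' \<Longrightarrow> d' \<le> d \<Longrightarrow> jet_pair U V f f' d' w w'"
  by (induction rule: jet_pair.induct) (auto intro: jet_pair.intros jet_eq_mono)

lemma jet_pair_sum:
  assumes "\<And>k. k \<in> K \<Longrightarrow> jet_pair U V f f' d (w k) (w' k)"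
  shows "jet_pair U V f f' d (\<lambda>x. \<Sum>k\<in>K. w k x) (\<lambda>x. \<Sum>k\<in>K. w' k x)"
proof (cases "finite K")
  case True
  then show ?thesis using assms
  proof (induction K)
    case empty
    show ?case by (auto intro: jet_pair.base simp: smooth_on_const jet_eq_refl)
  next
    case (insert k K)
    then show ?case by (auto intro: jet_pair.add)
  qed
next
  case False
  then show ?thesis by (auto intro: jet_pair.base simp: smooth_on_const jet_eq_refl)
qed

lemma has_derivative_frechet: "f differentiable (at x) \<Longrightarrow> (f has_derivative frechet_derivative f (at x)) (at x)"
  by (simp add: frechet_derivative_works)

lemma partial_comp:
  fixes f :: "real^'m::finite \<Rightarrow> real^'n::finite" and \<Phi> :: "real^'n \<Rightarrow> real^'p::finite"
  assumes "f differentiable (at x)" "\<Phi> differentiable (at (f x))"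
  shows "(\<lambda>x. \<Phi> (f x)) differentiable (at x)"
    and "partial i (\<lambda>x. \<Phi> (f x)) x = (\<Sum>k\<in>UNIV. (partial i f x $ k) *\<^sub>R partial k \<Phi> (f x))"
proof -
  let ?D = "frechet_derivative \<Phi> (at (f x))" and ?E = "frechet_derivative f (at x)"
  have 1: "((\<lambda>x. \<Phi> (f x)) has_derivative (\<lambda>v. ?D (?E v))) (at x)"
    using has_derivative_compose[OF has_derivative_frechet[OF assms(1)], of \<Phi> "?D"] has_derivative_frechet[OF assms(2)] by simp
  then show "(\<lambda>x. \<Phi> (f x)) differentiable (at x)" by (auto simp: differentiable_def)
  have lin: "linear ?D" using assms(2) by (rule linear_frechet_derivative)
  have "partial i (\<lambda>x. \<Phi> (f x)) x = ?D (?E (axis i 1))"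
    by (simp only: frechet_derivative_at[OF 1, symmetric])
  also have "?E (axis i 1) = (\<Sum>k\<in>UNIV. (?E (axis i 1) $ k) *\<^sub>R axis k 1)"
    using basis_expansion[of "?E (axis i 1)"] by (simp add: scalar_mult_eq_scaleR)
  also have "?D \<dots> = (\<Sum>k\<in>UNIV. (?E (axis i 1) $ k) *\<^sub>R ?D (axis k 1))"
    by (simp add: linear_sum[OF lin] linear_cmul[OF lin])
  finally show "partial i (\<lambda>x. \<Phi> (f x)) x = (\<Sum>k\<in>UNIV. (partial i f x $ k) *\<^sub>R partial k \<Phi> (f x))" .
qed

lemma partial_mult:
  fixes g :: "real^'m::finite \<Rightarrow> real^'n::finite" and w :: "real^'m \<Rightarrow> real^'p::finite"
  assumes "g differentiable (at x)" "w differentiable (at x)"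
  shows "(\<lambda>x. (g x $ k) *\<^sub>R w x) differentiable (at x)"
    and "partial i (\<lambda>x. (g x $ k) *\<^sub>R w x) x = (partial i g x $ k) *\<^sub>R w x + (g x $ k) *\<^sub>R partial i w x"
proof -
  have 0: "((\<lambda>x. g x $ k) has_derivative (\<lambda>v. frechet_derivative g (at x) v $ k)) (at x)"
    using has_derivative_frechet[OF assms(1)] bounded_linear.has_derivative[OF bounded_linear_vec_nth] by blast
  have 1: "((\<lambda>x. (g x $ k) *\<^sub>R w x) has_derivative
      (\<lambda>v. (g x $ k) *\<^sub>R frechet_derivative w (at x) v + (frechet_derivative g (at x) v $ k) *\<^sub>R w x)) (at x)"
    using has_derivative_scaleR[OF 0 has_derivative_frechet[OF assms(2)]] by simp
  then show "(\<lambda>x. (g x $ k) *\<^sub>R w x) differentiable (at x)" by (auto simp: differentiable_def)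
  show "partial i (\<lambda>x. (g x $ k) *\<^sub>R w x) x = (partial i g x $ k) *\<^sub>R w x + (g x $ k) *\<^sub>R partial i w x"
    unfolding frechet_derivative_at[OF 1, symmetric] by (rule add.commute)
qed

lemma partial_add:
  assumes "v differentiable (at x)" "w differentiable (at x)"
  shows "partial i (\<lambda>x. v x + w x) x = partial i v x + partial i w x"
  by (simp only: frechet_derivative_at[OF has_derivative_add[OF has_derivative_frechet[OF assms(1)] has_derivative_frechet[OF assms(2)]], symmetric])

context
  fixes U :: "(real^'m::finite) set" and V :: "(real^'n::finite) set" and f f' :: "real^'m \<Rightarrow> real^'n"
  assumes U: "open U" and smf: "smooth_on U f" "smooth_on U f'"
    and fV: "f ` U \<subseteq> V" "f' ` U \<subseteq> V" and f0: "f 0 = 0" "f' 0 = 0"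
begin

lemma jet_pair_differentiable:
  "jet_pair U V f f' d w w' \<Longrightarrow> x \<in> U \<Longrightarrow> w differentiable (at x) \<and> w' differentiable (at x)"
proof (induction rule: jet_pair.induct)
  case (comp \<Phi> \<Phi>' d)
  then have "f differentiable at x" "f' differentiable at x" "\<Phi> differentiable at (f x)" "\<Phi>' differentiable at (f' x)"
    using fV smf by (auto intro: smooth_on_differentiable)
  then show ?case using partial_comp(1) by blast
next
  case (mult g g' d w w' k)
  then have "g differentiable at x" "g' differentiable at x"
    by (auto intro: smooth_on_differentiable)
  then show ?case using partial_mult(1) mult by blast
qed (auto dest: smooth_on_differentiable)

lemma jet_pair_zero: "jet_pair U V f f' d w w' \<Longrightarrow> w 0 = w' 0"
  by (induction rule: jet_pair.induct) (auto simp: f0 dest: jet_eq_0)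

text \<open>Chain and product rule turn a derivative into sums of products whose factors are again
  of the listed kinds, at the cost of one order of the jets. Agreement is claimed only on
  \<open>U\<close>, where these rules apply.\<close>

lemma jet_pair_partial:
  "jet_pair U V f f' (Suc d) w w' \<Longrightarrow>
    \<exists>v v'. jet_pair U V f f' d v v' \<and> (\<forall>x\<in>U. partial i w x = v x \<and> partial i w' x = v' x)"
proof (induction "Suc d" w w' rule: jet_pair.induct)
  case (base w w')
  then show ?case
    by (intro exI[of _ "partial i w"] exI[of _ "partial i w'"])
      (auto intro: jet_pair.base smooth_on_partial jet_eq_partial)
next
  case (comp \<Phi> \<Phi>')
  let ?v = "\<lambda>x. \<Sum>k\<in>UNIV. (partial i f x $ k) *\<^sub>R partial k \<Phi> (f x)"
  let ?v' = "\<lambda>x. \<Sum>k\<in>UNIV. (partial i f' x $ k) *\<^sub>R partial k \<Phi>' (f' x)"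
  have "jet_pair U V f f' d ?v ?v'"
    using comp smf by (intro jet_pair_sum jet_pair.mult jet_pair.comp smooth_on_partial jet_eq_partial)
      (auto intro: jet_eq_mono)
  moreover have "\<forall>x\<in>U. partial i (\<lambda>x. \<Phi> (f x)) x = ?v x \<and> partial i (\<lambda>x. \<Phi>' (f' x)) x = ?v' x"
    using comp fV smf by (intro ballI conjI partial_comp(2)) (auto intro: smooth_on_differentiable)
  ultimately show ?case by blast
next
  case (mult g g' w w' k)
  then obtain v v' where v: "jet_pair U V f f' d v v'"
    "\<forall>x\<in>U. partial i w x = v x \<and> partial i w' x = v' x" by blast
  let ?v = "\<lambda>x. (partial i g x $ k) *\<^sub>R w x + (g x $ k) *\<^sub>R v x"
  let ?v' = "\<lambda>x. (partial i g' x $ k) *\<^sub>R w' x + (g' x $ k) *\<^sub>R v' x"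
  have "jet_pair U V f f' d ?v ?v'"
    using mult v by (intro jet_pair.add jet_pair.mult smooth_on_partial jet_eq_partial v)
      (auto intro: jet_eq_mono jet_pair_mono)
  moreover have "\<forall>x\<in>U. partial i (\<lambda>x. (g x $ k) *\<^sub>R w x) x = ?v x \<and> partial i (\<lambda>x. (g' x $ k) *\<^sub>R w' x) x = ?v' x"
  proof (intro ballI)
    fix x assume x: "x \<in> U"
    have "g differentiable at x" "g' differentiable at x" "w differentiable at x" "w' differentiable at x"
      using mult x jet_pair_differentiable by (blast intro: smooth_on_differentiable)+
    then show "partial i (\<lambda>x. (g x $ k) *\<^sub>R w x) x = ?v x \<and> partial i (\<lambda>x. (g' x $ k) *\<^sub>R w' x) x = ?v' x"
      using v x by (simp add: partial_mult(2))
  qed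
  ultimately show ?case by blast
next
  case (add w w' v v')
  then obtain p p' q q' where pq: "jet_pair U V f f' d p p'" "jet_pair U V f f' d q q'"
    "\<forall>x\<in>U. partial i w x = p x \<and> partial i w' x = p' x"
    "\<forall>x\<in>U. partial i v x = q x \<and> partial i v' x = q' x" by metis
  have "\<forall>x\<in>U. partial i (\<lambda>x. w x + v x) x = p x + q x \<and> partial i (\<lambda>x. w' x + v' x) x = p' x + q' x"
  proof (intro ballI)
    fix x assume x: "x \<in> U"
    have "v differentiable at x" "v' differentiable at x" "w differentiable at x" "w' differentiable at x"
      using add x jet_pair_differentiable by blast+
    then show "partial i (\<lambda>x. w x + v x) x = p x + q x \<and> partial i (\<lambda>x. w' x + v' x) x = p' x + q' x"
      using pq x by (simp add: partial_add)
  qed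
  then show ?case using jet_pair.add[OF pq(1,2)] by blast
qed

lemma jet_pair_higher_partial:
  assumes "jet_pair U V f f' d w w'" "length I \<le> d"
  shows "(\<forall>x\<in>U. higher_partial I w differentiable (at x) \<and> higher_partial I w' differentiable (at x))
    \<and> (0 \<in> U \<longrightarrow> higher_partial I w 0 = higher_partial I w' 0)"
  using assms
proof (induction I arbitrary: d w w' rule: rev_induct)
  case Nil
  then show ?case using jet_pair_differentiable jet_pair_zero by simp blast
next
  case (snoc i I)
  then obtain d' where d: "d = Suc d'" "length I \<le> d'" by (cases d) auto
  obtain v v' where v: "jet_pair U V f f' d' v v'"
    "\<forall>x\<in>U. partial i w x = v x \<and> partial i w' x = v' x"
    using jet_pair_partial snoc.prems(1) unfolding d by blast
  note IH = snoc.IH[OF v(1) d(2)]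
  have c: "higher_partial (I @ [i]) w x = higher_partial I v x"
          "higher_partial (I @ [i]) w' x = higher_partial I v' x" if "x \<in> U" for x
    using higher_partial_cong_open[OF U _ that, of "partial i w" v I]
      higher_partial_cong_open[OF U _ that, of "partial i w'" v' I] v(2)
    by (simp_all add: higher_partial_append)
  have "higher_partial (I @ [i]) w differentiable at x" "higher_partial (I @ [i]) w' differentiable at x"
    if "x \<in> U" for x
  proof -
    show "higher_partial (I @ [i]) w differentiable at x"
      by (subst differentiable_cong_open[OF U that, of _ "higher_partial I v"]) (use IH c that in auto)
    show "higher_partial (I @ [i]) w' differentiable at x"
      by (subst differentiable_cong_open[OF U that, of _ "higher_partial I v'"]) (use IH c that in auto)
  qed
  then show ?case using IH c by simp
qed

lemma jet_pair_jet_eq: "jet_pair U V f f' d w w' \<Longrightarrow> 0 \<in> U \<Longrightarrow> jet_eq d w w'"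
  unfolding jet_eq_def using jet_pair_higher_partial by blast

end

lemma jet_pair_smooth_on:
  assumes "open U" "smooth_on U f" "f ` U \<subseteq> V" "f 0 = 0" "\<And>d. jet_pair U V f f d w w"
  shows "smooth_on U w"
  unfolding smooth_on_def
  using jet_pair_higher_partial[OF assms(1,2,2,3,3,4,4) assms(5) order_refl] by blast

lemma smooth_on_comp:
  assumes "open U" "smooth_on U f" "f ` U \<subseteq> V" "f 0 = 0" "smooth_on V \<Phi>"
  shows "smooth_on U (\<lambda>x. \<Phi> (f x))"
  using assms by (intro jet_pair_smooth_on[OF assms(1-4)] jet_pair.comp jet_eq_refl) auto

lemma smooth_on_mult:
  fixes g :: "real^'m::finite \<Rightarrow> real^'n::finite"
  assumes "open U" "smooth_on U g" "smooth_on U w"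
  shows "smooth_on U (\<lambda>x. (g x $ k) *\<^sub>R w x)"
  \<comment> \<open>Only products occur here, so the zero map can stand in for the inner map of
    \<open>jet_pair\<close>.\<close>
  by (rule jet_pair_smooth_on[where f="\<lambda>x. 0::real^'n" and V=UNIV])
    (use assms in \<open>auto intro: jet_pair.mult jet_pair.base jet_eq_refl smooth_on_const\<close>)

lemma smooth_on_add:
  assumes "open U" "smooth_on U v" "smooth_on U w"
  shows "smooth_on U (\<lambda>x. v x + w x)"
  by (rule jet_pair_smooth_on[where f="\<lambda>x. 0::real^1" and V=UNIV])
    (use assms in \<open>auto intro: jet_pair.add jet_pair.base jet_eq_refl smooth_on_const\<close>)

lemma smooth_on_sum:
  assumes "open U" "\<And>k. k \<in> K \<Longrightarrow> smooth_on U (w k)"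
  shows "smooth_on U (\<lambda>x. \<Sum>k\<in>K. w k x)"
  by (rule jet_pair_smooth_on[where f="\<lambda>x. 0::real^1" and V=UNIV])
    (use assms in \<open>auto intro: jet_pair_sum jet_pair.base jet_eq_refl smooth_on_const\<close>)

lemma jet_eq_comp:
  assumes "smooth_germ f" "smooth_germ f'" "smooth_germ \<Phi>" "smooth_germ \<Phi>'"
    "jet_eq d f f'" "jet_eq d \<Phi> \<Phi>'"
  shows "jet_eq d (\<Phi> \<circ> f) (\<Phi>' \<circ> f')"
proof -
  obtain U1 U2 V1 V2 where o: "open U1" "0 \<in> U1" "smooth_on U1 f" "open U2" "0 \<in> U2" "smooth_on U2 f'"
    "open V1" "0 \<in> V1" "smooth_on V1 \<Phi>" "open V2" "0 \<in> V2" "smooth_on V2 \<Phi>'"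
    and z: "f 0 = 0" "f' 0 = 0"
    using assms unfolding smooth_germ_iff by metis
  let ?V = "V1 \<inter> V2"
  have "continuous (at 0) f" "continuous (at 0) f'"
    using o by (auto intro!: differentiable_imp_continuous_within smooth_on_differentiable)
  then have "(f \<longlongrightarrow> 0) (nhds 0)" "(f' \<longlongrightarrow> 0) (nhds 0)"
    using z by (simp_all add: continuous_at tendsto_nhds_iff)
  then have "\<forall>\<^sub>F x in nhds 0. f x \<in> ?V" "\<forall>\<^sub>F x in nhds 0. f' x \<in> ?V"
    using o topological_tendstoD[of f 0 "nhds 0" ?V] topological_tendstoD[of f' 0 "nhds 0" ?V] by auto
  then obtain W where W: "open W" "0 \<in> W" "\<forall>x\<in>W. f x \<in> ?V \<and> f' x \<in> ?V"
    unfolding eventually_nhds by (metis IntI Int_iff open_Int)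
  let ?U = "W \<inter> U1 \<inter> U2"
  have "jet_pair ?U ?V f f' d (\<lambda>x. \<Phi> (f x)) (\<lambda>x. \<Phi>' (f' x))"
    using o assms(5,6) by (intro jet_pair.comp) (auto intro: smooth_on_subset)
  then have "jet_eq d (\<lambda>x. \<Phi> (f x)) (\<lambda>x. \<Phi>' (f' x))"
    using o W z by (intro jet_pair_jet_eq[of ?U f f' ?V]) (auto intro: smooth_on_subset)
  then show ?thesis by (simp add: o_def)
qed

lemma smooth_germ_comp:
  assumes "smooth_germ f" "smooth_germ \<Phi>"
  shows "smooth_germ (\<Phi> \<circ> f)"
proof -
  obtain U V where o: "open U" "0 \<in> U" "smooth_on U f" "open V" "0 \<in> V" "smooth_on V \<Phi>"
    and z: "f 0 = 0" "\<Phi> 0 = 0"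
    using assms unfolding smooth_germ_iff by metis
  have "continuous_on U f"
    by (intro continuous_at_imp_continuous_on ballI differentiable_imp_continuous_within
        smooth_on_differentiable[OF o(3)])
  then have W: "open (U \<inter> f -` V)" using o by (auto intro: continuous_open_preimage)
  have "smooth_on (U \<inter> f -` V) (\<lambda>x. \<Phi> (f x))"
    by (rule smooth_on_comp[OF W smooth_on_subset[OF o(3)] _ z(1) o(6)]) auto
  then show ?thesis unfolding smooth_germ_iff o_def using W o z by auto
qed

subsection \<open>Germs of diffeomorphisms\<close>

lemma smooth_germ_tendsto:
  assumes "smooth_germ f"
  shows "(f \<longlongrightarrow> 0) (nhds 0)"
proof -
  obtain U where "0 \<in> U" "smooth_on U f" "f 0 = 0"
    using assms unfolding smooth_germ_iff by metis
  then have "continuous (at 0) f" "f 0 = 0"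
    by (auto intro!: differentiable_imp_continuous_within smooth_on_differentiable)
  then show ?thesis by (simp add: continuous_at tendsto_nhds_iff)
qed

lemma smooth_germ_eventually:
  assumes "smooth_germ f" "\<forall>\<^sub>F y in nhds 0. P y"
  shows "\<forall>\<^sub>F x in nhds 0. P (f x)"
  using eventually_compose_filterlim[OF assms(2) smooth_germ_tendsto[OF assms(1)]] .

lemma jet_eq_cong:
  assumes "\<forall>\<^sub>F x in nhds 0. f x = g x"
  shows "jet_eq d f g"
  using assms jet_eq_cong_open unfolding eventually_nhds by metis

lemma smooth_germ_cong:
  assumes "smooth_germ f" "\<forall>\<^sub>F x in nhds 0. f x = g x"
  shows "smooth_germ g"
proof -
  obtain U V where o: "open U" "0 \<in> U" "smooth_on U f" "open V" "0 \<in> V" "\<forall>x\<in>V. f x = g x" "f 0 = 0"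
    using assms unfolding smooth_germ_iff eventually_nhds by metis
  have "smooth_on (U \<inter> V) g"
    using o smooth_on_subset[OF o(3)] by (intro smooth_on_cong[of "U \<inter> V" f g]) auto
  then show ?thesis unfolding smooth_germ_iff using o by (metis IntI open_Int)
qed

lemma smooth_germ_id: "smooth_germ (id :: real^'m::finite \<Rightarrow> real^'m)"
proof -
  have "higher_partial I (id :: real^'m \<Rightarrow> real^'m) = (if I = [] then id else higher_partial (butlast I) (\<lambda>x. axis (last I) 1))" for I
    by (cases I rule: rev_cases) (auto simp: higher_partial_append)
  then have "smooth_on UNIV (id :: real^'m \<Rightarrow> real^'m)"
    unfolding smooth_on_def by (simp add: higher_partial_const id_def differentiable_ident)
  then show ?thesis unfolding smooth_germ_iff by auto
qed

lemma diffeo_germ_id: "diffeo_germ id"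
  unfolding diffeo_germ_def using smooth_germ_id by (intro conjI exI[of _ id]) auto

lemma diffeo_germ_smooth: "diffeo_germ \<phi> \<Longrightarrow> smooth_germ \<phi>"
  by (simp add: diffeo_germ_def)

lemma diffeo_germ_inverse:
  assumes "diffeo_germ \<phi>"
  obtains \<psi> where "diffeo_germ \<psi>" "\<forall>\<^sub>F x in nhds 0. \<psi> (\<phi> x) = x" "\<forall>\<^sub>F y in nhds 0. \<phi> (\<psi> y) = y"
proof -
  obtain \<psi> where "smooth_germ \<psi>" "\<forall>\<^sub>F x in nhds 0. \<psi> (\<phi> x) = x" "\<forall>\<^sub>F y in nhds 0. \<phi> (\<psi> y) = y"
    using assms unfolding diffeo_germ_def by blast
  moreover from this have "diffeo_germ \<psi>" using assms unfolding diffeo_germ_def by blast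
  ultimately show ?thesis using that by blast
qed

lemma diffeo_germ_comp:
  assumes "diffeo_germ \<phi>" "diffeo_germ \<eta>"
  shows "diffeo_germ (\<phi> \<circ> \<eta>)"
proof -
  obtain \<phi>i where i: "diffeo_germ \<phi>i" "\<forall>\<^sub>F x in nhds 0. \<phi>i (\<phi> x) = x" "\<forall>\<^sub>F y in nhds 0. \<phi> (\<phi>i y) = y"
    using assms(1) by (rule diffeo_germ_inverse)
  obtain \<eta>i where j: "diffeo_germ \<eta>i" "\<forall>\<^sub>F x in nhds 0. \<eta>i (\<eta> x) = x" "\<forall>\<^sub>F y in nhds 0. \<eta> (\<eta>i y) = y"
    using assms(2) by (rule diffeo_germ_inverse)
  note sm = diffeo_germ_smooth[OF assms(1)] diffeo_germ_smooth[OF assms(2)]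
    diffeo_germ_smooth[OF i(1)] diffeo_germ_smooth[OF j(1)]
  have "\<forall>\<^sub>F x in nhds 0. (\<eta>i \<circ> \<phi>i) ((\<phi> \<circ> \<eta>) x) = x"
    using smooth_germ_eventually[OF sm(2) i(2)] j(2) by eventually_elim simp
  moreover have "\<forall>\<^sub>F x in nhds 0. (\<phi> \<circ> \<eta>) ((\<eta>i \<circ> \<phi>i) x) = x"
    using smooth_germ_eventually[OF sm(3) j(3)] i(3) by eventually_elim simp
  ultimately show ?thesis unfolding diffeo_germ_def
    using smooth_germ_comp[OF sm(2,1)] smooth_germ_comp[OF sm(3,4)] by blast
qed

lemma smooth_germ_comp3:
  assumes "smooth_germ f" "diffeo_germ \<phi>" "diffeo_germ \<Phi>"
  shows "smooth_germ (\<Phi> \<circ> f \<circ> \<phi>)"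
  using assms by (intro smooth_germ_comp diffeo_germ_smooth)

lemma A_equivalentI:
  assumes "smooth_germ f" "diffeo_germ \<phi>" "diffeo_germ \<Phi>" "\<forall>\<^sub>F x in nhds 0. (\<Phi> \<circ> f \<circ> \<phi>) x = g x"
  shows "A_equivalent f g"
  unfolding A_equivalent_def
  using assms smooth_germ_cong[OF smooth_germ_comp3[OF assms(1-3)] assms(4)] by blast

lemma A_equivalent_refl: "smooth_germ f \<Longrightarrow> A_equivalent f f"
  by (rule A_equivalentI[of f id id]) (auto simp: diffeo_germ_id)

lemma A_equivalent_sym:
  assumes "A_equivalent f g"
  shows "A_equivalent g f"
proof -
  obtain \<phi> \<Phi> where *: "smooth_germ f" "smooth_germ g" "diffeo_germ \<phi>" "diffeo_germ \<Phi>"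
    "\<forall>\<^sub>F x in nhds 0. \<Phi> (f (\<phi> x)) = g x"
    using assms unfolding A_equivalent_def by auto
  obtain \<phi>i where i: "diffeo_germ \<phi>i" "\<forall>\<^sub>F y in nhds 0. \<phi> (\<phi>i y) = y"
    using *(3) by (rule diffeo_germ_inverse)
  obtain \<Phi>i where j: "diffeo_germ \<Phi>i" "\<forall>\<^sub>F y in nhds 0. \<Phi>i (\<Phi> y) = y"
    using *(4) by (rule diffeo_germ_inverse)
  have "\<forall>\<^sub>F x in nhds 0. (\<Phi>i \<circ> g \<circ> \<phi>i) x = f x"
    using smooth_germ_eventually[OF diffeo_germ_smooth[OF i(1)] *(5)] i(2)
      smooth_germ_eventually[OF *(1) j(2)]
    by eventually_elim (metis comp_apply)
  then show ?thesis using A_equivalentI[OF *(2) i(1) j(1)] by blast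
qed

lemma A_equivalent_trans:
  assumes "A_equivalent f g" "A_equivalent g h"
  shows "A_equivalent f h"
proof -
  obtain \<phi> \<Phi> where *: "smooth_germ f" "diffeo_germ \<phi>" "diffeo_germ \<Phi>"
    "\<forall>\<^sub>F x in nhds 0. \<Phi> (f (\<phi> x)) = g x"
    using assms unfolding A_equivalent_def by auto
  obtain \<eta> \<Psi> where **: "diffeo_germ \<eta>" "diffeo_germ \<Psi>"
    "\<forall>\<^sub>F x in nhds 0. \<Psi> (g (\<eta> x)) = h x"
    using assms unfolding A_equivalent_def by auto
  have "\<forall>\<^sub>F x in nhds 0. ((\<Psi> \<circ> \<Phi>) \<circ> f \<circ> (\<phi> \<circ> \<eta>)) x = h x"
    using smooth_germ_eventually[OF diffeo_germ_smooth[OF **(1)] *(4)] **(3)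
    by eventually_elim simp
  then show ?thesis
    by (rule A_equivalentI[OF *(1) diffeo_germ_comp[OF *(2) **(1)] diffeo_germ_comp[OF **(2) *(3)]])
qed

lemma jet_eq_comp3:
  assumes "smooth_germ f" "smooth_germ g" "jet_eq d f g" "diffeo_germ \<phi>" "diffeo_germ \<Phi>"
  shows "jet_eq d (\<Phi> \<circ> f \<circ> \<phi>) (\<Phi> \<circ> g \<circ> \<phi>)"
  using assms by (intro jet_eq_comp smooth_germ_comp diffeo_germ_smooth jet_eq_refl)

text \<open>The coordinate change from \<open>g\<close> to \<open>f\<close> carries a germ with the
  jet of \<open>g\<close> to a germ with the jet of \<open>f\<close>, because jets of composites
  depend only on jets. Thus determinacy passes from the given germ to the normal form and to its
  whole class.\<close>

lemma determined_A_equivalent: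
  assumes "determined d f" "A_equivalent f g"
  shows "determined d g"
proof -
  obtain \<phi> \<Phi> where *: "smooth_germ g" "smooth_germ f" "diffeo_germ \<phi>" "diffeo_germ \<Phi>"
    "\<forall>\<^sub>F x in nhds 0. (\<Phi> \<circ> g \<circ> \<phi>) x = f x"
    using A_equivalent_sym[OF assms(2)] unfolding A_equivalent_def by auto
  have "A_equivalent k g" if k: "smooth_germ k" "jet_eq d k g" for k
  proof -
    have "jet_eq d (\<Phi> \<circ> k \<circ> \<phi>) f"
      using jet_eq_trans[OF jet_eq_comp3[OF k(1) *(1) k(2) *(3,4)] jet_eq_cong[OF *(5)]] .
    then have "A_equivalent (\<Phi> \<circ> k \<circ> \<phi>) f"
      using assms(1) smooth_germ_comp3[OF k(1) *(3,4)] unfolding determined_def jet_eq_iff by blast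
    moreover have "A_equivalent k (\<Phi> \<circ> k \<circ> \<phi>)"
      using A_equivalentI[OF k(1) *(3,4)] by simp
    ultimately show ?thesis using assms(2) A_equivalent_trans by blast
  qed
  then show ?thesis unfolding determined_def jet_eq_iff using *(1) by blast
qed

section \<open>Linear parts and orders of vanishing\<close>

definition jacobian :: "(real^'m::finite \<Rightarrow> real^'n::finite) \<Rightarrow> real^'m^'n" where
  "jacobian f = matrix (frechet_derivative f (at 0))"

lemma smooth_germ_has_derivative:
  assumes "smooth_germ f"
  shows "(f has_derivative (\<lambda>v. jacobian f *v v)) (at 0)"
proof -
  have d: "f differentiable (at 0)"
    using assms smooth_on_differentiable unfolding smooth_germ_iff by blast
  then have "(\<lambda>v. jacobian f *v v) = frechet_derivative f (at 0)"
    unfolding jacobian_def by (simp add: linear_frechet_derivative fun_eq_iff)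
  then show ?thesis using has_derivative_frechet[OF d] by simp
qed

lemma jacobian_unique:
  assumes "(f has_derivative (\<lambda>v. A *v v)) (at 0)"
  shows "jacobian f = A"
  unfolding jacobian_def frechet_derivative_at[OF assms, symmetric] by simp

lemma jacobian_comp:
  assumes "smooth_germ f" "smooth_germ \<Phi>"
  shows "jacobian (\<Phi> \<circ> f) = jacobian \<Phi> ** jacobian f"
proof (rule jacobian_unique)
  have "f 0 = 0" using assms by (simp add: smooth_germ_iff)
  then show "(\<Phi> \<circ> f has_derivative (*v) (jacobian \<Phi> ** jacobian f)) (at 0)"
    using has_derivative_compose[OF smooth_germ_has_derivative[OF assms(1)], of \<Phi> "(*v) (jacobian \<Phi>)"]
      smooth_germ_has_derivative[OF assms(2)]
    by (simp add: o_def matrix_vector_mul_assoc)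
qed

lemma jacobian_entry: "jacobian f $ i $ j = higher_partial [j] f 0 $ i"
  by (simp add: jacobian_def matrix_def)

lemma jacobian_jet_eq: "jet_eq d f g \<Longrightarrow> 1 \<le> d \<Longrightarrow> jacobian f = jacobian g"
  unfolding vec_eq_iff jacobian_entry jet_eq_def by (simp del: higher_partial.simps)

lemma jacobian_id: "jacobian id = mat 1"
  by (rule jacobian_unique) (simp add: id_def has_derivative_ident)

lemma jacobian_inverse:
  assumes "diffeo_germ \<phi>" "diffeo_germ \<psi>" "\<forall>\<^sub>F x in nhds 0. \<psi> (\<phi> x) = x"
  shows "jacobian \<psi> ** jacobian \<phi> = mat 1"
proof -
  have "jet_eq 1 (\<psi> \<circ> \<phi>) id" using assms(3) by (intro jet_eq_cong) simp
  then have "jacobian (\<psi> \<circ> \<phi>) = mat 1" using jacobian_jet_eq[of 1] jacobian_id by (metis order_refl)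
  then show ?thesis
    by (simp add: jacobian_comp[OF diffeo_germ_smooth[OF assms(1)] diffeo_germ_smooth[OF assms(2)]])
qed

lemma det_jacobian_nz:
  assumes "diffeo_germ \<phi>"
  shows "det (jacobian \<phi>) \<noteq> 0"
proof -
  obtain \<psi> where "diffeo_germ \<psi>" "\<forall>\<^sub>F x in nhds 0. \<psi> (\<phi> x) = x"
    using assms by (rule diffeo_germ_inverse)
  from jacobian_inverse[OF assms this] have "det (jacobian \<psi>) * det (jacobian \<phi>) = 1"
    by (metis det_I det_mul)
  then show ?thesis by auto
qed

text \<open>Taylor's estimate without a Taylor polynomial: by induction the partial derivatives are
  bounded by one power less, and the mean value inequality on the ball of radius
  \<open>norm x\<close> gains the missing factor.\<close>

lemma jet_eq_zero_bound:
  fixes u :: "real^'m::finite \<Rightarrow> real^'n::finite"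
  assumes "open U" "0 \<in> U" "smooth_on U u" "jet_eq d u (\<lambda>x. 0)"
  shows "\<exists>C. \<forall>\<^sub>F x in nhds 0. norm (u x) \<le> C * norm x ^ Suc d"
  using assms(3,4)
proof (induction d arbitrary: u)
  case 0
  have u0: "u 0 = 0" using jet_eq_0[OF 0(2)] .
  let ?D = "frechet_derivative u (at 0)"
  have D: "(u has_derivative ?D) (at 0)" using 0 assms smooth_on_differentiable has_derivative_frechet by blast
  then obtain e where e: "e > 0" "\<And>y. norm y < e \<Longrightarrow> norm (u y - ?D y) \<le> norm y"
    unfolding has_derivative_at_alt using u0 by (metis diff_zero mult_1 zero_less_one)
  obtain K where K: "\<And>x. norm (?D x) \<le> norm x * K"
    using bounded_linear.bounded[OF has_derivative_bounded_linear[OF D]] by blast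
  have "norm (u x) \<le> (K + 1) * norm x ^ Suc 0" if "norm x < e" for x
  proof -
    have "norm (u x) \<le> norm (u x - ?D x) + norm (?D x)" by (metis diff_add_cancel norm_triangle_ineq)
    also have "\<dots> \<le> (K + 1) * norm x" using e(2)[OF that] K[of x] by (simp add: algebra_simps)
    finally show ?thesis by simp
  qed
  then show ?case unfolding eventually_nhds_metric using e(1) by (metis dist_0_norm dist_commute)
next
  case (Suc d)
  have "\<forall>i. \<exists>C. \<forall>\<^sub>F x in nhds 0. norm (partial i u x) \<le> C * norm x ^ Suc d"
  proof
    fix i
    have "jet_eq d (partial i u) (\<lambda>x. 0)" using jet_eq_partial[OF Suc.prems(2), of i] by simp
    then show "\<exists>C. \<forall>\<^sub>F x in nhds 0. norm (partial i u x) \<le> C * norm x ^ Suc d"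
      by (rule Suc.IH[OF smooth_on_partial[OF Suc.prems(1)]])
  qed
  from choice[OF this] obtain C
    where C: "\<And>i. \<forall>\<^sub>F x in nhds 0. norm (partial i u x) \<le> C i * norm x ^ Suc d" by blast
  have "\<forall>\<^sub>F x in nhds 0. \<forall>i. norm (partial i u x) \<le> C i * norm x ^ Suc d"
    by (rule eventually_all_finite[OF C])
  moreover have "\<forall>\<^sub>F x in nhds 0. x \<in> U" using assms(1,2) by (rule eventually_nhds_in_open)
  ultimately have "\<forall>\<^sub>F x in nhds 0. x \<in> U \<and> (\<forall>i. norm (partial i u x) \<le> C i * norm x ^ Suc d)"
    by eventually_elim blast
  then obtain e where e: "e > 0"
    "\<And>x. norm x < e \<Longrightarrow> x \<in> U \<and> (\<forall>i. norm (partial i u x) \<le> C i * norm x ^ Suc d)"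
    unfolding eventually_nhds_metric by (metis dist_0_norm dist_commute)
  define K where "K = (\<Sum>i\<in>UNIV. \<bar>C i\<bar>)"
  have K0: "K \<ge> 0" unfolding K_def by (simp add: sum_nonneg)
  have bd: "norm (frechet_derivative u (at x) v) \<le> K * norm x ^ Suc d * norm v" if x: "norm x < e" for x v
  proof -
    have "u differentiable (at x)" using smooth_on_differentiable[OF Suc.prems(1)] e(2)[OF x] by blast
    then have lin: "linear (frechet_derivative u (at x))" by (rule linear_frechet_derivative)
    have "v = (\<Sum>i\<in>UNIV. (v $ i) *\<^sub>R axis i 1)"
      using basis_expansion[of v] by (simp add: scalar_mult_eq_scaleR)
    then have "frechet_derivative u (at x) v = frechet_derivative u (at x) (\<Sum>i\<in>UNIV. (v $ i) *\<^sub>R axis i 1)"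
      by simp
    also have "\<dots> = (\<Sum>i\<in>UNIV. (v $ i) *\<^sub>R partial i u x)"
      by (simp add: linear_cmul[OF lin] linear_sum[OF lin])
    finally have "norm (frechet_derivative u (at x) v) = norm (\<Sum>i\<in>UNIV. (v $ i) *\<^sub>R partial i u x)"
      by simp
    also have "\<dots> \<le> (\<Sum>i\<in>UNIV. norm v * (\<bar>C i\<bar> * norm x ^ Suc d))"
    proof (rule sum_norm_le)
      fix i
      have "norm (partial i u x) \<le> \<bar>C i\<bar> * norm x ^ Suc d"
        using e(2)[OF x] by (smt (verit) mult_right_mono norm_ge_zero zero_le_power)
      then show "norm ((v $ i) *\<^sub>R partial i u x) \<le> norm v * (\<bar>C i\<bar> * norm x ^ Suc d)"
        by (simp add: component_le_norm_cart mult_mono)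
    qed
    also have "\<dots> = K * norm x ^ Suc d * norm v"
      unfolding K_def by (simp add: sum_distrib_left sum_distrib_right mult_ac)
    finally show ?thesis .
  qed
  have "norm (u x) \<le> K * norm x ^ Suc (Suc d)" if x: "norm x < e" for x
  proof -
    have "norm (u x - u 0) \<le> (K * norm x ^ Suc d) * norm (x - 0)"
    proof (rule differentiable_bound[where S="cball 0 (norm x)" and f'="\<lambda>y. frechet_derivative u (at y)"])
      fix y :: "real^'m" assume y: "y \<in> cball 0 (norm x)"
      then have y': "norm y \<le> norm x" "norm y < e" using x by auto
      show "(u has_derivative frechet_derivative u (at y)) (at y within cball 0 (norm x))"
        using smooth_on_differentiable[OF Suc.prems(1)] e(2)[OF y'(2)]
        by (blast intro: has_derivative_at_withinI has_derivative_frechet)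
      show "onorm (frechet_derivative u (at y)) \<le> K * norm x ^ Suc d"
      proof (rule onorm_le)
        fix v
        have "norm (frechet_derivative u (at y) v) \<le> K * norm y ^ Suc d * norm v" by (rule bd[OF y'(2)])
        also have "\<dots> \<le> K * norm x ^ Suc d * norm v"
          using y'(1) K0 by (intro mult_right_mono mult_left_mono power_mono) auto
        finally show "norm (frechet_derivative u (at y) v) \<le> K * norm x ^ Suc d * norm v" .
      qed
    qed auto
    then show ?thesis using jet_eq_0[OF Suc.prems(2)] by (simp add: mult_ac)
  qed
  then show ?case unfolding eventually_nhds_metric using e(1) by (metis dist_0_norm dist_commute)
qed

subsection \<open>Paths of jets of diffeomorphisms\<close>

lemma continuous_nonzero_same_sign:
  fixes g :: "real \<Rightarrow> real"
  assumes "continuous_on {0..1} g" "\<And>t. t \<in> {0..1} \<Longrightarrow> g t \<noteq> 0"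
  shows "0 < g 0 \<longleftrightarrow> 0 < g 1"
proof -
  have "connected (g ` {0..1})" using assms(1) by (intro connected_continuous_image) auto
  then have iv: "\<And>a b z. a \<in> g ` {0..1} \<Longrightarrow> b \<in> g ` {0..1} \<Longrightarrow> a \<le> z \<Longrightarrow> z \<le> b \<Longrightarrow> z \<in> g ` {0..1}"
    unfolding connected_iff_interval by blast
  have "g 0 \<in> g ` {0..1}" "g 1 \<in> g ` {0..1}" "0 \<notin> g ` {0..1}" using assms(2) by force+
  then show ?thesis using iv[of "g 0" "g 1" 0] iv[of "g 1" "g 0" 0] by force
qed

lemma continuous_on_if_const:
  "continuous_on S f \<Longrightarrow> continuous_on S g \<Longrightarrow> continuous_on S (\<lambda>x. if P then f x else g x)"
  by (cases P) simp_all

section \<open>Path components of the nonsingular matrices\<close>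

definition nonsingular :: "(real^'k::finite^'k) set" where
  "nonsingular = {A. det A \<noteq> 0}"

lemma continuous_on_matrix_mult:
  fixes f :: "'a::topological_space \<Rightarrow> real^'k::finite^'l::finite" and g :: "'a \<Rightarrow> real^'p::finite^'k"
  assumes "continuous_on S f" "continuous_on S g"
  shows "continuous_on S (\<lambda>x. f x ** g x)"
  unfolding matrix_matrix_mult_def using assms by (intro continuous_intros)

lemma path_component_mult:
  assumes "path_component nonsingular A A'" "path_component nonsingular B B'"
  shows "path_component nonsingular (A ** B) (A' ** B')"
proof -
  obtain p q where "path p" "path_image p \<subseteq> nonsingular" "pathstart p = A" "pathfinish p = A'"
    "path q" "path_image q \<subseteq> nonsingular" "pathstart q = B" "pathfinish q = B'"
    using assms unfolding path_component_def by blast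
  then show ?thesis unfolding path_component_def
    by (intro exI[of _ "\<lambda>t. p t ** q t"])
      (auto simp: path_def path_image_def pathstart_def pathfinish_def nonsingular_def det_mul image_subset_iff
        intro!: continuous_on_matrix_mult)
qed

lemma path_component_det_sign:
  assumes "path_component nonsingular A B"
  shows "0 < det A \<longleftrightarrow> 0 < det B"
proof -
  obtain p where p: "path p" "path_image p \<subseteq> nonsingular" "pathstart p = A" "pathfinish p = B"
    using assms unfolding path_component_def by blast
  have "continuous_on {0..1} (\<lambda>t. det (p t))"
    unfolding det_def using p(1) by (auto simp: path_def intro!: continuous_intros)
  then have "0 < det (p 0) \<longleftrightarrow> 0 < det (p 1)"
    by (rule continuous_nonzero_same_sign) (use p(2) in \<open>force simp: path_image_def nonsingular_def image_subset_iff\<close>)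
  then show ?thesis using p by (simp add: pathstart_def pathfinish_def)
qed

text \<open>The reflection in the hyperplane orthogonal to \<open>v\<close>. It is continuous in
  nonzero \<open>v\<close>, so a segment of vectors that avoids 0 yields a path of nonsingular
  matrices.\<close>

definition householder :: "real^'k::finite \<Rightarrow> real^'k^'k" where
  "householder v = (\<chi> i j. of_bool (i = j) - 2 * (v $ i) * (v $ j) / (v \<bullet> v))"

lemma householder_square:
  assumes "v \<noteq> 0"
  shows "householder v ** householder v = mat 1"
proof -
  have s: "(\<Sum>k\<in>UNIV. v $ k * v $ k) = v \<bullet> v" by (simp add: inner_vec_def)
  define c where "c = 2 / (v \<bullet> v)"
  have c: "c * (v \<bullet> v) = 2" using assms by (simp add: c_def)
  have H: "householder v = (\<chi> i j. of_bool (i = j) - c * v $ i * v $ j)"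
    by (simp add: householder_def c_def)
  have "(\<Sum>k\<in>UNIV. (of_bool (i = k) - c * v $ i * v $ k) * (of_bool (k = j) - c * v $ k * v $ j))
      = of_bool (i = j)" for i j
  proof -
    have "(\<Sum>k\<in>UNIV. (of_bool (i = k) - c * v $ i * v $ k) * (of_bool (k = j) - c * v $ k * v $ j))
      = (\<Sum>k\<in>UNIV. (if k = i then of_bool (i = j) - c * v $ i * v $ j else 0)
          - (if k = j then c * v $ i * v $ j else 0) + (c * c * v $ i * v $ j) * (v $ k * v $ k))"
      by (rule sum.cong) (auto simp: algebra_simps)
    also have "\<dots> = of_bool (i = j) - 2 * (c * v $ i * v $ j) + (c * (v \<bullet> v)) * (c * v $ i * v $ j)"
      by (simp add: sum.distrib sum_subtractf sum_distrib_left[symmetric] s)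
    finally show ?thesis unfolding c by simp
  qed
  then show ?thesis
    by (simp add: H matrix_matrix_mult_def mat_def vec_eq_iff of_bool_def)
qed

lemma householder_nonsingular: "v \<noteq> 0 \<Longrightarrow> householder v \<in> nonsingular"
  using arg_cong[OF householder_square, of v det] by (auto simp: nonsingular_def det_mul)

lemma householder_path:
  assumes "\<And>t. t \<in> {0..1} \<Longrightarrow> linepath v w t \<noteq> 0"
  shows "path_component nonsingular (householder v) (householder w)"
proof -
  have "continuous_on {0..1} (\<lambda>t. householder (linepath v w t))"
    unfolding householder_def using assms
    by (intro continuous_intros) auto
  moreover have "householder (linepath v w t) \<in> nonsingular" if "t \<in> {0..1}" for t
    using householder_nonsingular[OF assms[OF that]] .
  ultimately show ?thesis unfolding path_component_def
    by (intro exI[of _ "\<lambda>t. householder (linepath v w t)"])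
      (auto simp: path_def path_image_def pathstart_def pathfinish_def linepath_def)
qed

lemma householder_axis:
  "householder (axis p 1) = (\<chi> i j. if i = j then (if i = p then -1 else 1) else 0)"
  by (simp add: householder_def vec_eq_iff inner_axis_axis) (auto simp: axis_def)

lemma householder_axis_path:
  "path_component nonsingular (householder (axis p 1)) (householder (axis q (1::real)))"
proof (cases "p = q")
  case True
  then show ?thesis 
    by (auto intro!: path_component_refl householder_nonsingular simp: axis_eq_0_iff)
next
  case False
  show ?thesis
  proof (rule householder_path)
    fix t :: real
    have "linepath (axis p 1) (axis q 1) t $ p = 1 - t" "linepath (axis p 1) (axis q 1) t $ q = (t::real)"
      using False by (simp_all add: linepath_def axis_def)
    then show "linepath (axis p 1) (axis q (1::real)) t \<noteq> 0"
      by (metis diff_zero zero_index zero_neq_one)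
  qed
qed

lemma swap_path:
  assumes "m \<noteq> n"
  shows "path_component nonsingular (householder (axis m 1)) ((\<chi> i j. mat 1 $ i $ Transposition.transpose m n j) :: real^'k::finite^'k)"
proof -
  \<comment> \<open>A transposition matrix is the reflection along the difference of the two basis
    vectors.\<close>
  have "((\<chi> i j. mat 1 $ i $ Transposition.transpose m n j) :: real^'k::finite^'k) = householder (axis m 1 - axis n 1)"
    using assms
    by (simp add: householder_def vec_eq_iff inner_diff_left inner_diff_right inner_axis_axis mat_def)
      (auto simp: axis_def Transposition.transpose_def)
  moreover have "path_component nonsingular (householder (axis m (1::real))) (householder (axis m 1 - axis n 1))"
  proof (rule householder_path)
    fix t :: real
    have "linepath (axis m 1) (axis m 1 - axis n 1) t $ m = (1::real)"
      using assms by (simp add: linepath_def axis_def)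
    then show "linepath (axis m 1) (axis m 1 - axis n 1) t \<noteq> (0::real^_)"
      by (metis zero_index zero_neq_one)
  qed
  ultimately show ?thesis by simp
qed

text \<open>The property of having a path to \<open>mat 1\<close> or to one fixed reflection is
  multiplicative, because the reflection squares to \<open>mat 1\<close>. So only the elementary
  matrices remain: diagonal matrices, transpositions and shears.\<close>

lemma nonsingular_component:
  fixes A :: "real^'k::finite^'k" and p :: 'k
  assumes "det A \<noteq> 0"
  shows "path_component nonsingular A (mat 1) \<or> path_component nonsingular A (householder (axis p 1))"
proof -
  let ?J = "householder (axis p (1::real))"
  define P where "P \<equiv> \<lambda>A :: real^'k^'k.
    path_component nonsingular A (mat 1) \<or> path_component nonsingular A ?J"
  have J: "?J \<in> nonsingular" "?J ** ?J = mat 1"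
    by (simp_all add: householder_nonsingular householder_square axis_eq_0_iff)
  have one: "(mat 1 :: real^'k^'k) \<in> nonsingular" by (simp add: nonsingular_def)
  have mult: "P (A ** B)" if "P A" "P B" for A B
    using that path_component_mult[of A _ B] unfolding P_def
    by (metis J(2) matrix_mul_lid matrix_mul_rid)
  have H: "P (householder (axis q 1))" for q
    unfolding P_def using householder_axis_path by blast
  have trans: "P B" if "path_component nonsingular B A" "P A" for A B
    using that path_component_trans unfolding P_def by blast
  have sgn: "P (\<chi> i j. if i = j then (if i \<in> S then -1 else 1) else 0)" (is "P (?E S)") for S :: "'k set"
    using finite[of S]
  proof (induction S)
    case empty
    have "?E {} = mat 1" by (simp add: mat_def vec_eq_iff)
    then show ?case using path_component_refl[OF one] unfolding P_def by simp
  next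
    case (insert x S)
    have "householder (axis x 1) ** ?E S = ?E (insert x S)"
      using insert.hyps
      by (auto simp: householder_axis matrix_matrix_mult_def vec_eq_iff if_distrib[where f="\<lambda>x. x * _"] cong: if_cong)
    then show ?case using mult[OF H insert.IH, of x] by simp
  qed
  have "det A \<noteq> 0 \<longrightarrow> P A"
  proof (induction A rule: induct_matrix_elementary)
    case (1 A B)
    then show ?case using mult by (simp add: det_mul)
  next
    case (2 A i)
    then show ?case by (simp add: det_zero_row)
  next
    case (3 A)
    show ?case
    proof
      assume d: "det A \<noteq> 0"
      have dA: "det A = (\<Prod>i\<in>UNIV. A $ i $ i)" using 3 by (rule det_diagonal)
      then have nz: "A $ i $ i \<noteq> 0" for i using d by (simp add: prod_zero_iff)
      \<comment> \<open>Every diagonal entry moves on a segment to its own sign and so never passes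
        through 0.\<close>
      define D where "D \<equiv> \<lambda>t::real. (\<chi> i j. if i = j then (1 - t) * A $ i $ i + t * sgn (A $ i $ i) else 0) :: real^'k^'k"
      have "D t \<in> nonsingular" if t: "t \<in> {0..1}" for t
      proof -
        have "D t $ i $ i \<noteq> 0" for i
        proof (cases "A $ i $ i > 0")
          case True
          then have "(1 - t) * A $ i $ i + t > 0" using t
            by (cases "t = 0") (auto intro: add_nonneg_pos)
          then show ?thesis using True by (simp add: D_def)
        next
          case False
          then have "A $ i $ i < 0" using nz[of i] by linarith
          then have "(1 - t) * - (A $ i $ i) + t > 0" using t mult_nonneg_nonpos[of "1 - t" "A $ i $ i"]
            by (cases "t = 0") auto
          then show ?thesis using \<open>A $ i $ i < 0\<close> by (simp add: D_def)
        qed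
        moreover have "det (D t) = (\<Prod>i\<in>UNIV. D t $ i $ i)" by (rule det_diagonal) (simp add: D_def)
        ultimately show ?thesis by (simp add: nonsingular_def prod_zero_iff)
      qed
      moreover have "continuous_on {0..1} D" 
        unfolding D_def by (intro continuous_intros continuous_on_if_const)
      ultimately have "path_component nonsingular (D 0) (D 1)"
        unfolding path_component_def by (intro exI[of _ D])
          (auto simp: path_def path_image_def pathstart_def pathfinish_def)
      moreover have "D 0 = A" using 3 by (auto simp: D_def vec_eq_iff)
      moreover have "D 1 = ?E {i. A $ i $ i < 0}" using nz
        by (auto simp: D_def vec_eq_iff sgn_if not_less less_le)
      ultimately show "P A" using trans[of A] sgn[of "{i. A $ i $ i < 0}"] by simp
    qed
  next
    case (4 m n)
    then show ?case using trans[OF path_component_sym[OF swap_path] H] by blast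
  next
    case (5 m n c)
    define E where "E \<equiv> \<lambda>c. (\<chi> i j. if i = m \<and> j = n then c else of_bool (i = j)) :: real^'k^'k"
    have det: "det (E c) = 1" for c
    proof -
      have "E c = (\<chi> k. if k = m then row m (mat 1) + c *s row n (mat 1) else row k (mat 1))"
        using 5 by (auto simp: E_def vec_eq_iff row_def mat_def)
      then show ?thesis using det_row_operation[OF 5, of "mat 1" c] by simp
    qed
    \<comment> \<open>A shear keeps determinant 1 while its off-diagonal entry shrinks to 0.\<close>
    have "continuous_on {0..1} (\<lambda>t. E ((1 - t) * c))" unfolding E_def
      by (intro continuous_intros continuous_on_if_const)
    then have "path_component nonsingular (E c) (E 0)" unfolding path_component_def
      by (intro exI[of _ "\<lambda>t. E ((1 - t) * c)"])
        (auto simp: path_def path_image_def pathstart_def pathfinish_def nonsingular_def det)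
    moreover have "E 0 = mat 1" using 5 by (auto simp: E_def mat_def vec_eq_iff)
    ultimately have "P (E c)" unfolding P_def by simp
    then show ?case unfolding E_def by simp
  qed
  then show ?thesis using assms unfolding P_def by blast
qed

text \<open>The sign of the determinant is constant on path components and negative at a reflection,
  so of the two possible components only that of \<open>mat 1\<close> is left.\<close>

lemma path_component_det_pos:
  fixes A :: "real^'k::finite^'k"
  assumes "0 < det A"
  shows "path_component nonsingular (mat 1) A"
proof -
  obtain p :: 'k where True by blast
  have "det (householder (axis p (1::real))) = (\<Prod>i\<in>UNIV. if i = p then -1 else 1)"
    unfolding householder_axis by (subst det_diagonal) simp_all
  then have "\<not> 0 < det (householder (axis p (1::real)))" by simp
  then show ?thesis
    using nonsingular_component[of A p] path_component_det_sign assms path_component_sym by fastforce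
qed

section \<open>Linear germs and rescaling\<close>

lemma partial_linear: "partial i ((*v) A) x = A *v axis i 1"
  for A :: "real^'m::finite^'n::finite"
proof -
  have "((*v) A has_derivative (*v) A) (at x)"
    by (rule bounded_linear_imp_has_derivative) simp
  from frechet_derivative_at[OF this] show ?thesis by simp
qed

lemma higher_partial_linear:
  "higher_partial I ((*v) A) = (if I = [] then (*v) A else if length I = 1 then (\<lambda>x. A *v axis (hd I) 1) else (\<lambda>x. 0))"
  by (cases I rule: rev_cases) (auto simp: higher_partial_append partial_linear higher_partial_const)

lemma smooth_on_linear: "smooth_on UNIV ((*v) A)"
  unfolding smooth_on_def by (auto simp: higher_partial_linear matrix_vector_mul_bounded_linear
      bounded_linear_imp_differentiable)

lemma smooth_germ_linear: "smooth_germ ((*v) A)"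
  unfolding smooth_germ_iff using smooth_on_linear by (metis UNIV_I matrix_vector_mult_0_right open_UNIV)

lemma diffeo_germ_linear:
  assumes "det A \<noteq> 0"
  shows "diffeo_germ ((*v) A)"
proof -
  obtain B where "A ** B = mat 1" "B ** A = mat 1"
    using assms unfolding invertible_det_nz[symmetric] invertible_def by blast
  then show ?thesis unfolding diffeo_germ_def
    by (intro conjI exI[of _ "(*v) B"] smooth_germ_linear) (auto simp: matrix_vector_mul_assoc)
qed

lemma jacobian_linear: "jacobian ((*v) A) = A"
  by (rule jacobian_unique) (rule bounded_linear_imp_has_derivative, simp)

lemma jet_linear:
  "jet d ((*v) A) = (\<lambda>I. if length I \<le> d \<and> length I = 1 then A *v axis (hd I) 1 else 0)"
  by (auto simp: jet_def higher_partial_linear fun_eq_iff)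

lemma jet_linear_path:
  assumes "0 < det A"
  shows "path_component (Diff_jets d) (jet d id) (jet d ((*v) A))"
proof -
  obtain p where p: "path p" "path_image p \<subseteq> nonsingular" "pathstart p = mat 1" "pathfinish p = A"
    using path_component_det_pos[OF assms] unfolding path_component_def by blast
  have "continuous_on {0..1} (\<lambda>t. jet d ((*v) (p t)))"
  proof (rule continuous_on_coordinatewise_then_product)
    fix I
    show "continuous_on {0..1} (\<lambda>t. jet d ((*v) (p t)) I)"
      using p(1) unfolding jet_linear path_def matrix_vector_mult_def
      by (cases "length I \<le> d \<and> length I = 1") (auto intro!: continuous_intros)
  qed
  moreover have "jet d ((*v) (p t)) \<in> Diff_jets d" if "t \<in> {0..1}" for t
  proof -
    have "p t \<in> nonsingular" using p(2) that by (auto simp: path_image_def)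
    then show ?thesis unfolding Diff_jets_def nonsingular_def using diffeo_germ_linear by blast
  qed
  moreover have "jet d ((*v) (mat 1)) = jet d id"
    by (rule arg_cong[where f="jet d"]) auto
  ultimately show ?thesis unfolding path_component_def using p
    by (intro exI[of _ "\<lambda>t. jet d ((*v) (p t))"])
      (auto simp: path_def path_image_def pathstart_def pathfinish_def)
qed

lemma higher_partial_scale:
  fixes f :: "real^'m::finite \<Rightarrow> real^'n::finite"
  assumes "smooth_on U f" "t *\<^sub>R x \<in> U" "open U" "t \<noteq> 0"
  shows "higher_partial I (\<lambda>x. c *\<^sub>R f (t *\<^sub>R x)) x = (c * t ^ length I) *\<^sub>R higher_partial I f (t *\<^sub>R x)"
  using assms(2)
proof (induction I arbitrary: x)
  case (Cons i I)
  let ?W = "(\<lambda>x. t *\<^sub>R x) -` U" and ?g = "higher_partial I f"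
  have W: "open ?W" using assms(3) by (intro open_vimage) (auto intro!: continuous_intros)
  have "?g differentiable (at (t *\<^sub>R x))" using assms(1) Cons.prems unfolding smooth_on_def by blast
  then have "(?g has_derivative frechet_derivative ?g (at (t *\<^sub>R x))) (at (t *\<^sub>R x))" by (rule has_derivative_frechet)
  from has_derivative_compose[where g="?g" and f="\<lambda>x. t *\<^sub>R x" and f'="\<lambda>x. t *\<^sub>R x", OF _ this]
  have 1: "((\<lambda>x. ?g (t *\<^sub>R x)) has_derivative (\<lambda>v. frechet_derivative ?g (at (t *\<^sub>R x)) (t *\<^sub>R v))) (at x)"
    by (simp add: bounded_linear_imp_has_derivative bounded_linear_scaleR_right)
  have 2: "((\<lambda>x. (c * t ^ length I) *\<^sub>R ?g (t *\<^sub>R x)) has_derivative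
     (\<lambda>v. (c * t ^ length I) *\<^sub>R frechet_derivative ?g (at (t *\<^sub>R x)) (t *\<^sub>R v))) (at x)"
    by (rule has_derivative_scaleR_right[OF 1])
  have lin: "linear (frechet_derivative ?g (at (t *\<^sub>R x)))"
    using \<open>?g differentiable (at (t *\<^sub>R x))\<close> by (rule linear_frechet_derivative)
  have "higher_partial (i # I) (\<lambda>x. c *\<^sub>R f (t *\<^sub>R x)) x = partial i (\<lambda>x. (c * t ^ length I) *\<^sub>R ?g (t *\<^sub>R x)) x"
    using frechet_derivative_cong_open[OF W, of x "higher_partial I (\<lambda>x. c *\<^sub>R f (t *\<^sub>R x))"] Cons by simp
  also have "\<dots> = (c * t ^ length I) *\<^sub>R frechet_derivative ?g (at (t *\<^sub>R x)) (t *\<^sub>R axis i 1)"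
    unfolding frechet_derivative_at[OF 2, symmetric] ..
  also have "\<dots> = (c * t ^ length (i # I)) *\<^sub>R higher_partial (i # I) f (t *\<^sub>R x)"
    by (simp add: linear_cmul[OF lin] mult_ac)
  finally show ?case .
qed simp

text \<open>The partial derivatives of order \<open>k\<close> at 0 of the rescaled germ carry the
  factor \<open>t ^ (k - 1)\<close>. Defining the path by these coefficients makes it continuous at
  \<open>t = 0\<close>, where the rescaling itself makes no sense.\<close>

lemma jet_scale_path:
  fixes \<phi> :: "real^'m::finite \<Rightarrow> real^'m"
  assumes "diffeo_germ \<phi>"
  shows "path_component (Diff_jets d) (jet d ((*v) (jacobian \<phi>))) (jet d \<phi>)"
proof -
  \<comment> \<open>At \<open>t = 0\<close> the convention \<open>0 ^ 0 = 1\<close> keeps exactly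
    the entries of order one. Order zero is excluded separately, since \<open>0 - 1 = 0\<close> for
    natural numbers.\<close>
  define \<sigma> where "\<sigma> \<equiv> \<lambda>(t::real) (I::'m list). if length I \<le> d \<and> I \<noteq> [] then t ^ (length I - 1) *\<^sub>R higher_partial I \<phi> 0 else 0"
  obtain U where U: "open U" "0 \<in> U" "smooth_on U \<phi>" "\<phi> 0 = 0"
    using diffeo_germ_smooth[OF assms] unfolding smooth_germ_iff by blast
  have col: "jacobian \<phi> *v axis i 1 = higher_partial [i] \<phi> 0" for i
    by (simp add: vec_eq_iff jacobian_entry[symmetric] matrix_vector_mul_component inner_axis del: higher_partial.simps)
  have s0: "\<sigma> 0 = jet d ((*v) (jacobian \<phi>))"
  proof
    fix I :: "'m list" show "\<sigma> 0 I = jet d ((*v) (jacobian \<phi>)) I"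
      unfolding jet_linear \<sigma>_def col
      by (cases I) (auto simp: power_0_left simp del: higher_partial.simps)
  qed
  have st: "\<sigma> t = jet d (\<lambda>x. (1 / t) *\<^sub>R \<phi> (t *\<^sub>R x))" if "t \<noteq> 0" for t
  proof
    fix I :: "'m list"
    have "t ^ (length I - 1) = t ^ length I / t" if "I \<noteq> []"
      using that \<open>t \<noteq> 0\<close> by (cases I) auto
    then show "\<sigma> t I = jet d (\<lambda>x. (1 / t) *\<^sub>R \<phi> (t *\<^sub>R x)) I"
      using higher_partial_scale[of U \<phi> t 0 I "1/t"] U that by (auto simp: \<sigma>_def jet_def)
  qed
  have "\<sigma> t \<in> Diff_jets d" for t
  proof (cases "t = 0")
    case True
    then show ?thesis unfolding s0 Diff_jets_def True
      using diffeo_germ_linear[OF det_jacobian_nz[OF assms]] by blast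
  next
    case False
    let ?D = "\<lambda>c. (\<chi> i j. if i = j then c else 0) :: real^'m^'m"
    have "?D c *v x = c *\<^sub>R x" for c x
      by (simp add: matrix_vector_mult_def vec_eq_iff if_distrib[where f="\<lambda>x. x * _"] cong: if_cong)
    then have "(\<lambda>x. (1 / t) *\<^sub>R \<phi> (t *\<^sub>R x)) = (*v) (?D (1/t)) \<circ> \<phi> \<circ> (*v) (?D t)" by auto
    moreover have "det (?D c) \<noteq> 0" if "c \<noteq> 0" for c
      using that by (subst det_diagonal) (auto simp: prod_zero_iff)
    ultimately have "diffeo_germ (\<lambda>x. (1 / t) *\<^sub>R \<phi> (t *\<^sub>R x))"
      using False assms by (simp add: diffeo_germ_comp diffeo_germ_linear)
    then show ?thesis unfolding st[OF False] Diff_jets_def by blast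
  qed
  moreover have "continuous_on {0..1} \<sigma>"
  proof (rule continuous_on_coordinatewise_then_product)
    fix I :: "'m list" show "continuous_on {0..1} (\<lambda>t. \<sigma> t I)"
      unfolding \<sigma>_def by (cases "length I \<le> d \<and> I \<noteq> []") (auto intro!: continuous_intros)
  qed
  moreover have "\<sigma> 1 = jet d \<phi>" using st[of 1] by simp
  ultimately show ?thesis unfolding path_component_def using s0
    by (intro exI[of _ \<sigma>]) (auto simp: path_def path_image_def pathstart_def pathfinish_def)
qed

lemma Diff_jets_path_iff:
  assumes "diffeo_germ \<phi>" "1 \<le> d"
  shows "path_component (Diff_jets d) (jet d id) (jet d \<phi>) \<longleftrightarrow> 0 < det (jacobian \<phi>)"
proof
  assume "0 < det (jacobian \<phi>)"
  then show "path_component (Diff_jets d) (jet d id) (jet d \<phi>)"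
    using jet_linear_path jet_scale_path[OF assms(1)] path_component_trans by blast
next
  assume "path_component (Diff_jets d) (jet d id) (jet d \<phi>)"
  then obtain \<sigma> where "path \<sigma>" "path_image \<sigma> \<subseteq> Diff_jets d" "pathstart \<sigma> = jet d id" "pathfinish \<sigma> = jet d \<phi>"
    unfolding path_component_def by blast
  then have s: "continuous_on {0..1} \<sigma>" "\<sigma> ` {0..1} \<subseteq> Diff_jets d" "\<sigma> 0 = jet d id" "\<sigma> 1 = jet d \<phi>"
    by (simp_all add: path_def path_image_def pathstart_def pathfinish_def)
  \<comment> \<open>As \<open>1 \<le> d\<close>, a jet contains the jacobian; its determinant is
    thus continuous along the path and vanishes nowhere on \<open>Diff_jets d\<close>.\<close>
  define M where "M \<equiv> \<lambda>s :: ('a, 'a) jet. (\<chi> i j. s [j] $ i) :: real^'a^'a"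
  have M: "M (jet d \<psi>) = jacobian \<psi>" for \<psi>
    unfolding M_def jet_def vec_eq_iff using assms(2) by (simp add: jacobian_entry)
  have "continuous_on {0..1} (\<lambda>t. det (M (\<sigma> t)))"
    unfolding det_def M_def vec_lambda_beta
    by (intro continuous_intros continuous_on_product_then_coordinatewise[OF s(1)])
  then have "0 < det (M (\<sigma> 0)) \<longleftrightarrow> 0 < det (M (\<sigma> 1))"
  proof (rule continuous_nonzero_same_sign)
    fix t :: real assume "t \<in> {0..1}"
    then obtain \<psi> where "diffeo_germ \<psi>" "\<sigma> t = jet d \<psi>" using s(2) unfolding Diff_jets_def by blast
    then show "det (M (\<sigma> t)) \<noteq> 0" using M det_jacobian_nz by metis
  qed
  then show "0 < det (jacobian \<phi>)" unfolding s M by (simp add: jacobian_id)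
qed

subsection \<open>Counting isotopy classes by orientation\<close>

text \<open>\<open>True\<close> is the sign of a change that preserves orientation; \<open>s\<close>
  belongs to the source, \<open>s'\<close> to the target. Only jets are compared, as in an isotopy,
  and the pairs belonging to \<open>f = g\<close> form the subgroup whose index is wanted.\<close>

definition oriented_equiv ::
    "nat \<Rightarrow> bool \<Rightarrow> bool \<Rightarrow> (real^'m::finite \<Rightarrow> real^'n::finite) \<Rightarrow> (real^'m \<Rightarrow> real^'n) \<Rightarrow> bool" where
  "oriented_equiv d s s' f g \<longleftrightarrow> smooth_germ f \<and> smooth_germ g \<and>
     (\<exists>\<phi> \<Phi>. diffeo_germ \<phi> \<and> diffeo_germ \<Phi> \<and> (0 < det (jacobian \<phi>) \<longleftrightarrow> s) \<and>
       (0 < det (jacobian \<Phi>) \<longleftrightarrow> s') \<and> jet_eq d (\<Phi> \<circ> f \<circ> \<phi>) g)"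

lemma A_isotopic_iff:
  assumes "1 \<le> d"
  shows "A_isotopic d f g \<longleftrightarrow> A_equivalent f g \<and> determined d f \<and> determined d g \<and> oriented_equiv d True True f g"
proof -
  have path: "path_component (Diff_jets d) (jet d id) j \<longleftrightarrow>
     (\<exists>\<sigma> :: real \<Rightarrow> _. continuous_on {0..1} \<sigma> \<and> \<sigma> ` {0..1} \<subseteq> Diff_jets d \<and> \<sigma> 0 = jet d id \<and> \<sigma> 1 = j)"
    for j :: "('k::finite, 'k) jet"
    by (simp add: path_component_def path_def path_image_def pathstart_def pathfinish_def)
  have "(\<exists>(\<sigma> :: real \<Rightarrow> ('a, 'a) jet) (\<tau> :: real \<Rightarrow> ('b, 'b) jet).
        continuous_on {0..1} \<sigma> \<and> \<sigma> ` {0..1} \<subseteq> Diff_jets d \<and> \<sigma> 0 = jet d id \<and>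
        continuous_on {0..1} \<tau> \<and> \<tau> ` {0..1} \<subseteq> Diff_jets d \<and> \<tau> 0 = jet d id \<and>
        (\<exists>\<phi> \<Phi>. diffeo_germ \<phi> \<and> jet d \<phi> = \<sigma> 1 \<and> diffeo_germ \<Phi> \<and> jet d \<Phi> = \<tau> 1 \<and>
               jet d g = jet d (\<Phi> \<circ> f \<circ> \<phi>)))
    \<longleftrightarrow> (\<exists>\<phi> \<Phi>. diffeo_germ \<phi> \<and> diffeo_germ \<Phi> \<and> path_component (Diff_jets d) (jet d id) (jet d \<phi>) \<and>
      path_component (Diff_jets d) (jet d id) (jet d \<Phi>) \<and> jet d g = jet d (\<Phi> \<circ> f \<circ> \<phi>))"
    (is "?L \<longleftrightarrow> ?R")
  proof
    assume ?L
    then obtain \<sigma> :: "real \<Rightarrow> ('a, 'a) jet" and \<tau> :: "real \<Rightarrow> ('b, 'b) jet" and \<phi> \<Phi> where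
      "continuous_on {0..1} \<sigma>" "\<sigma> ` {0..1} \<subseteq> Diff_jets d" "\<sigma> 0 = jet d id"
      "continuous_on {0..1} \<tau>" "\<tau> ` {0..1} \<subseteq> Diff_jets d" "\<tau> 0 = jet d id"
      "diffeo_germ \<phi>" "jet d \<phi> = \<sigma> 1" "diffeo_germ \<Phi>" "jet d \<Phi> = \<tau> 1" "jet d g = jet d (\<Phi> \<circ> f \<circ> \<phi>)"
      by (elim exE conjE) (rule that)
    then show ?R unfolding path
      by (intro exI[of _ \<phi>] exI[of _ \<Phi>] conjI exI[of _ \<sigma>] exI[of _ \<tau>]) simp_all
  next
    assume ?R
    then obtain \<phi> \<Phi> and \<sigma> :: "real \<Rightarrow> ('a, 'a) jet" and \<tau> :: "real \<Rightarrow> ('b, 'b) jet" where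
      "continuous_on {0..1} \<sigma>" "\<sigma> ` {0..1} \<subseteq> Diff_jets d" "\<sigma> 0 = jet d id" "\<sigma> 1 = jet d \<phi>"
      "continuous_on {0..1} \<tau>" "\<tau> ` {0..1} \<subseteq> Diff_jets d" "\<tau> 0 = jet d id" "\<tau> 1 = jet d \<Phi>"
      "diffeo_germ \<phi>" "diffeo_germ \<Phi>" "jet d g = jet d (\<Phi> \<circ> f \<circ> \<phi>)"
      unfolding path by (elim exE conjE) (rule that)
    then show ?L
      by (intro exI[of _ \<sigma>] exI[of _ \<tau>] conjI exI[of _ \<phi>] exI[of _ \<Phi>]) simp_all
  qed
  also have "\<dots> \<longleftrightarrow> (\<exists>\<phi> \<Phi>. diffeo_germ \<phi> \<and> diffeo_germ \<Phi> \<and> 0 < det (jacobian \<phi>) \<and>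
      0 < det (jacobian \<Phi>) \<and> jet_eq d (\<Phi> \<circ> f \<circ> \<phi>) g)"
    by (intro ex_cong1) (auto simp: Diff_jets_path_iff[OF _ assms] jet_eq_iff)
  finally show ?thesis unfolding A_isotopic_def oriented_equiv_def A_equivalent_def by auto
qed

lemma det_inverse_sign:
  fixes A B :: "real^'k::finite^'k"
  assumes "A ** B = mat 1"
  shows "0 < det A \<longleftrightarrow> 0 < det B"
proof -
  have "det A * det B = 1" using assms by (metis det_I det_mul)
  then show ?thesis by (metis mult.commute zero_less_mult_pos zero_less_one)
qed

lemma oriented_equiv_sym:
  assumes "oriented_equiv d s s' f g"
  shows "oriented_equiv d s s' g f"
proof -
  obtain \<phi> \<Phi> where *: "smooth_germ f" "smooth_germ g" "diffeo_germ \<phi>" "diffeo_germ \<Phi>"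
    "0 < det (jacobian \<phi>) \<longleftrightarrow> s" "0 < det (jacobian \<Phi>) \<longleftrightarrow> s'" "jet_eq d (\<Phi> \<circ> f \<circ> \<phi>) g"
    using assms unfolding oriented_equiv_def by blast
  obtain \<phi>i where i: "diffeo_germ \<phi>i" "\<forall>\<^sub>F x in nhds 0. \<phi>i (\<phi> x) = x" "\<forall>\<^sub>F y in nhds 0. \<phi> (\<phi>i y) = y"
    using *(3) by (rule diffeo_germ_inverse)
  obtain \<Phi>i where j: "diffeo_germ \<Phi>i" "\<forall>\<^sub>F x in nhds 0. \<Phi>i (\<Phi> x) = x" "\<forall>\<^sub>F y in nhds 0. \<Phi> (\<Phi>i y) = y"
    using *(4) by (rule diffeo_germ_inverse)
  have "\<forall>\<^sub>F x in nhds 0. (\<Phi>i \<circ> (\<Phi> \<circ> f \<circ> \<phi>) \<circ> \<phi>i) x = f x"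
    using i(3) smooth_germ_eventually[OF *(1) j(2)] by eventually_elim simp
  then have "jet_eq d (\<Phi>i \<circ> (\<Phi> \<circ> f \<circ> \<phi>) \<circ> \<phi>i) f" by (rule jet_eq_cong)
  then have "jet_eq d (\<Phi>i \<circ> g \<circ> \<phi>i) f"
    using jet_eq_comp3[OF smooth_germ_comp3[OF *(1,3,4)] *(2,7) i(1) j(1)] jet_eq_sym jet_eq_trans by blast
  moreover have "0 < det (jacobian \<phi>i) \<longleftrightarrow> s" "0 < det (jacobian \<Phi>i) \<longleftrightarrow> s'"
    using *(5,6) det_inverse_sign[OF jacobian_inverse[OF *(3) i(1,2)]]
      det_inverse_sign[OF jacobian_inverse[OF *(4) j(1,2)]] by auto
  ultimately show ?thesis unfolding oriented_equiv_def using * i j by blast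
qed

text \<open>With \<open>True\<close> as the sign 1, equality of truth values is multiplication of
  signs, so this is the group law.\<close>

lemma oriented_equiv_trans:
  assumes "oriented_equiv d s s' f g" "oriented_equiv d t t' g h"
  shows "oriented_equiv d (s = t) (s' = t') f h"
proof -
  obtain \<phi> \<Phi> where *: "smooth_germ f" "smooth_germ g" "diffeo_germ \<phi>" "diffeo_germ \<Phi>"
    "0 < det (jacobian \<phi>) \<longleftrightarrow> s" "0 < det (jacobian \<Phi>) \<longleftrightarrow> s'" "jet_eq d (\<Phi> \<circ> f \<circ> \<phi>) g"
    using assms unfolding oriented_equiv_def by blast
  obtain \<psi> \<Psi> where **: "smooth_germ h" "diffeo_germ \<psi>" "diffeo_germ \<Psi>"
    "0 < det (jacobian \<psi>) \<longleftrightarrow> t" "0 < det (jacobian \<Psi>) \<longleftrightarrow> t'" "jet_eq d (\<Psi> \<circ> g \<circ> \<psi>) h"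
    using assms unfolding oriented_equiv_def by blast
  have "jet_eq d (\<Psi> \<circ> (\<Phi> \<circ> f \<circ> \<phi>) \<circ> \<psi>) (\<Psi> \<circ> g \<circ> \<psi>)"
    using jet_eq_comp3[OF smooth_germ_comp3[OF *(1,3,4)] *(2,7) **(2,3)] .
  then have "jet_eq d ((\<Psi> \<circ> \<Phi>) \<circ> f \<circ> (\<phi> \<circ> \<psi>)) h"
    using jet_eq_trans[OF _ **(6)] by (simp add: comp_assoc)
  moreover have sg: "0 < x * y \<longleftrightarrow> (0 < x \<longleftrightarrow> 0 < y)" if "x \<noteq> 0" "y \<noteq> 0" for x y :: real
    using that by (simp add: zero_less_mult_iff) linarith
  have "0 < det (jacobian (\<phi> \<circ> \<psi>)) \<longleftrightarrow> s = t"
    using sg[OF det_jacobian_nz[OF *(3)] det_jacobian_nz[OF **(2)]] *(5) **(4)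
    by (simp add: jacobian_comp[OF diffeo_germ_smooth[OF **(2)] diffeo_germ_smooth[OF *(3)]] det_mul)
  moreover have "0 < det (jacobian (\<Psi> \<circ> \<Phi>)) \<longleftrightarrow> s' = t'"
    using sg[OF det_jacobian_nz[OF **(3)] det_jacobian_nz[OF *(4)]] *(6) **(5)
    by (auto simp: jacobian_comp[OF diffeo_germ_smooth[OF *(4)] diffeo_germ_smooth[OF **(3)]] det_mul)
  ultimately show ?thesis unfolding oriented_equiv_def
    using *(1) **(1) diffeo_germ_comp[OF *(3) **(2)] diffeo_germ_comp[OF **(3) *(4)] by blast
qed

lemma oriented_equiv_refl: "smooth_germ f \<Longrightarrow> oriented_equiv d True True f f"
  unfolding oriented_equiv_def
  by (intro conjI exI[of _ id]) (auto simp: diffeo_germ_id jacobian_id jet_eq_refl)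

lemma A_equivalent_oriented:
  assumes "A_equivalent f g"
  shows "\<exists>s s'. oriented_equiv d s s' f g"
proof -
  obtain \<phi> \<Phi> where "smooth_germ f" "smooth_germ g" "diffeo_germ \<phi>" "diffeo_germ \<Phi>"
    "\<forall>\<^sub>F x in nhds 0. (\<Phi> \<circ> f \<circ> \<phi>) x = g x"
    using assms unfolding A_equivalent_def by auto
  then show ?thesis unfolding oriented_equiv_def using jet_eq_cong[of "\<Phi> \<circ> f \<circ> \<phi>" g d] by blast
qed

lemma diffeo_germ_with_sign:
  obtains \<phi> :: "real^'k::finite \<Rightarrow> real^'k" where "diffeo_germ \<phi>" "0 < det (jacobian \<phi>) \<longleftrightarrow> s"
proof (cases s)
  case True
  then show ?thesis using that[OF diffeo_germ_id] by (simp add: jacobian_id)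
next
  case False
  obtain p :: 'k where True by blast
  let ?A = "(\<chi> i j. if i = j then (if i = p then -1 else 1) else 0) :: real^'k^'k"
  have "det ?A = (\<Prod>i\<in>UNIV. if i = p then -1 else 1)" by (subst det_diagonal) simp_all
  then have "det ?A = -1" by simp
  then show ?thesis using that[of "(*v) ?A"] False by (simp add: diffeo_germ_linear jacobian_linear)
qed

text \<open>Reflections of the source and of the target change the two orientations independently,
  so all four pairs occur inside one equivalence class.\<close>

lemma oriented_equiv_exists:
  assumes "smooth_germ f"
  obtains g where "A_equivalent f g" "oriented_equiv d s s' f g"
proof -
  obtain \<phi> :: "real^'a \<Rightarrow> real^'a" where 1: "diffeo_germ \<phi>" "0 < det (jacobian \<phi>) \<longleftrightarrow> s"
    by (rule diffeo_germ_with_sign)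
  obtain \<Phi> :: "real^'b \<Rightarrow> real^'b" where 2: "diffeo_germ \<Phi>" "0 < det (jacobian \<Phi>) \<longleftrightarrow> s'"
    by (rule diffeo_germ_with_sign)
  show ?thesis
  proof (rule that[of "\<Phi> \<circ> f \<circ> \<phi>"])
    show "A_equivalent f (\<Phi> \<circ> f \<circ> \<phi>)" using A_equivalentI[OF assms 1(1) 2(1)] by simp
    show "oriented_equiv d s s' f (\<Phi> \<circ> f \<circ> \<phi>)" unfolding oriented_equiv_def
      using assms smooth_germ_comp3[OF assms 1(1) 2(1)] 1 2 jet_eq_refl by blast
  qed
qed

section \<open>Isotopy classes as cosets of pairs of orientations\<close>

context
  fixes d :: nat and f :: "real^'m::finite \<Rightarrow> real^'n::finite"
  assumes d: "1 \<le> d" and f: "determined d f"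
begin

text \<open>\<open>A_isotopic\<close> is reflexive only at determined germs. Inside the class of
  \<open>f\<close> determinacy is automatic, and the relation reduces to a statement about
  orientations.\<close>

lemma A_isotopic_class:
  assumes "A_equivalent f g" "A_equivalent f g'"
  shows "(g, g') \<in> {(f, g). A_isotopic d f g} \<longleftrightarrow> oriented_equiv d True True g g'"
  using A_isotopic_iff[OF d, of g g'] determined_A_equivalent[OF f] assms A_equivalent_sym A_equivalent_trans
  by (metis case_prodI mem_Collect_eq case_prodD)

lemma A_isotopic_class_eq:
  assumes "A_equivalent f g" "A_equivalent f g'"
  shows "{(f, g). A_isotopic d f g} `` {g} = {(f, g). A_isotopic d f g} `` {g'}
    \<longleftrightarrow> oriented_equiv d True True g g'"
proof -
  have R: "{(f, g). A_isotopic d f g} `` {g} = {k. A_equivalent f k \<and> oriented_equiv d True True g k}"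
    if g: "A_equivalent f g" for g
  proof -
    have "A_isotopic d g k \<longleftrightarrow> A_equivalent f k \<and> oriented_equiv d True True g k" for k
      using A_isotopic_class[OF g, of k] A_isotopic_iff[OF d, of g k] A_equivalent_trans[OF g] by auto
    then show ?thesis by auto
  qed
  have sm: "smooth_germ g'" using assms unfolding A_equivalent_def by blast
  show ?thesis
  proof
    assume "{(f, g). A_isotopic d f g} `` {g} = {(f, g). A_isotopic d f g} `` {g'}"
    then show "oriented_equiv d True True g g'"
      unfolding R[OF assms(1)] R[OF assms(2)] using oriented_equiv_refl[OF sm, of d] assms(2) by blast
  next
    assume *: "oriented_equiv d True True g g'"
    have "oriented_equiv d True True g k \<longleftrightarrow> oriented_equiv d True True g' k" for k
      using oriented_equiv_trans[OF *, of True True k] oriented_equiv_trans[OF oriented_equiv_sym[OF *], of True True k]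
      by auto
    then show "{(f, g). A_isotopic d f g} `` {g} = {(f, g). A_isotopic d f g} `` {g'}"
      unfolding R[OF assms(1)] R[OF assms(2)] by simp
  qed
qed

lemma A_isotopy_classes_image:
  "A_isotopy_classes d C = (\<lambda>g. {(f, g). A_isotopic d f g} `` {g}) ` C"
  unfolding A_isotopy_classes_def quotient_def by (rule UNION_singleton_eq_range)

lemma image_constant_set: "x \<in> C \<Longrightarrow> (\<And>g. g \<in> C \<Longrightarrow> h g = c) \<Longrightarrow> h ` C = {c}"
  by (metis image_cong image_constant)

lemma smooth_f: "smooth_germ f" and f_class: "A_equivalent f f"
  using f A_equivalent_refl unfolding determined_def by blast+

text \<open>Composing an equivalence with a self-equivalence of the same pair of signs makes both
  coordinate changes preserve orientation.\<close>

lemma card_isotopy_classes_one: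
  assumes all: "\<And>s s'. oriented_equiv d s s' f f"
  shows "card (A_isotopy_classes d {g. A_equivalent f g}) = 1"
proof -
  let ?R = "{(f, g). A_isotopic d f g}"
  have eq: "?R `` {g} = ?R `` {f}" if g: "A_equivalent f g" for g
  proof -
    obtain s s' where "oriented_equiv d s s' f g" using A_equivalent_oriented[OF g] by blast
    from oriented_equiv_trans[OF all[of s s'] this] have "oriented_equiv d True True f g" by simp
    then show ?thesis using A_isotopic_class_eq[OF f_class g] by simp
  qed
  have "A_isotopy_classes d {g. A_equivalent f g} = {?R `` {f}}"
    unfolding A_isotopy_classes_image
  proof (rule image_constant_set[of f])
    show "f \<in> {g. A_equivalent f g}" using f_class by simp
    show "?R `` {g} = ?R `` {f}" if "g \<in> {g. A_equivalent f g}" for g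
      using that by (intro eq) simp
  qed
  then show ?thesis by simp
qed

text \<open>The realised pairs form a subgroup that contains the nontrivial \<open>(s, s')\<close>
  and misses \<open>(t, t')\<close>; in a group of order four it has index 2. A germ reached from
  \<open>f\<close> with signs \<open>(t, t')\<close> represents the other coset.\<close>

lemma card_isotopy_classes_two:
  assumes s: "oriented_equiv d s s' f f" and s0: "\<not> (s \<and> s')" and t: "\<not> oriented_equiv d t t' f f"
  shows "card (A_isotopy_classes d {g. A_equivalent f g}) = 2"
proof -
  let ?R = "{(f, g). A_isotopic d f g}"
  obtain k where k: "A_equivalent f k" "oriented_equiv d t t' f k"
    using smooth_f by (rule oriented_equiv_exists)
  have "?R `` {g} = ?R `` {f} \<or> ?R `` {g} = ?R `` {k}" if g: "A_equivalent f g" for g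
  proof -
    obtain u u' where u: "oriented_equiv d u u' f g" using A_equivalent_oriented[OF g] by blast
    have f1: "oriented_equiv d True True f f" using oriented_equiv_refl[OF smooth_f] .
    have not: "\<not> ((t \<longleftrightarrow> s) \<and> (t' \<longleftrightarrow> s'))" "\<not> (t \<and> t')" using s t f1 by (cases s; cases s'; cases t; cases t'; simp)+
    have v: "oriented_equiv d (s = u) (s' = u') f g" using oriented_equiv_trans[OF s u] .
    have ku: "oriented_equiv d (t = u) (t' = u') k g"
      using oriented_equiv_trans[OF oriented_equiv_sym[OF k(2)] u] .
    have kv: "oriented_equiv d (t = (s = u)) (t' = (s' = u')) k g"
      using oriented_equiv_trans[OF oriented_equiv_sym[OF k(2)] v] .
    from not have not: "t \<noteq> s \<or> t' \<noteq> s'" "\<not> t \<or> \<not> t'" by auto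
    \<comment> \<open>The two cosets of the subgroup generated by \<open>(s, s')\<close>, written
      out: two elements for \<open>f\<close>, two for \<open>k\<close>.\<close>
    have "(u = True \<and> u' = True) \<or> (s = u) \<and> (s' = u') \<or> (t = u) \<and> (t' = u') \<or> (t = (s = u)) \<and> (t' = (s' = u'))"
      using s0 not by (cases s; cases s'; cases t; cases t'; cases u; cases u'; simp)
    then have "oriented_equiv d True True f g \<or> oriented_equiv d True True k g"
      using u v ku kv by (elim disjE) simp_all
    then show ?thesis using A_isotopic_class_eq[OF f_class g] A_isotopic_class_eq[OF k(1) g] by auto
  qed
  moreover have "?R `` {f} \<noteq> ?R `` {k}"
  proof
    assume "?R `` {f} = ?R `` {k}"
    then have "oriented_equiv d True True f k" using A_isotopic_class_eq[OF f_class k(1)] by simp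
    from oriented_equiv_trans[OF k(2) oriented_equiv_sym[OF this]] t show False by simp
  qed
  moreover have "A_isotopy_classes d {g. A_equivalent f g} = {?R `` {f}, ?R `` {k}}"
  proof
    show "A_isotopy_classes d {g. A_equivalent f g} \<subseteq> {?R `` {f}, ?R `` {k}}"
      unfolding A_isotopy_classes_image using calculation(1) by (intro image_subsetI) blast
    show "{?R `` {f}, ?R `` {k}} \<subseteq> A_isotopy_classes d {g. A_equivalent f g}"
      unfolding A_isotopy_classes_image using f_class k(1) by (intro insert_subsetI imageI) auto
  qed
  ultimately show ?thesis by simp
qed

end

subsection \<open>Determinants of block triangular matrices\<close>

text \<open>The Leibniz formula over an arbitrary index set. Blocks are subsets of the indices, and
  matrices are numbered by natural numbers below, whereas \<open>det\<close> sums over a whole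
  type.\<close>

definition minor_det :: "'a set \<Rightarrow> ('a \<Rightarrow> 'a \<Rightarrow> real) \<Rightarrow> real" where
  "minor_det S A = (\<Sum>p | p permutes S. of_int (sign p) * (\<Prod>i\<in>S. A i (p i)))"

lemma minor_det_UNIV: "det A = minor_det UNIV (\<lambda>i j. A $ i $ j)"
  by (simp add: det_def minor_det_def)

lemma minor_det_cong:
  assumes "\<And>i j. i \<in> S \<Longrightarrow> j \<in> S \<Longrightarrow> A i j = B i j"
  shows "minor_det S A = minor_det S B"
  unfolding minor_det_def using assms
  by (intro sum.cong arg_cong2[where f="(*)"] prod.cong) (auto simp: permutes_in_image)

lemma minor_det_reindex:
  assumes f: "bij_betw f S T" and fin: "finite S"
  shows "minor_det T A = minor_det S (\<lambda>i j. A (f i) (f j))"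
  unfolding minor_det_def
proof (rule sym, rule sum.reindex_bij_witness[where j="map_permutation S f" and i="map_permutation T (inv_into S f)"])
  have inj: "inj_on f S" and img: "f ` S = T" using f by (auto simp: bij_betw_def)
  fix p assume p: "p \<in> {p. p permutes S}"
  show "map_permutation T (inv_into S f) (map_permutation S f p) = p"
    using p by (intro map_permutation_compose_inv[OF f]) (auto simp: inj)
  show "map_permutation S f p \<in> {p. p permutes T}" using map_permutation_permutes[OF f] p by blast
  have "(\<Prod>i\<in>T. A i (map_permutation S f p i)) = (\<Prod>i\<in>S. A (f i) (f (p i)))"
    unfolding img[symmetric] by (simp add: prod.reindex[OF inj] map_permutation_apply[OF inj])
  then show "of_int (sign (map_permutation S f p)) * (\<Prod>i\<in>T. A i (map_permutation S f p i)) =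
      of_int (sign p) * (\<Prod>i\<in>S. A (f i) (f (p i)))"
    using sign_map_permutation[OF inj _ fin] p by simp
next
  have g: "bij_betw (inv_into S f) T S" by (rule bij_betw_inv_into[OF f])
  fix p assume p: "p \<in> {p. p permutes T}"
  show "map_permutation S f (map_permutation T (inv_into S f) p) = p"
    using p f by (intro map_permutation_compose_inv[OF g]) (auto simp: bij_betw_inv_into_right)
  show "map_permutation T (inv_into S f) p \<in> {p. p permutes S}"
    using map_permutation_permutes[OF g] p by blast
qed

lemma minor_det_scale:
  assumes "finite S"
  shows "minor_det S (\<lambda>i j. c i * A i j * e j) = prod c S * prod e S * minor_det S A"
proof -
  have "(\<Prod>i\<in>S. c i * A i (p i) * e (p i)) = prod c S * prod e S * (\<Prod>i\<in>S. A i (p i))" if "p permutes S" for p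
  proof -
    have "(\<Prod>i\<in>S. e (p i)) = prod e S" using prod.permute[OF that, of e] by (simp add: o_def)
    then show ?thesis by (simp add: prod.distrib)
  qed
  then show ?thesis unfolding minor_det_def sum_distrib_left by (intro sum.cong) auto
qed

text \<open>A permutation that moves some element of \<open>S\<close> into \<open>T\<close> meets a
  zero entry. The others preserve both sets and split uniquely into a permutation of each, with
  multiplicative signs.\<close>

lemma minor_det_block:
  assumes fin: "finite S" "finite T" and disj: "S \<inter> T = {}"
    and zero: "\<And>i j. i \<in> S \<Longrightarrow> j \<in> T \<Longrightarrow> A i j = 0"
  shows "minor_det (S \<union> T) A = minor_det S A * minor_det T A"
proof -
  let ?F = "\<lambda>p U. of_int (sign p) * (\<Prod>i\<in>U. A i (p i)) :: real"
  let ?P = "{p. p permutes (S \<union> T)}" and ?Q = "{p. p permutes (S \<union> T) \<and> p ` S \<subseteq> S}"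
  have "minor_det (S \<union> T) A = (\<Sum>p\<in>?Q. ?F p (S \<union> T))"
    unfolding minor_det_def
  proof (rule sum.mono_neutral_right)
    show "finite ?P" using fin by (simp add: finite_permutations)
    show "\<forall>p\<in>?P - ?Q. ?F p (S \<union> T) = 0"
    proof
      fix p assume p: "p \<in> ?P - ?Q"
      then obtain i where i: "i \<in> S" "p i \<notin> S" by blast
      then have "p i \<in> T" using p permutes_in_image[of p "S \<union> T" i] by auto
      then have "A i (p i) = 0" using zero i by blast
      then have "(\<Prod>i\<in>S \<union> T. A i (p i)) = 0" using fin i by (auto intro!: prod_zero bexI[of _ i])
      then show "?F p (S \<union> T) = 0" by simp
    qed
  qed auto
  also have "\<dots> = (\<Sum>(q, w)\<in>{q. q permutes S} \<times> {w. w permutes T}. ?F q S * ?F w T)"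
  \<comment> \<open>Splitting restricts a permutation to either set and extends it by the identity;
    composition is the inverse operation.\<close>
  proof (rule sum.reindex_bij_witness[where j="\<lambda>p. (restrict_id p S, restrict_id p T)" and i="\<lambda>(q, w). q \<circ> w"])
    fix p assume p: "p \<in> ?Q"
    then have inj: "inj p" and pp: "p permutes (S \<union> T)" by (auto intro: permutes_inj)
    have S: "p ` S = S" using p endo_inj_surj[of S p] fin inj by (auto intro: inj_on_subset)
    have "p ` T = T"
    proof -
      have "p ` T = p ` ((S \<union> T) - S)" using disj by (intro arg_cong[where f="image p"]) auto
      also have "\<dots> = p ` (S \<union> T) - p ` S" by (rule image_set_diff[OF inj])
      also have "\<dots> = T" unfolding S permutes_image[OF pp] using disj by auto
      finally show ?thesis .
    qed
    then have bij: "bij_betw p S S" "bij_betw p T T"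
      using S inj by (auto simp: bij_betw_def intro: inj_on_subset)
    then have perm: "restrict_id p S permutes S" "restrict_id p T permutes T"
      by (auto intro: permutes_restrict_id)
    then show "(restrict_id p S, restrict_id p T) \<in> {q. q permutes S} \<times> {w. w permutes T}" by simp
    have "p x = (restrict_id p S \<circ> restrict_id p T) x" for x
    proof -
      have "x \<in> T \<Longrightarrow> p x \<in> T" using \<open>p ` T = T\<close> by blast
      moreover have "x \<notin> S \<union> T \<Longrightarrow> p x = x" using pp by (rule permutes_not_in)
      ultimately show ?thesis using disj by (auto simp: restrict_id_def)
    qed
    then have eq: "restrict_id p S \<circ> restrict_id p T = p" by (intro ext) (rule sym)
    then show "(case (restrict_id p S, restrict_id p T) of (q, w) \<Rightarrow> q \<circ> w) = p" by simp
    have sg: "sign p = sign (restrict_id p S) * sign (restrict_id p T)"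
      using sign_compose[OF permutes_imp_permutation[OF fin(1) perm(1)] permutes_imp_permutation[OF fin(2) perm(2)]]
      unfolding eq .
    have "(\<Prod>i\<in>S \<union> T. A i (p i)) = (\<Prod>i\<in>S. A i (restrict_id p S i)) * (\<Prod>i\<in>T. A i (restrict_id p T i))"
      using fin disj by (simp add: prod.union_disjoint restrict_id_def)
    then show "(case (restrict_id p S, restrict_id p T) of (q, w) \<Rightarrow> ?F q S * ?F w T) = ?F p (S \<union> T)"
      using sg by simp
  next
    fix b assume "b \<in> {q. q permutes S} \<times> {w. w permutes T}"
    then obtain q w where b: "b = (q, w)" and q: "q permutes S" and w: "w permutes T" by blast
    have fix_q: "x \<notin> S \<Longrightarrow> q x = x" for x using q permutes_not_in by metis
    have fix_w: "x \<notin> T \<Longrightarrow> w x = x" for x using w permutes_not_in by metis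
    have S_q: "x \<in> S \<Longrightarrow> q x \<in> S" for x using q permutes_in_image by metis
    have T_w: "x \<in> T \<Longrightarrow> w x \<in> T" for x using w permutes_in_image by metis
    have "restrict_id (q \<circ> w) S = q" "restrict_id (q \<circ> w) T = w"
      using fix_q fix_w S_q T_w disj by (fastforce simp: restrict_id_def fun_eq_iff)+
    then show "(\<lambda>p. (restrict_id p S, restrict_id p T)) (case b of (q, w) \<Rightarrow> q \<circ> w) = b"
      unfolding b by simp
    have "(q \<circ> w) permutes (S \<union> T)"
      by (intro permutes_compose permutes_subset[OF q] permutes_subset[OF w]) auto
    moreover have "(q \<circ> w) ` S \<subseteq> S" using fix_w S_q disj by fastforce
    ultimately show "(case b of (q, w) \<Rightarrow> q \<circ> w) \<in> ?Q" unfolding b by simp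
  qed
  also have "\<dots> = minor_det S A * minor_det T A"
    unfolding minor_det_def by (simp add: sum_product sum.cartesian_product)
  finally show ?thesis .
qed

lemma minor_det_blocks:
  fixes B :: "nat \<Rightarrow> 'a set"
  assumes "\<And>s. finite (B s)" "\<And>s p. s < p \<Longrightarrow> B s \<inter> B p = {}"
    and "\<And>s p i j. 1 \<le> s \<Longrightarrow> s < p \<Longrightarrow> p \<le> r \<Longrightarrow> i \<in> B s \<Longrightarrow> j \<in> B p \<Longrightarrow> A i j = 0"
  shows "minor_det (\<Union>s\<in>{1..r}. B s) A = (\<Prod>s=1..r. minor_det (B s) A)"
  using assms(3)
proof (induction r)
  case 0
  show ?case by (simp add: minor_det_def)
next
  case (Suc r)
  have U: "(\<Union>s\<in>{1..Suc r}. B s) = (\<Union>s\<in>{1..r}. B s) \<union> B (Suc r)"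
    by (simp add: atLeastAtMostSuc_conv Un_commute)
  have "minor_det ((\<Union>s\<in>{1..r}. B s) \<union> B (Suc r)) A = minor_det (\<Union>s\<in>{1..r}. B s) A * minor_det (B (Suc r)) A"
  proof (rule minor_det_block)
    have "B s \<inter> B (Suc r) = {}" if "s \<in> {1..r}" for s using assms(2)[of s "Suc r"] that by simp
    then show "(\<Union>s\<in>{1..r}. B s) \<inter> B (Suc r) = {}" by blast
    show "A i j = 0" if "i \<in> (\<Union>s\<in>{1..r}. B s)" "j \<in> B (Suc r)" for i j
      using that Suc.prems[of _ "Suc r" i j] by auto
  qed (use assms(1) in auto)
  then show ?case unfolding U using Suc.IH Suc.prems by simp
qed

lemma sum_atLeast1_atMost: "(\<Sum>s=1..r. s) = r * (r + 1) div 2" for r :: nat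
  by (induction r) auto

lemma block_index_inj:
  fixes s p i i' r :: nat
  assumes "(i - 1) * r + s = (i' - 1) * r + p" "1 \<le> s" "s \<le> r" "1 \<le> p" "p \<le> r" "1 \<le> i" "1 \<le> i'"
  shows "s = p \<and> i = i'"
proof -
  have dm: "(x * r + y) div r = x" "(x * r + y) mod r = y" if "y < r" for x y
    using that by simp_all
  \<comment> \<open>The second index runs from 1 to \<open>r\<close>; lowered by one it is a
    remainder modulo \<open>r\<close>.\<close>
  have eq: "(i - 1) * r + (s - 1) = (i' - 1) * r + (p - 1)" using assms by linarith
  have lt: "s - 1 < r" "p - 1 < r" using assms by linarith+
  have "i - 1 = i' - 1" "s - 1 = p - 1"
    using dm[OF lt(1), of "i - 1"] dm[OF lt(2), of "i' - 1"] unfolding eq by argo+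
  then show ?thesis using assms by linarith
qed

text \<open>The matrices \<open>\<alpha>\<close> and \<open>\<beta>\<close> are the linear parts of the source and target diffeomorphisms: \<open>\<kappa>\<close> is the
  action on the kernel line, the lower right block of \<open>\<beta>\<close> the action on the cokernel \<open>C\<close>, and the
  diagonal blocks of \<open>\<alpha>\<close> are the actions on the spaces \<open>Hom(K\<^sup>p, C)\<close>. The weight \<open>w\<close> accounts
  for the derivative \<open>(r + 1) t^r\<close> of the last monomial.\<close>

lemma flag_determinants:
  fixes \<alpha> \<beta> :: "nat \<Rightarrow> nat \<Rightarrow> real" and w :: "nat \<Rightarrow> nat \<Rightarrow> real"
  assumes r: "1 \<le> r" and c: "1 \<le> c" and m: "m = r * c" and n: "n = m - 1 + c" and w: "\<And>i p. w i p \<noteq> 0"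
    and F1: "\<And>k. 1 \<le> k \<Longrightarrow> k < m \<Longrightarrow> \<alpha> k m = 0" "\<alpha> m m = \<kappa>"
    and F2: "\<And>k l. 1 \<le> k \<Longrightarrow> k < m \<Longrightarrow> 1 \<le> l \<Longrightarrow> l < m \<Longrightarrow> \<beta> k l = \<alpha> k l"
    and F3: "\<And>i l. 1 \<le> i \<Longrightarrow> i \<le> c \<Longrightarrow> 1 \<le> l \<Longrightarrow> l < m \<Longrightarrow> \<beta> (m - 1 + i) l = 0"
    and F4: "\<And>i i' s p. 1 \<le> i \<Longrightarrow> i \<le> c \<Longrightarrow> 1 \<le> i' \<Longrightarrow> i' \<le> c \<Longrightarrow> 1 \<le> s \<Longrightarrow> s < p \<Longrightarrow> p \<le> r \<Longrightarrow>
      \<alpha> ((i - 1) * r + s) ((i' - 1) * r + p) = 0"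
    and F5: "\<And>i i' p. 1 \<le> i \<Longrightarrow> i \<le> c \<Longrightarrow> 1 \<le> i' \<Longrightarrow> i' \<le> c \<Longrightarrow> 1 \<le> p \<Longrightarrow> p \<le> r \<Longrightarrow>
      \<kappa> ^ p * w i p * \<alpha> ((i - 1) * r + p) ((i' - 1) * r + p) = \<beta> (m - 1 + i) (m - 1 + i') * w i' p"
  obtains b D where "minor_det {1..m} \<alpha> * \<kappa> ^ (c * (r * (r + 1) div 2)) = b ^ r"
    "minor_det {1..m} \<alpha> = \<kappa> * D" "minor_det {1..n} \<beta> = D * b"
proof
  define b where "b = minor_det {1..c} (\<lambda>i i'. \<beta> (m - 1 + i) (m - 1 + i'))"
  define B where "B \<equiv> \<lambda>s. (\<lambda>i. (i - 1) * r + s) ` {1..c}"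
  \<comment> \<open>Outside the range \<open>1..r\<close> the sets \<open>B s\<close> would overlap
    the genuine blocks, so they are replaced by the empty set to make all blocks disjoint.\<close>
  define B' where "B' \<equiv> \<lambda>s. if s \<in> {1..r} then B s else {}"
  have m1: "1 \<le> m" unfolding m using r c by simp
  note ix = block_index_inj[where r = r]
  have U: "(\<Union>s\<in>{1..r}. B' s) = {1..m}"
  proof
    show "(\<Union>s\<in>{1..r}. B' s) \<subseteq> {1..m}"
    proof clarsimp
      fix s x assume "Suc 0 \<le> s" "s \<le> r" "x \<in> B' s"
      then obtain i where i: "1 \<le> i" "i \<le> c" "x = (i - 1) * r + s" unfolding B'_def B_def by auto
      have "x \<le> (i - 1) * r + r" using i \<open>s \<le> r\<close> by simp
      also have "\<dots> = i * r" using i by (cases i) auto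
      also have "\<dots> \<le> m" unfolding m using i by simp
      finally show "Suc 0 \<le> x \<and> x \<le> m" using i \<open>Suc 0 \<le> s\<close> by simp
    qed
    show "{1..m} \<subseteq> (\<Union>s\<in>{1..r}. B' s)"
    proof
      fix x assume x: "x \<in> {1..m}"
      let ?i = "(x - 1) div r + 1" and ?s = "(x - 1) mod r + 1"
      have "x - 1 < c * r" using x m m1 by (simp add: mult.commute) linarith
      then have "(x - 1) div r < c" by (rule less_mult_imp_div_less)
      moreover have "(?i - 1) * r + ?s = x" using x by simp
      moreover have "?s \<in> {1..r}" using r by (simp add: Suc_leI)
      ultimately have "x \<in> B ?s" "?s \<in> {1..r}" unfolding B_def by (auto intro!: image_eqI[of _ _ ?i])
      then show "x \<in> (\<Union>s\<in>{1..r}. B' s)" unfolding B'_def by (intro UN_I[of ?s]) simp_all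
    qed
  qed
  have blk: "minor_det (B s) \<alpha> * \<kappa> ^ (s * c) = b" if s: "s \<in> {1..r}" for s
  proof -
    have "bij_betw (\<lambda>i. (i - 1) * r + s) {1..c} (B s)"
      unfolding bij_betw_def B_def using ix[of _ s _ s] s by (auto intro!: inj_onI)
    then have "minor_det (B s) \<alpha> = minor_det {1..c} (\<lambda>i i'. \<alpha> ((i - 1) * r + s) ((i' - 1) * r + s))"
      by (rule minor_det_reindex) simp
    \<comment> \<open>By \<open>F5\<close> the cokernel block of \<open>\<beta>\<close> arises from
      the \<open>s\<close>-th diagonal block of \<open>\<alpha>\<close> by scaling row
      \<open>i\<close> with \<open>\<kappa> ^ s * w i s\<close> and column \<open>i'\<close> with
      \<open>1 / w i' s\<close>; in the determinant the weights cancel.\<close>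
    moreover have "b = minor_det {1..c} (\<lambda>i i'. (\<kappa> ^ s * w i s) * \<alpha> ((i - 1) * r + s) ((i' - 1) * r + s) * (1 / w i' s))"
      unfolding b_def using F5[of _ _ s] s w by (intro minor_det_cong) (simp add: field_simps)
    moreover have "(\<Prod>i=1..c. \<kappa> ^ s * w i s) * (\<Prod>i=1..c. 1 / w i s) = \<kappa> ^ (s * c)"
      using w by (simp add: prod.distrib[symmetric] power_mult)
    ultimately show ?thesis
      using minor_det_scale[of "{1..c}" "\<lambda>i. \<kappa> ^ s * w i s"
          "\<lambda>i i'. \<alpha> ((i - 1) * r + s) ((i' - 1) * r + s)" "\<lambda>i. 1 / w i s"]
      by (metis finite_atLeastAtMost mult.commute)
  qed
  have "minor_det {1..m} \<alpha> = (\<Prod>s=1..r. minor_det (B' s) \<alpha>)"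
    unfolding U[symmetric]
  proof (rule minor_det_blocks)
    show "finite (B' s)" for s unfolding B'_def B_def by simp
    show "B' s \<inter> B' p = {}" if "s < p" for s p
      using ix[of _ s _ p] that unfolding B'_def B_def by auto
    show "\<alpha> i j = 0" if "1 \<le> s" "s < p" "p \<le> r" "i \<in> B' s" "j \<in> B' p" for s p i j
      using that F4 unfolding B'_def B_def by (auto split: if_splits)
  qed
  also have "\<dots> = (\<Prod>s=1..r. minor_det (B s) \<alpha>)" by (rule prod.cong) (simp_all add: B'_def)
  finally have A: "minor_det {1..m} \<alpha> = (\<Prod>s=1..r. minor_det (B s) \<alpha>)" .
  have "\<kappa> ^ (c * (r * (r + 1) div 2)) = (\<Prod>s=1..r. \<kappa> ^ (s * c))"
    unfolding sum_atLeast1_atMost[symmetric] by (simp add: power_sum sum_distrib_left mult.commute)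
  then have "minor_det {1..m} \<alpha> * \<kappa> ^ (c * (r * (r + 1) div 2)) = (\<Prod>s=1..r. minor_det (B s) \<alpha> * \<kappa> ^ (s * c))"
    unfolding A by (simp add: prod.distrib)
  also have "\<dots> = b ^ r" using blk by simp
  finally show "minor_det {1..m} \<alpha> * \<kappa> ^ (c * (r * (r + 1) div 2)) = b ^ r" .
  \<comment> \<open>The same matrix is split a second time, along the kernel direction. The factor
    over \<open>{1..<m}\<close> also occurs in \<open>\<beta>\<close> by \<open>F2\<close>, which
    links the two determinants.\<close>
  have "{1..m} = {1..<m} \<union> {m}" using m1 by auto
  then have "minor_det {1..m} \<alpha> = minor_det {1..<m} \<alpha> * minor_det {m} \<alpha>"
    using minor_det_block[of "{1..<m}" "{m}" \<alpha>] F1 by simp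
  moreover have "minor_det {m} \<alpha> = \<kappa>" by (simp add: minor_det_def F1)
  ultimately show "minor_det {1..m} \<alpha> = \<kappa> * minor_det {1..<m} \<alpha>" by simp
  have "bij_betw (\<lambda>i. m - 1 + i) {1..c} {m..n}"
    using m1 n by (intro bij_betw_byWitness[where f'="\<lambda>x. x - (m - 1)"]) auto
  then have "minor_det {m..n} \<beta> = b" unfolding b_def by (rule minor_det_reindex) simp
  moreover have "{1..n} = {m..n} \<union> {1..<m}" using m1 n by auto
  \<comment> \<open>The cokernel rows come first in the union because \<open>F3\<close> makes them
    vanish on the lower columns.\<close>
  moreover have "minor_det ({m..n} \<union> {1..<m}) \<beta> = minor_det {m..n} \<beta> * minor_det {1..<m} \<beta>"
  proof (rule minor_det_block)
    show "\<beta> i j = 0" if "i \<in> {m..n}" "j \<in> {1..<m}" for i j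
      using F3[of "i - (m - 1)" j] that m1 n by auto
  qed auto
  moreover have "minor_det {1..<m} \<beta> = minor_det {1..<m} \<alpha>" using F2 by (intro minor_det_cong) auto
  ultimately show "minor_det {1..n} \<beta> = minor_det {1..<m} \<alpha> * b" by simp
qed

subsection \<open>Symmetries of the normal form\<close>

text \<open>\<open>smooth_on\<close> speaks of vector-valued maps, so a scalar function is tested
  through its multiples of constant vectors; the type argument fixes the space of these
  vectors.\<close>

definition smooth_scalar :: "(real^'m::finite \<Rightarrow> real) \<Rightarrow> 'n::finite itself \<Rightarrow> bool" where
  "smooth_scalar p _ \<longleftrightarrow> (\<forall>v::real^'n. smooth_on UNIV (\<lambda>x. p x *\<^sub>R v))"

lemma smooth_on_ident: "smooth_on UNIV (\<lambda>x :: real^'m::finite. x)"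
proof -
  have "(*v) (mat 1 :: real^'m^'m) = (\<lambda>x. x)" by (rule ext) simp
  then show ?thesis using smooth_on_linear[where A="mat 1 :: real^'m^'m"] by simp
qed

lemma smooth_scalar_one: "smooth_scalar (\<lambda>x. 1) T"
  by (simp add: smooth_scalar_def smooth_on_const)

lemma smooth_scalar_coord_mult: "smooth_scalar q T \<Longrightarrow> smooth_scalar (\<lambda>x. x $ p * q x) T"
  unfolding smooth_scalar_def
proof
  fix v :: "real^'b" assume "\<forall>v::real^'b. smooth_on UNIV (\<lambda>x. q x *\<^sub>R v)"
  then have "smooth_on UNIV (\<lambda>x. (x $ p) *\<^sub>R (q x *\<^sub>R v))"
    by (intro smooth_on_mult smooth_on_ident) auto
  then show "smooth_on UNIV (\<lambda>x. (x $ p * q x) *\<^sub>R v)" by simp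
qed

lemma smooth_scalar_coord_power: "smooth_scalar (\<lambda>x. (x $ p) ^ j) T"
  by (induction j) (auto intro: smooth_scalar_one smooth_scalar_coord_mult)

lemma smooth_scalar_coord: "smooth_scalar (\<lambda>x. x $ p) T"
  using smooth_scalar_coord_power[of p 1] by simp

lemma smooth_scalar_add: "smooth_scalar p T \<Longrightarrow> smooth_scalar q T \<Longrightarrow> smooth_scalar (\<lambda>x. p x + q x) T"
  unfolding smooth_scalar_def by (simp add: scaleR_add_left smooth_on_add)

lemma smooth_scalar_sum: "(\<And>k. k \<in> K \<Longrightarrow> smooth_scalar (p k) T) \<Longrightarrow> smooth_scalar (\<lambda>x. \<Sum>k\<in>K. p k x) T"
  unfolding smooth_scalar_def by (simp add: scaleR_sum_left smooth_on_sum)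

lemma smooth_on_components:
  fixes f :: "real^'m::finite \<Rightarrow> real^'n::finite"
  assumes "\<And>q. smooth_scalar (\<lambda>x. f x $ q) TYPE('n)"
  shows "smooth_on UNIV f"
proof -
  have "smooth_on UNIV (\<lambda>x. \<Sum>q\<in>UNIV. (f x $ q) *\<^sub>R axis q 1)"
    using assms unfolding smooth_scalar_def by (intro smooth_on_sum) auto
  moreover have "(\<lambda>x. \<Sum>q\<in>UNIV. (f x $ q) *\<^sub>R axis q 1) = f"
    using basis_expansion[of "f _"] by (simp add: scalar_mult_eq_scaleR fun_eq_iff)
  ultimately show ?thesis by simp
qed

lemma prod_blocks: "prod g {1..a * r} = (\<Prod>i=1..a. \<Prod>j=1..r. g ((i - 1) * r + j))"
  for g :: "nat \<Rightarrow> 'b::comm_monoid_mult"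
proof (induction a)
  case (Suc a)
  have "{1..Suc a * r} = {1..a * r} \<union> (\<lambda>j. a * r + j) ` {1..r}"
    by (auto simp: image_iff)
  then have "prod g {1..Suc a * r} = prod g {1..a * r} * prod g ((\<lambda>j. a * r + j) ` {1..r})"
    by (simp only:) (rule prod.union_disjoint, auto)
  also have "prod g ((\<lambda>j. a * r + j) ` {1..r}) = (\<Prod>j=1..r. g (a * r + j))"
    by (subst prod.reindex) auto
  finally show ?case using Suc by simp
qed simp

lemma prod_sign_upto: "(\<Prod>j=1..r. (-1) ^ j) = ((-1) ^ (r * (r + 1) div 2) :: real)"
  by (simp only: sum_atLeast1_atMost[symmetric] power_sum)

lemma prod_sign_set: "finite A \<Longrightarrow> (\<Prod>k\<in>A. if P k then -1 else 1) = ((-1) ^ card {k\<in>A. P k} :: real)"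
  by (simp add: prod.If_cases Int_def)

section \<open>The normal form in coordinates and its diagonal symmetries\<close>

locale morin =
  fixes e :: "nat \<Rightarrow> 'm::finite" and e' :: "nat \<Rightarrow> 'n::finite" and m n a r :: nat
  assumes e: "bij_betw e {1..m} UNIV" and e': "bij_betw e' {1..n} UNIV"
    and m: "m = CARD('m)" and n: "n = CARD('n)" and na: "n = m + a"
    and a: "1 \<le> a" and r: "1 \<le> r" and mr: "r * (a + 1) \<le> m"
begin

abbreviation h :: "real^'m \<Rightarrow> real^'n" where "h \<equiv> morin_normal_form e e' r"

lemma h_component:
  assumes "1 \<le> k" "k \<le> n"
  shows "h x $ e' k = (if k < m then x $ e k else morin_component a r (k - (m - 1)) (\<lambda>k. x $ e k) (x $ e m))"
proof -
  have "inv_into {1..n} e' (e' k) = k" using e' assms by (simp add: bij_betw_def inv_into_f_f)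
  moreover have "n - m = a" using na by simp
  ultimately show ?thesis by (simp add: morin_normal_form_def Let_def m[symmetric] n[symmetric] del: One_nat_def)
qed

lemma m2: "2 \<le> m" "2 * r \<le> m"
proof -
  have "r * 2 \<le> r * (a + 1)" using a by (intro mult_le_mono2) simp
  then show "2 * r \<le> m" using mr by linarith
  then show "2 \<le> m" using r by linarith
qed

lemma h_low: "1 \<le> k \<Longrightarrow> k < m \<Longrightarrow> h x $ e' k = x $ e k"
  using h_component[of k] na by simp

lemma h_mid: "1 \<le> i \<Longrightarrow> i \<le> a \<Longrightarrow> h x $ e' (m - 1 + i) = (\<Sum>j=1..r. x $ e ((i - 1) * r + j) * (x $ e m) ^ j)"
  using h_component[of "m - 1 + i" x] na m2 by (simp add: morin_component_def)

lemma h_top: "h x $ e' n = (\<Sum>j=1..r - 1. x $ e (a * r + j) * (x $ e m) ^ j) + (x $ e m) ^ (r + 1)"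
  using h_component[of n x] na m2 a by (simp add: morin_component_def)

lemma e_cases: obtains k where "1 \<le> k" "k \<le> m" "p = e k"
  using e unfolding bij_betw_def by (metis UNIV_I atLeastAtMost_iff imageE)

lemma e'_cases:
  obtains k where "1 \<le> k" "k < m" "q = e' k" | i where "1 \<le> i" "i \<le> a" "q = e' (m - 1 + i)" | "q = e' n"
proof -
  obtain k where k: "1 \<le> k" "k \<le> n" "q = e' k"
    using e' unfolding bij_betw_def by (metis UNIV_I atLeastAtMost_iff imageE)
  consider "k < m" | "m \<le> k" "k < n" | "k = n" using k by linarith
  then show ?thesis
  proof cases
    case 2
    then have "k = m - 1 + (k - (m - 1))" "1 \<le> k - (m - 1)" "k - (m - 1) \<le> a" using na m2 by auto
    then show ?thesis using that(2) k by metis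
  qed (use k that in auto)
qed

lemma e_eq: "1 \<le> k \<Longrightarrow> k \<le> m \<Longrightarrow> 1 \<le> l \<Longrightarrow> l \<le> m \<Longrightarrow> e k = e l \<longleftrightarrow> k = l"
  using e unfolding bij_betw_def by (auto dest: inj_onD)

lemma e'_eq: "1 \<le> k \<Longrightarrow> k \<le> n \<Longrightarrow> 1 \<le> l \<Longrightarrow> l \<le> n \<Longrightarrow> e' k = e' l \<longleftrightarrow> k = l"
  using e' unfolding bij_betw_def by (auto dest: inj_onD)

lemma h_eqI:
  assumes "\<And>k. 1 \<le> k \<Longrightarrow> k < m \<Longrightarrow> y $ e' k = z $ e' k"
    "\<And>i. 1 \<le> i \<Longrightarrow> i \<le> a \<Longrightarrow> y $ e' (m - 1 + i) = z $ e' (m - 1 + i)" "y $ e' n = z $ e' n"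
  shows "y = z"
  unfolding vec_eq_iff using assms by (metis e'_cases)

lemma smooth_on_h: "smooth_on UNIV h"
proof (rule smooth_on_components)
  fix q
  show "smooth_scalar (\<lambda>x. h x $ q) TYPE('n)"
  proof (cases q rule: e'_cases)
    case (1 k)
    then show ?thesis by (simp add: h_low smooth_scalar_coord)
  next
    case (2 i)
    then show ?thesis
      by (simp only: h_mid) (intro smooth_scalar_sum smooth_scalar_coord_mult smooth_scalar_coord_power)
  next
    case 3
    then show ?thesis
      by (simp only: h_top)
        (intro smooth_scalar_sum smooth_scalar_coord_mult smooth_scalar_coord_power smooth_scalar_add)
  qed
qed

lemma h_zero: "h 0 = 0"
  using r by (intro h_eqI) (simp_all only: h_low h_mid h_top, simp_all add: zero_power)

lemma smooth_germ_h: "smooth_germ h"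
  unfolding smooth_germ_iff using smooth_on_h h_zero by blast

lemma morin_component_index: "1 \<le> i \<Longrightarrow> i \<le> a \<Longrightarrow> 1 \<le> j \<Longrightarrow> j \<le> r \<Longrightarrow> 1 \<le> (i - 1) * r + j \<and> (i - 1) * r + j \<le> a * r \<and> (i - 1) * r + j < m"
proof -
  assume *: "1 \<le> i" "i \<le> a" "1 \<le> j" "j \<le> r"
  have "(i - 1) * r + j \<le> (i - 1) * r + r" using * by simp
  also have "\<dots> = i * r" using * by (cases i) auto
  also have "\<dots> \<le> a * r" using * by simp
  finally show ?thesis using * mr r by (simp add: mult.commute)
qed

text \<open>Each component of \<open>h\<close> is a sum of monomials, so a diagonal change of
  coordinates preserves \<open>h\<close> once it preserves every monomial. The hypotheses list these
  conditions, and the determinants are the products of the entries.\<close>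

lemma diagonal_symmetry:
  fixes \<sigma> \<tau> :: "nat \<Rightarrow> real"
  assumes nz: "\<And>k. \<sigma> k \<noteq> 0" "\<And>k. \<tau> k \<noteq> 0"
    and low: "\<And>k. 1 \<le> k \<Longrightarrow> k < m \<Longrightarrow> \<tau> k * \<sigma> k = 1"
    and mid: "\<And>i j. 1 \<le> i \<Longrightarrow> i \<le> a \<Longrightarrow> 1 \<le> j \<Longrightarrow> j \<le> r \<Longrightarrow> \<tau> (m - 1 + i) * (\<sigma> ((i - 1) * r + j) * \<sigma> m ^ j) = 1"
    and top: "\<And>j. 1 \<le> j \<Longrightarrow> j < r \<Longrightarrow> \<tau> n * (\<sigma> (a * r + j) * \<sigma> m ^ j) = 1" "\<tau> n * \<sigma> m ^ (r + 1) = 1"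
  shows "oriented_equiv d (0 < prod \<sigma> {1..m}) (0 < prod \<tau> {1..n}) h h"
proof -
  define A :: "real^'m^'m" where "A = (\<chi> p q. if p = q then \<sigma> (inv_into {1..m} e p) else 0)"
  define B :: "real^'n^'n" where "B = (\<chi> p q. if p = q then \<tau> (inv_into {1..n} e' p) else 0)"
  have ie: "inv_into {1..m} e (e k) = k" if "1 \<le> k" "k \<le> m" for k
    using e that by (simp add: bij_betw_def inv_into_f_f)
  have ie': "inv_into {1..n} e' (e' k) = k" if "1 \<le> k" "k \<le> n" for k
    using e' that by (simp add: bij_betw_def inv_into_f_f)
  have dA: "det A = prod \<sigma> {1..m}"
  proof -
    have "det A = (\<Prod>p\<in>UNIV. \<sigma> (inv_into {1..m} e p))" by (subst det_diagonal) (auto simp: A_def)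
    also have "\<dots> = prod \<sigma> {1..m}"
      using prod.reindex_bij_betw[OF bij_betw_inv_into[OF e]] by simp
    finally show ?thesis .
  qed
  have dB: "det B = prod \<tau> {1..n}"
  proof -
    have "det B = (\<Prod>p\<in>UNIV. \<tau> (inv_into {1..n} e' p))" by (subst det_diagonal) (auto simp: B_def)
    also have "\<dots> = prod \<tau> {1..n}"
      using prod.reindex_bij_betw[OF bij_betw_inv_into[OF e']] by simp
    finally show ?thesis .
  qed
  have A: "(A *v x) $ e k = \<sigma> k * x $ e k" if "1 \<le> k" "k \<le> m" for x k
    using that by (simp add: A_def matrix_vector_mult_def ie if_distrib[where f="\<lambda>x. x * _"] cong: if_cong del: One_nat_def)
  have B: "(B *v x) $ e' k = \<tau> k * x $ e' k" if "1 \<le> k" "k \<le> n" for x k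
    using that by (simp add: B_def matrix_vector_mult_def ie' if_distrib[where f="\<lambda>x. x * _"] cong: if_cong del: One_nat_def)
  have eq: "B *v (h (A *v x)) = h x" for x
  proof (rule h_eqI)
    fix k assume k: "1 \<le> k" "k < m"
    then show "(B *v (h (A *v x))) $ e' k = h x $ e' k"
      using na low[OF k] by (simp add: B A h_low mult.assoc[symmetric])
  next
    fix i assume i: "1 \<le> i" "i \<le> a"
    have "(A *v x) $ e ((i - 1) * r + j) * (A *v x) $ e m ^ j =
        \<sigma> ((i - 1) * r + j) * \<sigma> m ^ j * (x $ e ((i - 1) * r + j) * x $ e m ^ j)" if "j \<in> {1..r}" for j
      using morin_component_index[OF i, of j] that m2 by (simp add: A power_mult_distrib)
    note comps = this
    have "(B *v (h (A *v x))) $ e' (m - 1 + i) = \<tau> (m - 1 + i) * h (A *v x) $ e' (m - 1 + i)"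
      by (rule B) (use i na m2 in linarith)+
    also have "\<dots> = (\<Sum>j=1..r. \<tau> (m - 1 + i) * (\<sigma> ((i - 1) * r + j) * \<sigma> m ^ j) * (x $ e ((i - 1) * r + j) * x $ e m ^ j))"
      unfolding h_mid[OF i] sum_distrib_left using comps by (intro sum.cong) (simp_all add: mult.assoc)
    also have "\<dots> = h x $ e' (m - 1 + i)"
      unfolding h_mid[OF i] using mid[OF i] by (intro sum.cong) auto
    finally show "(B *v (h (A *v x))) $ e' (m - 1 + i) = h x $ e' (m - 1 + i)" .
  next
    have "(A *v x) $ e (a * r + j) * (A *v x) $ e m ^ j =
        \<sigma> (a * r + j) * \<sigma> m ^ j * (x $ e (a * r + j) * x $ e m ^ j)" if "j \<in> {1..r-1}" for j
    proof -
      have "1 \<le> a * r + j" "a * r + j \<le> m" using that mr by (auto simp: algebra_simps)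
      then show ?thesis using m2 by (simp add: A power_mult_distrib)
    qed
    note comps = this
    have Am: "(A *v x) $ e m = \<sigma> m * x $ e m" using m2 by (intro A) linarith+
    have "(B *v (h (A *v x))) $ e' n = \<tau> n * h (A *v x) $ e' n"
      by (rule B) (use na m2 in linarith)+
    also have "\<dots> = (\<Sum>j=1..r - 1. \<tau> n * (\<sigma> (a * r + j) * \<sigma> m ^ j) * (x $ e (a * r + j) * x $ e m ^ j))
          + \<tau> n * \<sigma> m ^ (r + 1) * x $ e m ^ (r + 1)"
      unfolding h_top distrib_left sum_distrib_left using comps
      by (intro arg_cong2[where f="(+)"] sum.cong) (simp_all add: Am power_mult_distrib mult.assoc)
    also have "\<dots> = h x $ e' n"
      unfolding h_top using top r by (intro arg_cong2[where f="(+)"] sum.cong) auto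
    finally show "(B *v (h (A *v x))) $ e' n = h x $ e' n" .
  qed
  have "diffeo_germ ((*v) A)" "diffeo_germ ((*v) B)"
    using nz by (auto intro!: diffeo_germ_linear simp: dA dB)
  moreover have "(*v) B \<circ> h \<circ> (*v) A = h" using eq by auto
  ultimately show ?thesis unfolding oriented_equiv_def
    using smooth_germ_h dA dB by (intro conjI exI[of _ "(*v) A"] exI[of _ "(*v) B"])
      (auto simp: jacobian_linear jet_eq_refl)
qed

lemma pos_neg_one: "0 < (-1 :: real) ^ k \<longleftrightarrow> even k"
  by (cases "even k") auto

text \<open>The coordinates with indices \<open>1..r\<close> enter the last \<open>a + 1\<close>
  components only through the first of them, which is linear in them. Reversing them, their target
  copies and this component, whose target index is \<open>m\<close>, gives \<open>r\<close> signs in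
  the source and \<open>r + 1\<close> in the target.\<close>

lemma symmetry_flip_component: "oriented_equiv d (even r) (odd r) h h"
proof -
  let ?\<sigma> = "\<lambda>k. if k \<le> r then -1 else 1 :: real" and ?\<tau> = "\<lambda>k. if k \<le> r \<or> k = m then -1 else 1 :: real"
  have "oriented_equiv d (0 < prod ?\<sigma> {1..m}) (0 < prod ?\<tau> {1..n}) h h"
  proof (rule diagonal_symmetry)
    fix i j assume i: "1 \<le> i" "i \<le> a" "1 \<le> j" "j \<le> r"
    have "r < (i - 1) * r + j" if "i \<noteq> 1"
    proof -
      have "i = Suc (Suc (i - 2))" using that i by simp
      then obtain i' where "i = Suc (Suc i')" by blast
      then show ?thesis using i by simp
    qed
    then show "?\<tau> (m - 1 + i) * (?\<sigma> ((i - 1) * r + j) * ?\<sigma> m ^ j) = 1"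
      using i m2 r by (cases "i = 1") auto
  next
    fix j assume "1 \<le> j" "j < r"
    moreover have "1 * r \<le> a * r" using a by (intro mult_le_mono1) simp
    ultimately have "\<not> a * r + j \<le> r" by linarith
    then show "?\<tau> n * (?\<sigma> (a * r + j) * ?\<sigma> m ^ j) = 1" using m2 na a r by auto
  qed (use m2 r na a in auto)
  moreover have "{k\<in>{1..m}. k \<le> r} = {1..r}" "{k\<in>{1..n}. k \<le> r \<or> k = m} = insert m {1..r}" "m \<notin> {1..r}"
    using m2 na r by auto
  ultimately show ?thesis by (simp add: prod_sign_set pos_neg_one del: One_nat_def)
qed

text \<open>The last component uses indices only up to \<open>a * r + r - 1\<close> besides
  \<open>m\<close>, so the coordinate \<open>r * (a + 1)\<close>, here different from
  \<open>m\<close>, occurs only as its own target copy. Reversing both costs one sign on each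
  side.\<close>

lemma symmetry_flip_unused:
  assumes "r * (a + 1) < m"
  shows "oriented_equiv d False False h h"
proof -
  let ?\<sigma> = "\<lambda>k. if k = r * (a + 1) then -1 else 1 :: real"
  have *: "1 \<le> r * (a + 1)" using r by simp
  have "oriented_equiv d (0 < prod ?\<sigma> {1..m}) (0 < prod ?\<sigma> {1..n}) h h"
  proof (rule diagonal_symmetry)
    fix i j assume i: "1 \<le> i" "i \<le> a" "1 \<le> j" "j \<le> r"
    then show "?\<sigma> (m - 1 + i) * (?\<sigma> ((i - 1) * r + j) * ?\<sigma> m ^ j) = 1"
      using assms morin_component_index[OF i] r by (auto simp: algebra_simps)
  qed (use assms na in \<open>auto simp: algebra_simps\<close>)
  moreover have "prod ?\<sigma> {1..m} = -1" "prod ?\<sigma> {1..n} = -1"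
    using * assms na by (subst prod.delta; simp)+
  ultimately show ?thesis by simp
qed

text \<open>Reversing the coordinate \<open>m\<close> is compensated by the sign
  \<open>(-1) ^ j\<close> on the coefficient of its \<open>j\<close>-th power. In the last component
  the pure power forces the target sign \<open>(-1) ^ (r + 1)\<close>, hence the signs
  \<open>(-1) ^ (r + 1 - j)\<close> there; at \<open>j = r\<close> this is the sign of the
  coordinate \<open>m\<close> itself.\<close>

lemma symmetry_flip_kernel:
  assumes meq: "m = r * (a + 1)"
  defines "T \<equiv> r * (r + 1) div 2"
  shows "oriented_equiv d (even ((a + 1) * T)) (even ((a + 1) * T + r)) h h"
proof -
  define \<sigma> :: "nat \<Rightarrow> real" where
    "\<sigma> k = (if k \<le> a * r then (-1) ^ ((k - 1) mod r + 1) else (-1) ^ (r + 1 - (k - a * r)))" for k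
  define \<tau> :: "nat \<Rightarrow> real" where "\<tau> k = (if k < m then \<sigma> k else if k < n then 1 else (-1) ^ (r + 1))" for k
  have s_mid: "\<sigma> ((i - 1) * r + j) = (-1) ^ j" if "1 \<le> i" "i \<le> a" "1 \<le> j" "j \<le> r" for i j
  proof -
    have "(i - 1) * r + j - 1 = (i - 1) * r + (j - 1)" "j - 1 < r" using that by auto
    then have "((i - 1) * r + j - 1) mod r = j - 1" by simp
    then show ?thesis using morin_component_index[OF that] that by (simp add: \<sigma>_def)
  qed
  have s_top: "\<sigma> (a * r + j) = (-1) ^ (r + 1 - j)" if "1 \<le> j" for j
    using that by (simp add: \<sigma>_def)
  have m': "m = a * r + r" using meq by (simp add: algebra_simps)
  have s_m: "\<sigma> m = -1" using s_top[of r] r m' by simp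
  have sq: "\<sigma> k * \<sigma> k = 1" for k by (simp add: \<sigma>_def power_add[symmetric] flip: mult_2)
  have pow: "(-1 :: real) ^ (r + 1) * ((-1) ^ (r + 1 - j) * (-1) ^ j) = 1" if "j < r" for j
  proof -
    have "(r + 1) + ((r + 1 - j) + j) = 2 * (r + 1)" using that by simp
    then show ?thesis by (metis power_add power_mult power2_minus power_one)
  qed
  have "oriented_equiv d (0 < prod \<sigma> {1..m}) (0 < prod \<tau> {1..n}) h h"
  proof (rule diagonal_symmetry)
    show "\<sigma> k \<noteq> 0" for k by (simp add: \<sigma>_def)
    then show "\<tau> k \<noteq> 0" for k by (simp add: \<tau>_def)
    show "\<tau> k * \<sigma> k = 1" if "k < m" for k using sq that by (simp add: \<tau>_def)
    show "\<tau> (m - 1 + i) * (\<sigma> ((i - 1) * r + j) * \<sigma> m ^ j) = 1" if i: "1 \<le> i" "i \<le> a" "1 \<le> j" "j \<le> r" for i j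
    proof -
      have "\<not> m - 1 + i < m" "m - 1 + i < n" using i na m2 by linarith+
      then have "\<tau> (m - 1 + i) = 1" by (simp add: \<tau>_def del: One_nat_def)
      then show ?thesis unfolding s_mid[OF i] s_m by (simp flip: power_mult_distrib)
    qed
    show "\<tau> n * (\<sigma> (a * r + j) * \<sigma> m ^ j) = 1" if "1 \<le> j" "j < r" for j
      using pow[OF that(2)] na by (simp add: \<tau>_def s_m s_top[OF that(1)])
    show "\<tau> n * \<sigma> m ^ (r + 1) = 1" unfolding s_m using na by (simp add: \<tau>_def flip: power_mult_distrib)
  qed
  moreover have Ps: "prod \<sigma> {1..m} = (-1) ^ ((a + 1) * T)"
  proof -
    have "prod \<sigma> {1..m} = prod \<sigma> {1..(a + 1) * r}" using meq by (simp add: mult.commute)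
    also have "\<dots> = (\<Prod>i=1..a. \<Prod>j=1..r. \<sigma> ((i - 1) * r + j)) * (\<Prod>j=1..r. \<sigma> (a * r + j))"
      unfolding prod_blocks by simp
    also have "(\<Prod>i=1..a. \<Prod>j=1..r. \<sigma> ((i - 1) * r + j)) = (\<Prod>i=1..a. \<Prod>j=1..r. (-1) ^ j)"
      using s_mid by (intro prod.cong) auto
    also have "(\<Prod>j=1..r. \<sigma> (a * r + j)) = (\<Prod>j=1..r. (-1) ^ (r + 1 - j))"
      using s_top by (intro prod.cong) auto
    \<comment> \<open>The exponents run through \<open>1..r\<close> backwards, so the last block
      contributes the same sign as the other \<open>a\<close> blocks.\<close>
    also have "\<dots> = (\<Prod>j=1..r. (-1) ^ j)"
      by (subst (2) prod.atLeastAtMost_rev) (simp add: add.commute)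
    finally show ?thesis unfolding T_def prod_sign_upto by (simp add: power_mult[symmetric] power_add mult.commute)
  qed
  \<comment> \<open>Source and target share the signs below \<open>m\<close>; beyond them stand
    \<open>-1\<close> in the source and \<open>(-1) ^ (r + 1)\<close> in the target.\<close>
  moreover have "prod \<tau> {1..n} = prod \<sigma> {1..m} * (-1) ^ r"
  proof -
    have "{1..n} = {1..<m} \<union> ({m..<n} \<union> {n})" using m2 na by auto
    then have "prod \<tau> {1..n} = prod \<tau> {1..<m} * prod \<tau> ({m..<n} \<union> {n})"
      using na a by (simp only:) (rule prod.union_disjoint, auto)
    also have "prod \<tau> ({m..<n} \<union> {n}) = prod \<tau> {m..<n} * prod \<tau> {n}"
      by (rule prod.union_disjoint) auto
    also have "prod \<tau> {1..<m} = prod \<sigma> {1..<m}" by (rule prod.cong) (auto simp: \<tau>_def)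
    also have "prod \<tau> {m..<n} = 1" by (rule prod.neutral) (auto simp: \<tau>_def)
    also have "prod \<tau> {n} = (-1) ^ (r + 1)" using na by (simp add: \<tau>_def)
    finally have "prod \<tau> {1..n} = prod \<sigma> {1..<m} * (-1) ^ (r + 1)" by simp
    moreover have "{1..m} = {1..<m} \<union> {m}" using m2 by auto
    then have "prod \<sigma> {1..m} = prod \<sigma> {1..<m} * \<sigma> m" by (simp add: prod.union_disjoint)
    ultimately show ?thesis unfolding s_m by simp
  qed
  ultimately show ?thesis by (simp add: pos_neg_one power_add[symmetric])
qed

end

subsection \<open>Order of determinacy\<close>

lemma smooth_germ_minus:
  fixes f g :: "real^'m::finite \<Rightarrow> real^'n::finite"
  assumes "smooth_germ f" "smooth_germ g"
  shows "smooth_germ (\<lambda>x. f x - g x)"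
    and "jet_eq d f g \<Longrightarrow> jet_eq d (\<lambda>x. f x - g x) (\<lambda>x. 0)"
proof -
  \<comment> \<open>Negation is written as a matrix, so that composition with a linear germ yields
    smoothness.\<close>
  let ?g = "\<lambda>x. ((\<chi> i j. if i = j then -1 else 0) :: real^'n^'n) *v g x"
  have mg: "?g x = - g x" for x
    by (simp add: vec_eq_iff matrix_vector_mult_def if_distrib[where f="\<lambda>x. x * _"] cong: if_cong)
  have "smooth_germ ?g"
    using smooth_germ_comp[OF assms(2) smooth_germ_linear] by (simp add: o_def)
  then obtain U V where o: "open U" "0 \<in> U" "smooth_on U f" "open V" "0 \<in> V" "smooth_on V ?g"
    using assms unfolding smooth_germ_iff by metis
  have z: "f 0 = 0" "g 0 = 0" using assms unfolding smooth_germ_iff by auto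
  let ?W = "U \<inter> V"
  have W: "open ?W" "0 \<in> ?W" "smooth_on ?W f" "smooth_on ?W ?g"
    using o by (auto intro: smooth_on_subset[OF o(3)] smooth_on_subset[OF o(6)])
  have "smooth_on ?W (\<lambda>x. f x + ?g x)" using W by (intro smooth_on_add)
  then show "smooth_germ (\<lambda>x. f x - g x)"
    unfolding smooth_germ_iff mg using W(1,2) z by auto
  assume d: "jet_eq d f g"
  obtain V' where o': "open V'" "0 \<in> V'" "smooth_on V' g" using assms unfolding smooth_germ_iff by metis
  let ?X = "?W \<inter> V'"
  have X: "open ?X" "0 \<in> ?X" "smooth_on ?X f" "smooth_on ?X g" "smooth_on ?X ?g"
    using o o' by (auto intro: smooth_on_subset[OF o(3)] smooth_on_subset[OF o(6)] smooth_on_subset[OF o'(3)])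
  \<comment> \<open>Adding \<open>- g\<close> to both sides of the equality of jets turns the
    right-hand side into 0.\<close>
  have "jet_pair ?X UNIV (\<lambda>x. 0::real^1) (\<lambda>x. 0) d (\<lambda>x. f x + ?g x) (\<lambda>x. g x + ?g x)"
    using X d by (intro jet_pair.add jet_pair.base jet_eq_refl)
  then have "jet_eq d (\<lambda>x. f x + ?g x) (\<lambda>x. g x + ?g x)"
    using X by (intro jet_pair_jet_eq[of ?X "\<lambda>x. 0::real^1" "\<lambda>x. 0" UNIV]) (auto intro: smooth_on_const)
  then show "jet_eq d (\<lambda>x. f x - g x) (\<lambda>x. 0)" by (simp add: mg)
qed

lemma higher_partial_monomial:
  fixes p :: "'m::finite" and v :: "real^'n::finite"
  shows "length I \<le> k \<Longrightarrow> \<exists>c. higher_partial I (\<lambda>x. (x $ p) ^ k *\<^sub>R v) = (\<lambda>x. (c * (x $ p) ^ (k - length I)) *\<^sub>R v)"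
proof (induction I)
  case Nil
  show ?case by (intro exI[of _ 1]) simp
next
  case (Cons i I)
  then obtain c where c: "higher_partial I (\<lambda>x. (x $ p) ^ k *\<^sub>R v) = (\<lambda>x. (c * (x $ p) ^ (k - length I)) *\<^sub>R v)"
    by auto
  let ?q = "k - length I"
  have "((\<lambda>x. (c * (x $ p) ^ ?q) *\<^sub>R v) has_derivative (\<lambda>w. (c * (real ?q * (w $ p) * (x $ p) ^ (?q - 1))) *\<^sub>R v)) (at x)" for x :: "real^'m"
    by (auto intro!: derivative_eq_intros bounded_linear.has_derivative[OF bounded_linear_vec_nth])
  from frechet_derivative_at[OF this]
  have "higher_partial (i # I) (\<lambda>x. (x $ p) ^ k *\<^sub>R v) =
      (\<lambda>x. (c * (real ?q * (axis i 1 $ p) * (x $ p) ^ (?q - 1))) *\<^sub>R v)"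
    by (simp add: c fun_eq_iff)
  then show ?case
    \<comment> \<open>The entry of the basis vector is 0 unless \<open>i = p\<close>, so one
      constant covers both cases.\<close>
    by (intro exI[of _ "c * (real ?q * (axis i 1 $ p))"]) (simp add: mult_ac)
qed

section \<open>Orders of vanishing along curves\<close>

lemma first_order_bound:
  assumes "smooth_on U G" "open U" "0 \<in> U"
  shows "\<exists>C. \<forall>\<^sub>F z in nhds 0. norm (G z - G 0) \<le> C * norm z ^ 1"
proof -
  have "smooth_on U (\<lambda>z. G z + - G 0)" using assms by (intro smooth_on_add smooth_on_const)
  then show ?thesis using jet_eq_zero_bound[of U "\<lambda>z. G z - G 0" 0] assms by (simp add: jet_eq_def)
qed

text \<open>Applied to the kernel line with \<open>s = 1\<close> and to its image under
  \<open>h\<close>, a curve with \<open>s = r + 1\<close>.\<close>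

lemma bigo_along:
  fixes G :: "'a::real_normed_vector \<Rightarrow> real^'n::finite" and \<zeta> :: "real \<Rightarrow> 'a"
  assumes "\<exists>C. \<forall>\<^sub>F z in nhds 0. norm (G z) \<le> C * norm z ^ k" "\<And>t. norm (\<zeta> t) = \<bar>t\<bar> ^ s" "0 < s"
  shows "(\<lambda>t. G (\<zeta> t) $ q) \<in> O[at 0](\<lambda>t. t ^ (s * k))"
proof -
  obtain C where C: "\<forall>\<^sub>F z in nhds 0. norm (G z) \<le> C * norm z ^ k" using assms(1) by blast
  have "(\<lambda>t::real. \<bar>t\<bar> ^ s) \<midarrow>0\<rightarrow> 0" using assms(3) by (auto intro!: tendsto_eq_intros)
  then have "(\<zeta> \<longlongrightarrow> 0) (at 0)" by (subst tendsto_norm_zero_iff[symmetric]) (simp add: assms(2))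
  from eventually_compose_filterlim[OF C this]
  have "\<forall>\<^sub>F t in at 0. norm (G (\<zeta> t) $ q) \<le> C * norm (t ^ (s * k))"
    by eventually_elim
      (use component_le_norm_cart in \<open>force simp: assms(2) power_abs power_mult intro: order_trans\<close>)
  then show ?thesis by (rule bigoI)
qed

lemma bigo_power_mono: "f \<in> O[at 0](\<lambda>t::real. t ^ k) \<Longrightarrow> j \<le> k \<Longrightarrow> f \<in> O[at 0](\<lambda>t. t ^ j)"
proof -
  assume f: "f \<in> O[at 0](\<lambda>t::real. t ^ k)" and j: "j \<le> k"
  have "\<forall>\<^sub>F t::real in at 0. \<bar>t\<bar> < 1"
    using eventually_at[of "\<lambda>t::real. \<bar>t\<bar> < 1" 0 UNIV] by (auto intro!: exI[of _ 1])
  then have "\<forall>\<^sub>F t::real in at 0. norm (t ^ k) \<le> 1 * norm (t ^ j)"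
    by eventually_elim (use j in \<open>auto simp: power_abs intro!: power_decreasing\<close>)
  then have "(\<lambda>t::real. t ^ k) \<in> O[at 0](\<lambda>t. t ^ j)" by (rule bigoI)
  with f show ?thesis by (rule landau_o.big_trans)
qed

text \<open>As \<open>\<tau> t\<close> behaves like \<open>\<kappa> * t\<close> with nonzero
  \<open>\<kappa>\<close>, its powers are as independent as those of \<open>t\<close>. Once the
  lower coefficients are gone, dividing by \<open>t ^ s\<close> and passing to the limit isolates
  the coefficient of index \<open>s\<close>.\<close>

lemma expansion_unique:
  fixes w :: "nat \<Rightarrow> real" and \<tau> :: "real \<Rightarrow> real"
  assumes \<tau>: "((\<lambda>t. \<tau> t / t) \<longlongrightarrow> \<kappa>) (at 0)" and nz: "\<kappa> \<noteq> 0" and p: "1 \<le> p" "p \<le> r"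
    and O: "(\<lambda>t. (\<Sum>j=1..r. w j * \<tau> t ^ j) - c * t ^ p) \<in> O[at 0](\<lambda>t. t ^ (p + 1))"
  shows "\<And>j. 1 \<le> j \<Longrightarrow> j < p \<Longrightarrow> w j = 0" and "w p * \<kappa> ^ p = c"
proof -
  have step: "w s * \<kappa> ^ s = (if s = p then c else 0)"
    if s: "1 \<le> s" "s \<le> p" and less: "\<And>j. 1 \<le> j \<Longrightarrow> j < s \<Longrightarrow> w j = 0" for s
  proof -
    let ?F = "\<lambda>t. (\<Sum>j=1..r. w j * \<tau> t ^ j) - c * t ^ p"
    have "?F \<in> o[at 0](\<lambda>t. t ^ s)"
    proof (rule landau_o.big_small_trans[OF O])
      have "((\<lambda>t::real. t ^ (p + 1) / t ^ s) \<longlongrightarrow> 0) (at 0)"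
      proof (rule Lim_transform_eventually)
        have "((\<lambda>t::real. t ^ (p + 1 - s)) \<longlongrightarrow> 0 ^ (p + 1 - s)) (at 0)" by (intro tendsto_intros)
        then show "((\<lambda>t::real. t ^ (p + 1 - s)) \<longlongrightarrow> 0) (at 0)" using s by (simp add: zero_power)
        show "\<forall>\<^sub>F t::real in at 0. t ^ (p + 1 - s) = t ^ (p + 1) / t ^ s"
          unfolding eventually_at_filter using s by (simp add: power_diff)
      qed
      then show "(\<lambda>t::real. t ^ (p + 1)) \<in> o[at 0](\<lambda>t. t ^ s)"
      proof (rule smalloI_tendsto)
        show "\<forall>\<^sub>F t::real in at 0. t ^ s \<noteq> 0"
          unfolding eventually_at_filter by (intro always_eventually) auto
      qed
    qed
    from smalloD_tendsto[OF this] have lim0: "((\<lambda>t. ?F t / t ^ s) \<longlongrightarrow> 0) (at 0)" .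
    let ?G = "\<lambda>t. (\<Sum>j=s..r. w j * ((\<tau> t / t) ^ j * t ^ (j - s))) - c * t ^ (p - s)"
    have "((\<lambda>t. ?F t / t ^ s) \<longlongrightarrow> (\<Sum>j=s..r. w j * (\<kappa> ^ j * 0 ^ (j - s))) - c * 0 ^ (p - s)) (at 0)"
    proof (rule Lim_transform_eventually)
      show "(?G \<longlongrightarrow> (\<Sum>j=s..r. w j * (\<kappa> ^ j * 0 ^ (j - s))) - c * 0 ^ (p - s)) (at 0)"
        by (intro tendsto_intros \<tau>)
      show "\<forall>\<^sub>F t in at 0. ?G t = ?F t / t ^ s"
        unfolding eventually_at_filter
      proof (intro always_eventually allI impI)
        fix t :: real assume t: "t \<noteq> 0"
        have "(\<Sum>j=1..r. w j * \<tau> t ^ j) = (\<Sum>j=s..r. w j * \<tau> t ^ j)"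
          using s less by (intro sum.mono_neutral_right) auto
        moreover have "w j * \<tau> t ^ j / t ^ s = w j * ((\<tau> t / t) ^ j * t ^ (j - s))" if "j \<in> {s..r}" for j
          using t that by (simp add: power_diff power_divide)
        moreover have "c * t ^ p / t ^ s = c * t ^ (p - s)" using t s by (simp add: power_diff)
        ultimately show "?G t = ?F t / t ^ s" by (simp add: diff_divide_distrib sum_divide_distrib)
      qed
    qed
    from tendsto_unique[OF _ this lim0]
    have "(\<Sum>j=s..r. w j * (\<kappa> ^ j * 0 ^ (j - s))) = c * 0 ^ (p - s)" by simp
    moreover have "(\<Sum>j=s..r. w j * (\<kappa> ^ j * 0 ^ (j - s))) = (\<Sum>j\<in>{s..r}. if j = s then w s * \<kappa> ^ s else 0)"
      by (intro sum.cong) (auto simp: power_0_left)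
    ultimately show ?thesis using s p by (auto simp: power_0_left split: if_splits)
  qed
  have zero: "w j = 0" if "1 \<le> j" "j < p" for j
    using that
  proof (induction j rule: less_induct)
    case (less j)
    then show ?case using step[of j] nz by simp
  qed
  then show "\<And>j. 1 \<le> j \<Longrightarrow> j < p \<Longrightarrow> w j = 0" .
  show "w p * \<kappa> ^ p = c" using step[of p] zero p by simp
qed

section \<open>A lower bound for the order of determinacy\<close>

context morin
begin

lemma axis_e: "1 \<le> k \<Longrightarrow> k \<le> m \<Longrightarrow> 1 \<le> l \<Longrightarrow> l \<le> m \<Longrightarrow> axis (e l) c $ e k = (if k = l then c else 0)"
  using e_eq by (simp add: axis_def)

lemma h_zero_isolated:
  assumes "h x = 0"
  shows "x = 0"
proof -
  have low: "x $ e k = 0" if "1 \<le> k" "k < m" for k using h_low[OF that, of x] assms by simp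
  have "a * r + j < m" if "j \<in> {1..r - 1}" for j
    using that mr r by (auto simp: algebra_simps)
  then have "(\<Sum>j=1..r - 1. x $ e (a * r + j) * (x $ e m) ^ j) = 0"
    by (intro sum.neutral ballI) (simp add: low)
  then have "x $ e m = 0" using h_top[of x] assms by auto
  then show ?thesis unfolding vec_eq_iff using low by (metis e_cases le_neq_implies_less zero_index)
qed

lemma h_kernel: "h (t *\<^sub>R axis (e m) 1) = t ^ (r + 1) *\<^sub>R axis (e' n) 1"
proof -
  have low: "(t *\<^sub>R axis (e m) (1::real)) $ e k = 0" if "1 \<le> k" "k < m" for k
    using that m2 by (simp add: axis_e)
  show ?thesis
  proof (rule h_eqI)
  fix k assume k: "1 \<le> k" "k < m"
  then show "h (t *\<^sub>R axis (e m) 1) $ e' k = (t ^ (r + 1) *\<^sub>R axis (e' n) 1) $ e' k"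
    unfolding h_low[OF k] low[OF k] using e'_eq[of k n] na by (simp add: axis_def)
next
  fix i assume i: "1 \<le> i" "i \<le> a"
  have "e' n \<noteq> e' (m - 1 + i)" using e'_eq[of n "m - 1 + i"] i na m2 by linarith
  moreover have "h (t *\<^sub>R axis (e m) 1) $ e' (m - 1 + i) = 0"
    unfolding h_mid[OF i]
  proof (intro sum.neutral ballI)
    fix j assume "j \<in> {1..r}"
    then have "(t *\<^sub>R axis (e m) (1::real)) $ e ((i - 1) * r + j) = 0"
      using morin_component_index[OF i, of j] by (intro low) auto
    then show "(t *\<^sub>R axis (e m) (1::real)) $ e ((i - 1) * r + j) * (t *\<^sub>R axis (e m) 1) $ e m ^ j = 0"
      by (simp only: mult_zero_left)
  qed
  ultimately show "h (t *\<^sub>R axis (e m) 1) $ e' (m - 1 + i) = (t ^ (r + 1) *\<^sub>R axis (e' n) 1) $ e' (m - 1 + i)"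
    by (simp add: axis_def del: One_nat_def)
next
  have "(t *\<^sub>R axis (e m) (1::real)) $ e (a * r + j) = 0" if "j \<in> {1..r - 1}" for j
    using that mr r by (intro low) (auto simp: algebra_simps)
  then have "(\<Sum>j=1..r - 1. (t *\<^sub>R axis (e m) (1::real)) $ e (a * r + j) * ((t *\<^sub>R axis (e m) 1) $ e m) ^ j) = 0"
    by (intro sum.neutral ballI) (simp only: mult_zero_left)
  then show "h (t *\<^sub>R axis (e m) 1) $ e' n = (t ^ (r + 1) *\<^sub>R axis (e' n) 1) $ e' n"
    by (simp add: h_top)
qed
qed

text \<open>Without its monomial of degree \<open>r + 1\<close>, the normal form vanishes on a whole line,
  whereas the zero of \<open>h\<close> is isolated.\<close>

lemma determined_order:
  assumes "determined d h"
  shows "r + 1 \<le> d"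
proof (rule ccontr)
  assume "\<not> r + 1 \<le> d"
  define u :: "real^'m \<Rightarrow> real^'n" where "u = (\<lambda>x. (x $ e m) ^ (r + 1) *\<^sub>R axis (e' n) 1)"
  have "smooth_on UNIV u" using smooth_scalar_coord_power[of "e m" "r + 1" "TYPE('n)"]
    unfolding smooth_scalar_def u_def by blast
  then have u: "smooth_germ u" unfolding smooth_germ_iff by (auto simp: u_def)
  have ju: "jet_eq d u (\<lambda>x. 0)"
    unfolding jet_eq_def
  proof (intro allI impI)
    fix I :: "'m list" assume "length I \<le> d"
    \<comment> \<open>At most \<open>d\<close> derivatives leave a positive power of the coordinate,
      which vanishes at 0; hence subtracting \<open>u\<close> does not change the
      \<open>d\<close>-jet.\<close>
    then have I: "length I < r + 1" using \<open>\<not> r + 1 \<le> d\<close> by simp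
    then obtain c where "higher_partial I u = (\<lambda>x. (c * (x $ e m) ^ (r + 1 - length I)) *\<^sub>R axis (e' n) 1)"
      unfolding u_def using higher_partial_monomial[of I "r + 1" "e m" "axis (e' n) 1"] by auto
    then show "higher_partial I u 0 = higher_partial I (\<lambda>x. 0) 0"
      using I by (simp add: higher_partial_zero zero_power)
  qed
  let ?k = "\<lambda>x. h x - u x"
  have k: "smooth_germ ?k" using smooth_germ_minus(1)[OF smooth_germ_h u] .
  have "jet_eq d h ?k"
  proof -
    have hk: "(\<lambda>x. h x - ?k x) = u" by auto
    obtain U where U: "open U" "0 \<in> U" "smooth_on U u" using u unfolding smooth_germ_iff by blast
    obtain V where V: "open V" "0 \<in> V" "smooth_on V ?k" using k unfolding smooth_germ_iff by blast
    have sub: "smooth_on (U \<inter> V) u" "smooth_on (U \<inter> V) ?k"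
      using smooth_on_subset[OF U(3)] smooth_on_subset[OF V(3)] by auto
    have "jet_pair (U \<inter> V) UNIV (\<lambda>x. 0::real^1) (\<lambda>x. 0) d (\<lambda>x. ?k x + u x) (\<lambda>x. ?k x + 0)"
      using sub ju by (intro jet_pair.add jet_pair.base jet_eq_refl smooth_on_const)
    then have "jet_eq d (\<lambda>x. ?k x + u x) (\<lambda>x. ?k x + 0)"
      using U V by (intro jet_pair_jet_eq[of "U \<inter> V" "\<lambda>x. 0::real^1" "\<lambda>x. 0" UNIV]) (auto intro: smooth_on_const)
    then show ?thesis by simp
  qed
  then have "A_equivalent ?k h"
    using assms k unfolding determined_def jet_eq_iff by metis
  then obtain \<phi> \<Phi> where *: "diffeo_germ \<phi>" "diffeo_germ \<Phi>" "\<forall>\<^sub>F x in nhds 0. \<Phi> (?k (\<phi> x)) = h x"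
    unfolding A_equivalent_def by auto
  obtain \<psi> where \<psi>: "diffeo_germ \<psi>" "\<forall>\<^sub>F y in nhds 0. \<phi> (\<psi> y) = y"
    using *(1) by (rule diffeo_germ_inverse)
  have z: "\<phi> 0 = 0" "\<Phi> 0 = 0" using *(1,2) diffeo_germ_smooth unfolding smooth_germ_iff by blast+
  \<comment> \<open>Coordinate changes fix 0, so the isolation of the zero would carry over from
    \<open>h\<close> to \<open>?k\<close>.\<close>
  have "\<forall>\<^sub>F y in nhds 0. ?k y = 0 \<longrightarrow> y = 0"
    using smooth_germ_eventually[OF diffeo_germ_smooth[OF \<psi>(1)] *(3)] \<psi>(2)
  proof eventually_elim
    case (elim y)
    show ?case
    proof
      assume "?k y = 0"
      then have "h (\<psi> y) = 0" using elim z by simp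
      then have "\<psi> y = 0" by (rule h_zero_isolated)
      then show "y = 0" using elim(2) z by simp
    qed
  qed
  then obtain \<epsilon> where \<epsilon>: "\<epsilon> > 0" "\<And>y. norm y < \<epsilon> \<Longrightarrow> ?k y = 0 \<Longrightarrow> y = 0"
    unfolding eventually_nhds_metric by (auto simp: dist_norm)
  let ?y = "(\<epsilon> / 2) *\<^sub>R axis (e m) 1 :: real^'m"
  have "?k ?y = 0" unfolding h_kernel u_def by simp
  moreover have "norm ?y < \<epsilon>" using \<epsilon>(1) by simp
  ultimately have "?y = 0" using \<epsilon>(2) by blast
  then show False using \<epsilon>(1) by (simp add: axis_eq_0_iff)
qed

end

subsection \<open>The obstruction\<close>

lemma partial_comp_frechet:
  assumes "f differentiable (at x)" "\<Phi> differentiable (at (f x))"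
  shows "partial i (\<lambda>x. \<Phi> (f x)) x = frechet_derivative \<Phi> (at (f x)) (partial i f x)"
  unfolding frechet_derivative_at[OF has_derivative_compose[OF has_derivative_frechet[OF assms(1)] has_derivative_frechet[OF assms(2)]], symmetric]
  ..

lemma partial_diff:
  assumes "v differentiable (at x)" "w differentiable (at x)"
  shows "partial i (\<lambda>x. v x - w x) x = partial i v x - partial i w x"
  unfolding frechet_derivative_at[OF has_derivative_diff[OF has_derivative_frechet[OF assms(1)] has_derivative_frechet[OF assms(2)]], symmetric]
  ..

lemma frechet_component:
  fixes f :: "real^'m::finite \<Rightarrow> real^'n::finite"
  assumes "f differentiable (at x)" "((\<lambda>x. f x $ q) has_derivative D) (at x)"
  shows "frechet_derivative f (at x) w $ q = D w"
proof -
  have "((\<lambda>x. f x $ q) has_derivative (\<lambda>w. frechet_derivative f (at x) w $ q)) (at x)"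
    using bounded_linear.has_derivative[OF bounded_linear_vec_nth has_derivative_frechet[OF assms(1)]] .
  from has_derivative_unique[OF this assms(2)] show ?thesis by meson
qed

lemma bigo_power_mult:
  assumes "f \<in> O[at 0](\<lambda>t::real. t ^ j)" "g \<in> O[at 0](\<lambda>t. t ^ k)" "l \<le> j + k"
  shows "(\<lambda>t. f t * g t) \<in> O[at 0](\<lambda>t. t ^ l)"
  using landau_o.big.mult[OF assms(1,2)] assms(3)
  by (intro bigo_power_mono[of _ "j + k" l]) (simp_all add: power_add)

lemma bigo_power_power:
  assumes "f \<in> O[at 0](\<lambda>t::real. t ^ 1)" "l \<le> j"
  shows "(\<lambda>t. f t ^ j) \<in> O[at 0](\<lambda>t. t ^ l)"
  using landau_o.big_power[OF assms(1), of j] assms(2) by (intro bigo_power_mono[of _ j l]) simp_all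

lemma bigo_const_power: "(\<lambda>t::real. c) \<in> O[at 0](\<lambda>t. t ^ 0)"
  by simp

lemma bigo_bounded:
  assumes "(\<lambda>t. f t - c) \<in> O[at 0](\<lambda>t::real. t ^ k)"
  shows "f \<in> O[at 0](\<lambda>t. t ^ 0)"
  using sum_in_bigo(1)[OF bigo_power_mono[OF assms, of 0] bigo_const_power[of c]] by simp

section \<open>The derivative of the normal form along the kernel line\<close>

context morin
begin

text \<open>For \<open>m = r * (a + 1)\<close> the index pair \<open>(a + 1, r)\<close> is the
  coordinate \<open>m\<close> itself. The derivative of its power \<open>r + 1\<close> then has the
  shape of the \<open>r\<close>-th summand that the last component lacks, and one formula serves all
  \<open>a + 1\<close> components.\<close>

definition weight :: "nat \<Rightarrow> nat \<Rightarrow> real" where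
  "weight i j = (if i = a + 1 \<and> j = r then real (r + 1) else 1)"

text \<open>The part of the derivative with respect to the coordinate \<open>m\<close> that has
  other coordinates as coefficients; the bound \<open>< m\<close> leaves out the summand already
  covered by \<open>weight\<close>. It vanishes on the kernel line and is small on the image of that
  line under \<open>\<phi>\<close>.\<close>

definition remainder :: "nat \<Rightarrow> real^'m \<Rightarrow> real" where
  "remainder i x = (\<Sum>j | j \<in> {1..r} \<and> (i - 1) * r + j < m. x $ e ((i - 1) * r + j) * (real j * (x $ e m) ^ (j - 1)))"

lemma h_differentiable: "h differentiable (at x)"
  using smooth_on_differentiable[OF smooth_on_h] by simp

lemma Dh_low:
  assumes "1 \<le> k" "k < m"
  shows "frechet_derivative h (at x) w $ e' k = w $ e k"
proof (rule frechet_component[OF h_differentiable])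
  show "((\<lambda>x. h x $ e' k) has_derivative (\<lambda>w. w $ e k)) (at x)"
    unfolding h_low[OF assms]
    by (rule bounded_linear_imp_has_derivative) (rule bounded_linear_vec_nth)
qed

lemma monomial_derivative:
  fixes x :: "real^'m"
  shows "((\<lambda>x. \<Sum>j\<in>K. x $ f j * (x $ p) ^ j) has_derivative
    (\<lambda>w. (\<Sum>j\<in>K. w $ f j * (x $ p) ^ j) + (\<Sum>j\<in>K. x $ f j * (real j * (x $ p) ^ (j - 1))) * w $ p)) (at x)"
proof -
  have c: "((\<lambda>x. x $ q) has_derivative (\<lambda>w. w $ q)) (at x)" for q :: 'm
    by (rule bounded_linear_imp_has_derivative) (rule bounded_linear_vec_nth)
  have "((\<lambda>x. \<Sum>j\<in>K. x $ f j * (x $ p) ^ j) has_derivative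
    (\<lambda>w. \<Sum>j\<in>K. x $ f j * (real j * w $ p * (x $ p) ^ (j - 1)) + w $ f j * (x $ p) ^ j)) (at x)"
    by (intro has_derivative_sum has_derivative_mult has_derivative_power c)
  then show ?thesis
    by (rule has_derivative_eq_rhs) (simp add: fun_eq_iff sum.distrib sum_distrib_left sum_distrib_right mult_ac)
qed

lemma Dh_high:
  assumes meq: "m = r * (a + 1)" and i: "1 \<le> i" "i \<le> a + 1"
  shows "frechet_derivative h (at x) w $ e' (m - 1 + i) =
    (\<Sum>j=1..r. weight i j * w $ e ((i - 1) * r + j) * (x $ e m) ^ j) + remainder i x * w $ e m"
proof (cases "i \<le> a")
  case True
  have S: "{j. j \<in> {1..r} \<and> (i - 1) * r + j < m} = {1..r}"
    using morin_component_index[OF i(1) True] by auto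
  show ?thesis
  proof (rule frechet_component[OF h_differentiable])
    show "((\<lambda>x. h x $ e' (m - 1 + i)) has_derivative (\<lambda>w.
      (\<Sum>j=1..r. weight i j * w $ e ((i - 1) * r + j) * (x $ e m) ^ j) + remainder i x * w $ e m)) (at x)"
      unfolding h_mid[OF i(1) True] remainder_def S
      using monomial_derivative[where K="{1..r}" and f="\<lambda>j. e ((i - 1) * r + j)" and p="e m" and x=x] True
      by (simp add: weight_def)
  qed
next
  case False
  then have ia: "i = a + 1" using i by simp
  have m': "m = a * r + r" using meq by (simp add: algebra_simps)
  have S: "{j. j \<in> {1..r} \<and> (i - 1) * r + j < m} = {1..r - 1}"
    using r unfolding ia m' by auto
  have K: "m - 1 + i = n" using ia na m2 by simp
  have I: "{1..r} = insert r {1..r - 1}" using r by auto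
  have d: "((\<lambda>x. (x $ e m) ^ (r + 1)) has_derivative (\<lambda>w. real (r + 1) * w $ e m * (x $ e m) ^ (r + 1 - 1))) (at x)"
    by (intro has_derivative_power bounded_linear_imp_has_derivative bounded_linear_vec_nth)
  show ?thesis unfolding K
  proof (rule frechet_component[OF h_differentiable])
    show "((\<lambda>x. h x $ e' n) has_derivative (\<lambda>w.
      (\<Sum>j=1..r. weight i j * w $ e ((i - 1) * r + j) * (x $ e m) ^ j) + remainder i x * w $ e m)) (at x)"
      unfolding h_top remainder_def S
    proof (rule has_derivative_eq_rhs[OF has_derivative_add[OF monomial_derivative d]], rule ext)
      fix w :: "real^'m"
      have "(\<Sum>j=1..r. weight i j * w $ e ((i - 1) * r + j) * (x $ e m) ^ j)
        = weight i r * w $ e ((i - 1) * r + r) * (x $ e m) ^ r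
          + (\<Sum>j=1..r-1. weight i j * w $ e ((i - 1) * r + j) * (x $ e m) ^ j)"
        unfolding I using r by (subst sum.insert) auto
      also have "weight i r * w $ e ((i - 1) * r + r) = real (r + 1) * w $ e m"
        by (simp add: weight_def ia m')
      also have "(\<Sum>j=1..r-1. weight i j * w $ e ((i - 1) * r + j) * (x $ e m) ^ j)
        = (\<Sum>j=1..r-1. w $ e (a * r + j) * (x $ e m) ^ j)"
        using r by (intro sum.cong) (auto simp: weight_def ia)
      finally show "(\<Sum>j=1..r-1. w $ e (a * r + j) * (x $ e m) ^ j) +
        (\<Sum>j=1..r-1. x $ e (a * r + j) * (real j * (x $ e m) ^ (j - 1))) * w $ e m +
        real (r + 1) * w $ e m * (x $ e m) ^ (r + 1 - 1) =
        (\<Sum>j=1..r. weight i j * w $ e ((i - 1) * r + j) * (x $ e m) ^ j) +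
        (\<Sum>j=1..r-1. x $ e ((i - 1) * r + j) * (real j * (x $ e m) ^ (j - 1))) * w $ e m"
        by (simp add: ia)
    qed
  qed
qed

lemma index_le:
  assumes "m = r * (a + 1)" "1 \<le> i" "i \<le> a + 1" "1 \<le> j" "j \<le> r"
  shows "1 \<le> (i - 1) * r + j" "(i - 1) * r + j \<le> m"
    "(i - 1) * r + j = m \<longleftrightarrow> i = a + 1 \<and> j = r"
proof -
  have m': "m = (a + 1 - 1) * r + r" using assms(1) by (simp add: algebra_simps)
  show "1 \<le> (i - 1) * r + j" using assms by simp
  have "(i - 1) * r \<le> a * r" using assms by (intro mult_le_mono1) simp
  moreover have "m = a * r + r" using m' by simp
  ultimately show "(i - 1) * r + j \<le> m" using assms(5) by linarith
  show "(i - 1) * r + j = m \<longleftrightarrow> i = a + 1 \<and> j = r"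
    unfolding m' using block_index_inj[of i r j "a + 1" r] assms r by auto
qed

abbreviation kernel_line :: "real \<Rightarrow> real^'m" where "kernel_line t \<equiv> t *\<^sub>R axis (e m) 1"

lemma kernel_line_component: "1 \<le> k \<Longrightarrow> k \<le> m \<Longrightarrow> kernel_line t $ e k = (if k = m then t else 0)"
  using axis_e[of k m "1::real"] m2 by simp

lemma Dh_kernel_low:
  assumes "1 \<le> k" "k < m" "1 \<le> l" "l \<le> m"
  shows "partial (e l) h x $ e' k = (if k = l then 1 else 0)"
  using assms by (simp add: Dh_low axis_e)

lemma Dh_kernel_high:
  assumes meq: "m = r * (a + 1)" and i: "1 \<le> i" "i \<le> a + 1" and i': "1 \<le> i'" "i' \<le> a + 1" and p: "1 \<le> p" "p \<le> r"
  shows "partial (e ((i' - 1) * r + p)) h (kernel_line t) $ e' (m - 1 + i) = (if i = i' then weight i' p * t ^ p else 0)"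
proof -
  have "remainder i (kernel_line t) = 0"
    unfolding remainder_def
  proof (intro sum.neutral ballI)
    fix j assume "j \<in> {j. j \<in> {1..r} \<and> (i - 1) * r + j < m}"
    then have "kernel_line t $ e ((i - 1) * r + j) = 0"
      using kernel_line_component[of "(i - 1) * r + j" t] by auto
    then show "kernel_line t $ e ((i - 1) * r + j) * (real j * kernel_line t $ e m ^ (j - 1)) = 0" by simp
  qed
  then have "partial (e ((i' - 1) * r + p)) h (kernel_line t) $ e' (m - 1 + i) =
    (\<Sum>j=1..r. weight i j * axis (e ((i' - 1) * r + p)) 1 $ e ((i - 1) * r + j) * kernel_line t $ e m ^ j)"
    unfolding Dh_high[OF meq i] by (simp only: mult_zero_left add_0_right)
  also have "\<dots> = (\<Sum>j=1..r. if j = p then (if i = i' then weight i' p * t ^ p else 0) else 0)"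
  proof (rule sum.cong[OF refl])
    fix j assume j: "j \<in> {1..r}"
    show "weight i j * axis (e ((i' - 1) * r + p)) 1 $ e ((i - 1) * r + j) * kernel_line t $ e m ^ j =
      (if j = p then (if i = i' then weight i' p * t ^ p else 0) else 0)"
    proof (cases "j = p \<and> i = i'")
      case True
      then show ?thesis by simp
    next
      case False
      then have "(i - 1) * r + j \<noteq> (i' - 1) * r + p"
        using block_index_inj[of i r j i' p] j i i' p by auto
      then have "axis (e ((i' - 1) * r + p)) (1::real) $ e ((i - 1) * r + j) = 0"
        using e_eq[of "(i - 1) * r + j" "(i' - 1) * r + p"] index_le[OF meq i, of j] index_le[OF meq i' p] j
        by (simp add: axis_def)
      then show ?thesis using False by (simp only: mult_zero_left mult_zero_right) auto
    qed
  qed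
  also have "\<dots> = (if i = i' then weight i' p * t ^ p else 0)" using p by simp
  finally show ?thesis .
qed

lemma target_sum:
  fixes g :: "'n \<Rightarrow> 'b::comm_monoid_add"
  shows "(\<Sum>q\<in>UNIV. g q) = (\<Sum>k\<in>{1..<m}. g (e' k)) + (\<Sum>i=1..a+1. g (e' (m - 1 + i)))"
proof -
  have "(\<Sum>q\<in>UNIV. g q) = (\<Sum>k\<in>{1..n}. g (e' k))" using sum.reindex_bij_betw[OF e', of g] by simp
  also have "{1..n} = {1..<m} \<union> {m..n}" using m2 na by auto
  also have "(\<Sum>k\<in>{1..<m} \<union> {m..n}. g (e' k)) = (\<Sum>k\<in>{1..<m}. g (e' k)) + (\<Sum>k\<in>{m..n}. g (e' k))"
    by (rule sum.union_disjoint) auto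
  also have "(\<Sum>k\<in>{m..n}. g (e' k)) = (\<Sum>i=1..a+1. g (e' (m - 1 + i)))"
    using m2 na by (intro sum.reindex_bij_witness[of _ "\<lambda>i. m - 1 + i" "\<lambda>k. k - (m - 1)"]) auto
  finally show ?thesis .
qed

text \<open>On the kernel line a column of the derivative of \<open>h\<close> has at most two
  nonzero entries: the target copy of the coordinate, absent for \<open>l = m\<close>, and a
  multiple of \<open>t ^ p\<close> in a single component. So the chain rule for a map after
  \<open>h\<close> collapses to two terms.\<close>

lemma Dh_kernel_sum:
  assumes meq: "m = r * (a + 1)" and i': "1 \<le> i'" "i' \<le> a + 1" and p: "1 \<le> p" "p \<le> r"
    and l: "l = (i' - 1) * r + p"
  shows "(\<Sum>q\<in>UNIV. partial (e l) h (kernel_line t) $ q * Q q) =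
    (if l < m then Q (e' l) else 0) + weight i' p * t ^ p * Q (e' (m - 1 + i'))"
proof -
  have l1: "1 \<le> l" "l \<le> m" using index_le[OF meq i' p] l by auto
  have "(\<Sum>k\<in>{1..<m}. partial (e l) h (kernel_line t) $ e' k * Q (e' k)) = (\<Sum>k\<in>{1..<m}. if k = l then Q (e' k) else 0)"
    using l1 by (intro sum.cong) (auto simp: Dh_kernel_low)
  moreover have "(\<Sum>i=1..a+1. partial (e l) h (kernel_line t) $ e' (m - 1 + i) * Q (e' (m - 1 + i)))
      = (\<Sum>i=1..a+1. if i = i' then weight i' p * t ^ p * Q (e' (m - 1 + i')) else 0)"
    unfolding l using Dh_kernel_high[OF meq _ _ i' p] by (intro sum.cong) auto
  ultimately show ?thesis unfolding target_sum using l1 i' by simp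
qed

lemma obstruction:
  assumes meq: "m = r * (a + 1)" and \<phi>: "diffeo_germ \<phi>" and \<Psi>: "diffeo_germ \<Psi>"
    and jet: "jet_eq (r + 1) (h \<circ> \<phi>) (\<Psi> \<circ> h)"
  obtains \<kappa> b D where "\<kappa> \<noteq> 0" "det (jacobian \<phi>) * \<kappa> ^ ((a + 1) * (r * (r + 1) div 2)) = b ^ r"
    "det (jacobian \<phi>) = \<kappa> * D" "det (jacobian \<Psi>) = D * b"
proof -
  define \<alpha> where "\<alpha> k l = jacobian \<phi> $ e k $ e l" for k l
  define \<beta> where "\<beta> k l = jacobian \<Psi> $ e' k $ e' l" for k l
  define \<kappa> where "\<kappa> = \<alpha> m m"
  let ?\<gamma> = kernel_line
  note sm = diffeo_germ_smooth[OF \<phi>] diffeo_germ_smooth[OF \<Psi>] smooth_germ_h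
  have m0: "1 \<le> m" using m2 by simp
  have K1: "1 \<le> m - 1 + i" "m - 1 + i \<le> n" if "1 \<le> i" "i \<le> a + 1" for i using that na m2 by auto

  \<comment> \<open>At order one, \<open>\<phi>\<close> preserves the kernel and
    \<open>\<Psi>\<close> the image of the jacobian of \<open>h\<close>; this gives
    \<open>F1\<close>, \<open>F2\<close> and \<open>F3\<close>.\<close>
  have "jacobian h ** jacobian \<phi> = jacobian \<Psi> ** jacobian h"
    using jacobian_jet_eq[OF jet] jacobian_comp[OF sm(1,3)] jacobian_comp[OF sm(3,2)] by simp
  then have J: "jacobian h *v (jacobian \<phi> *v v) = jacobian \<Psi> *v (jacobian h *v v)" for v
    by (simp add: matrix_vector_mul_assoc)
  have Jh: "jacobian h *v v = frechet_derivative h (at 0) v" for v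
    using frechet_derivative_at[OF smooth_germ_has_derivative[OF sm(3)]] by metis
  have Jlow: "(jacobian h *v v) $ e' k = v $ e k" if "1 \<le> k" "k < m" for k v
    unfolding Jh by (rule Dh_low[OF that])
  have Jhigh: "(jacobian h *v v) $ e' (m - 1 + i) = 0" if i: "1 \<le> i" "i \<le> a + 1" for i v
  proof -
    have "(\<Sum>j=1..r. weight i j * v $ e ((i - 1) * r + j) * (0::real^'m) $ e m ^ j) = 0"
      by (intro sum.neutral ballI) (simp add: zero_power)
    then show ?thesis unfolding Jh Dh_high[OF meq i] by (simp add: remainder_def)
  qed
  have Jax: "jacobian h *v axis (e l) 1 = (if l < m then axis (e' l) 1 else 0)" if l: "1 \<le> l" "l \<le> m" for l
  proof (rule h_eqI)
    fix k assume k: "1 \<le> k" "k < m"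
    then show "(jacobian h *v axis (e l) 1) $ e' k = (if l < m then axis (e' l) 1 else 0) $ e' k"
      using l e'_eq[of k l] e_eq[of k l] na by (simp add: Jlow axis_def)
  next
    fix i assume i: "1 \<le> i" "i \<le> a"
    then have "e' (m - 1 + i) \<noteq> e' l" if "l < m" using e'_eq[of "m - 1 + i" l] l that na by linarith
    then show "(jacobian h *v axis (e l) 1) $ e' (m - 1 + i) = (if l < m then axis (e' l) 1 else 0) $ e' (m - 1 + i)"
      using Jhigh[of i "axis (e l) 1"] i by (simp add: axis_def)
  next
    have "e' n \<noteq> e' l" if "l < m" using e'_eq[of n l] l that na by linarith
    moreover have "m - 1 + (a + 1) = n" using na m2 by simp
    ultimately show "(jacobian h *v axis (e l) 1) $ e' n = (if l < m then axis (e' l) 1 else 0) $ e' n"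
      using Jhigh[of "a + 1" "axis (e l) 1"] by (simp add: axis_def)
  qed
  have col: "(A *v axis l 1) $ k = A $ k $ l" for A :: "real^'k::finite^'l::finite" and k l
    by (simp add: matrix_vector_mult_basis column_def)
  have F1: "\<alpha> k m = 0" if "1 \<le> k" "k < m" for k
    using arg_cong[OF J[of "axis (e m) 1"], of "\<lambda>v. v $ e' k"] that m2
    by (simp add: Jax Jlow \<alpha>_def col)
  have F2: "\<beta> k l = \<alpha> k l" if "1 \<le> k" "k < m" "1 \<le> l" "l < m" for k l
    using arg_cong[OF J[of "axis (e l) 1"], of "\<lambda>v. v $ e' k"] that
    by (simp add: Jax Jlow \<alpha>_def \<beta>_def col)
  have F3: "\<beta> (m - 1 + i) l = 0" if "1 \<le> i" "i \<le> a + 1" "1 \<le> l" "l < m" for i l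
    using arg_cong[OF J[of "axis (e l) 1"], of "\<lambda>v. v $ e' (m - 1 + i)"] that
    unfolding Jhigh[OF that(1,2)] by (simp add: Jax \<beta>_def col)
  have \<kappa>: "\<kappa> \<noteq> 0"
  proof
    assume "\<kappa> = 0"
    then have "jacobian \<phi> *v axis (e m) 1 = 0"
      unfolding vec_eq_iff col zero_index using F1 \<alpha>_def \<kappa>_def by (metis e_cases le_neq_implies_less)
    moreover have "invertible (jacobian \<phi>)" using det_jacobian_nz[OF \<phi>] invertible_det_nz by blast
    ultimately have "axis (e m) (1::real) = 0"
      using matrix_left_invertible_ker invertible_left_inverse by metis
    then show False by (simp add: axis_eq_0_iff)
  qed

  define u where "u = (\<lambda>x. (h \<circ> \<phi>) x - (\<Psi> \<circ> h) x)"
  have u: "smooth_germ u" "jet_eq (r + 1) u (\<lambda>x. 0)"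
    unfolding u_def using smooth_germ_minus[OF smooth_germ_comp[OF sm(1,3)] smooth_germ_comp[OF sm(3,2)]] jet by auto
  obtain W where W: "open W" "0 \<in> W" "smooth_on W u" using u(1) unfolding smooth_germ_iff by blast
  obtain U where U: "open U" "0 \<in> U" "smooth_on U \<phi>" "\<phi> 0 = 0" using sm(1) unfolding smooth_germ_iff by blast
  obtain V where V: "open V" "0 \<in> V" "smooth_on V \<Psi>" "\<Psi> 0 = 0" using sm(2) unfolding smooth_germ_iff by blast
  have n\<gamma>: "norm (?\<gamma> t) = \<bar>t\<bar> ^ 1" for t by simp
  \<comment> \<open>Since \<open>h\<close> maps the kernel line to a curve of order
    \<open>r + 1\<close>, the map \<open>\<Psi>\<close> and its partial derivatives are constant
    along that curve up to this order.\<close>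
  have nh: "norm (h (?\<gamma> t)) = \<bar>t\<bar> ^ (r + 1)" for t
    unfolding h_kernel by (simp add: power_abs abs_mult)
  have Ou: "(\<lambda>t. u (?\<gamma> t) $ q) \<in> O[at 0](\<lambda>t. t ^ (r + 1))" for q
    by (rule bigo_power_mono[OF bigo_along[OF jet_eq_zero_bound[OF W u(2)] n\<gamma>]]) simp_all
  \<comment> \<open>A partial derivative of \<open>u\<close> has vanishing jet of order only
    \<open>r\<close>, but this already makes it \<open>O(t ^ (r + 1))\<close>.\<close>
  have Opu: "(\<lambda>t. partial l u (?\<gamma> t) $ q) \<in> O[at 0](\<lambda>t. t ^ (r + 1))" for l q
  proof -
    have "jet_eq r (partial l u) (\<lambda>x. 0)" using jet_eq_partial[of r u "\<lambda>x. 0" l] u(2) by simp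
    then show ?thesis
      using bigo_along[OF jet_eq_zero_bound[OF W(1,2) smooth_on_partial[OF W(3)]] n\<gamma>, of r l q] by simp
  qed
  have O\<Psi>: "(\<lambda>t. \<Psi> (h (?\<gamma> t)) $ q) \<in> O[at 0](\<lambda>t. t ^ (r + 1))" for q
    using bigo_along[OF first_order_bound[OF V(3,1,2)] nh, of q] V(4) by simp
  have Op\<Psi>: "(\<lambda>t. partial (e' l) \<Psi> (h (?\<gamma> t)) $ e' k - \<beta> k l) \<in> O[at 0](\<lambda>t. t ^ (r + 1))" for k l
    using bigo_along[OF first_order_bound[OF smooth_on_partial[OF V(3)] V(1,2)] nh, of "e' l" "e' k"]
    by (simp add: \<beta>_def jacobian_entry)
  have O\<phi>: "(\<lambda>t. \<phi> (?\<gamma> t) $ q) \<in> O[at 0](\<lambda>t. t ^ 1)" for q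
    using bigo_along[OF first_order_bound[OF U(3,1,2)] n\<gamma>, of q] U(4) by simp
  have Op\<phi>: "(\<lambda>t. partial (e l) \<phi> (?\<gamma> t) $ e k - \<alpha> k l) \<in> O[at 0](\<lambda>t. t ^ 1)" for k l
    using bigo_along[OF first_order_bound[OF smooth_on_partial[OF U(3)] U(1,2)] n\<gamma>, of "e l" "e k"]
    by (simp add: \<alpha>_def jacobian_entry)
  define \<tau> where "\<tau> t = \<phi> (?\<gamma> t) $ e m" for t
  have O\<tau>: "\<tau> \<in> O[at 0](\<lambda>t. t ^ 1)" using O\<phi>[of "e m"] unfolding \<tau>_def .
  have lim\<tau>: "((\<lambda>t. \<tau> t / t) \<longlongrightarrow> \<kappa>) (at 0)"
  proof -
    have "((\<lambda>t. \<phi> (?\<gamma> t)) has_derivative (\<lambda>s. jacobian \<phi> *v ?\<gamma> s)) (at 0)"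
      using has_derivative_compose[of ?\<gamma> ?\<gamma> 0 UNIV \<phi> "(*v) (jacobian \<phi>)"]
        smooth_germ_has_derivative[OF sm(1)]
      by (simp add: bounded_linear_imp_has_derivative bounded_linear_scaleR_left)
    from bounded_linear.has_derivative[OF bounded_linear_vec_nth this, of "e m"]
    have "(\<tau> has_derivative (\<lambda>s. (jacobian \<phi> *v ?\<gamma> s) $ e m)) (at 0)" unfolding \<tau>_def .
    moreover have "(jacobian \<phi> *v ?\<gamma> s) $ e m = \<kappa> * s" for s
      by (simp add: matrix_vector_mult_scaleR col \<kappa>_def \<alpha>_def mult.commute)
    ultimately have "(\<tau> has_field_derivative \<kappa>) (at 0)" unfolding has_field_derivative_def by simp
    then have "((\<lambda>t. (\<tau> (0 + t) - \<tau> 0) / t) \<longlongrightarrow> \<kappa>) (at 0)" unfolding DERIV_def .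
    then show ?thesis by (simp add: \<tau>_def U(4))
  qed
  \<comment> \<open>The lower components of \<open>h \<circ> \<phi>\<close> are those of
    \<open>\<phi>\<close>, and they agree up to \<open>u\<close> with those of \<open>\<Psi>\<close>
    on a curve of order \<open>r + 1\<close>: the image of the kernel line is tangent to it to order
    \<open>r\<close>.\<close>
  have Olow: "(\<lambda>t. \<phi> (?\<gamma> t) $ e k) \<in> O[at 0](\<lambda>t. t ^ (r + 1))" if k: "1 \<le> k" "k < m" for k
  proof -
    have "\<phi> (?\<gamma> t) $ e k = u (?\<gamma> t) $ e' k + \<Psi> (h (?\<gamma> t)) $ e' k" for t
      using h_low[OF k, of "\<phi> (?\<gamma> t)"] by (simp add: u_def)
    then show ?thesis using sum_in_bigo(1)[OF Ou O\<Psi>, of "e' k" "e' k"] by presburger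
  qed
  \<comment> \<open>The chain rules apply only near 0. For \<open>h \<circ> \<phi>\<close> the
    derivative of \<open>h\<close> is kept as a map; for \<open>\<Psi> \<circ> h\<close> the sum
    over target coordinates is written out so that the sparse columns of the derivative of
    \<open>h\<close> can be used.\<close>
  have ev: "\<forall>\<^sub>F t in at 0. \<forall>l. partial l u (?\<gamma> t) = frechet_derivative h (at (\<phi> (?\<gamma> t))) (partial l \<phi> (?\<gamma> t))
      - (\<Sum>q\<in>UNIV. (partial l h (?\<gamma> t) $ q) *\<^sub>R partial q \<Psi> (h (?\<gamma> t)))"
  proof -
    have "\<forall>\<^sub>F x in nhds 0. x \<in> U" "\<forall>\<^sub>F x in nhds 0. h x \<in> V"
      using eventually_nhds_in_open[OF U(1,2)] smooth_germ_eventually[OF sm(3) eventually_nhds_in_open[OF V(1,2)]] .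
    then have "\<forall>\<^sub>F x in nhds 0. x \<in> U \<and> h x \<in> V" by (rule eventually_conj)
    moreover have "(?\<gamma> \<longlongrightarrow> 0) (at 0)" by (auto intro!: tendsto_eq_intros)
    ultimately have "\<forall>\<^sub>F t in at 0. ?\<gamma> t \<in> U \<and> h (?\<gamma> t) \<in> V" by (rule eventually_compose_filterlim)
    then show ?thesis
    proof eventually_elim
      case (elim t)
      then have d: "\<phi> differentiable (at (?\<gamma> t))" "\<Psi> differentiable (at (h (?\<gamma> t)))"
        using smooth_on_differentiable U(3) V(3) by blast+
      have d1: "(\<lambda>x. h (\<phi> x)) differentiable (at (?\<gamma> t))" "(\<lambda>x. \<Psi> (h x)) differentiable (at (?\<gamma> t))"
        by (rule partial_comp(1)[OF d(1) h_differentiable]) (rule partial_comp(1)[OF h_differentiable d(2)])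
      show ?case
        unfolding u_def o_def partial_diff[OF d1] partial_comp(2)[OF h_differentiable d(2)]
          partial_comp_frechet[OF d(1) h_differentiable] by simp
    qed
  qed

  \<comment> \<open>In the component \<open>m - 1 + i\<close> of the derivative along the coordinate
    \<open>(i' - 1) * r + p\<close>, one side is a polynomial in \<open>\<tau> t\<close> with
    coefficients from \<open>\<alpha>\<close>, the other a multiple of \<open>t ^ p\<close>, up to
    \<open>O(t ^ (p + 1))\<close>. Comparing powers gives both claims.\<close>
  have main: "(\<forall>s. 1 \<le> s \<and> s < p \<longrightarrow> weight i s * \<alpha> ((i - 1) * r + s) ((i' - 1) * r + p) = 0) \<and>
      weight i p * \<alpha> ((i - 1) * r + p) ((i' - 1) * r + p) * \<kappa> ^ p = \<beta> (m - 1 + i) (m - 1 + i') * weight i' p"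
    if i: "1 \<le> i" "i \<le> a + 1" and i': "1 \<le> i'" "i' \<le> a + 1" and p: "1 \<le> p" "p \<le> r" for i i' p
  proof -
    define l where "l = (i' - 1) * r + p"
    have l1: "1 \<le> l" "l \<le> m" using index_le[OF meq i' p] l_def by auto
    define P where "P k q t = partial (e' q) \<Psi> (h (?\<gamma> t)) $ e' k" for k q t
    define A where "A k t = partial (e l) \<phi> (?\<gamma> t) $ e k" for k t
    have OP: "(\<lambda>t. P k q t - \<beta> k q) \<in> O[at 0](\<lambda>t. t ^ (r + 1))" for k q using Op\<Psi>[of q k] unfolding P_def .
    have OP0: "P k q \<in> O[at 0](\<lambda>t. t ^ 0)" for k q by (rule bigo_bounded[OF OP])
    have OA1: "(\<lambda>t. A k t - \<alpha> k l) \<in> O[at 0](\<lambda>t. t ^ 1)" for k using Op\<phi>[of l k] unfolding A_def .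
    have OA0: "A k \<in> O[at 0](\<lambda>t. t ^ 0)" for k by (rule bigo_bounded[OF OA1])
    have eq: "\<forall>\<^sub>F t in at 0. frechet_derivative h (at (\<phi> (?\<gamma> t))) (partial (e l) \<phi> (?\<gamma> t)) $ e' k =
        partial (e l) u (?\<gamma> t) $ e' k + ((if l < m then P k l t else 0) + weight i' p * t ^ p * P k (m - 1 + i') t)" for k
      using ev
    proof eventually_elim
      case (elim t)
      have "(\<Sum>q\<in>UNIV. (partial (e l) h (?\<gamma> t) $ q) *\<^sub>R partial q \<Psi> (h (?\<gamma> t))) $ e' k
          = (\<Sum>q\<in>UNIV. partial (e l) h (?\<gamma> t) $ q * partial q \<Psi> (h (?\<gamma> t)) $ e' k)" by simp
      also have "\<dots> = (if l < m then P k l t else 0) + weight i' p * t ^ p * P k (m - 1 + i') t"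
        using Dh_kernel_sum[OF meq i' p l_def] unfolding P_def by simp
      finally show ?case using elim by simp
    qed
    \<comment> \<open>Modulo the first \<open>m - 1\<close> target directions, \<open>Dh\<close> maps the \<open>l\<close>-th basis vector at \<open>t e\<^sub>m\<close> to
      \<open>O(t^p)\<close>; so below order \<open>p\<close> the column \<open>l\<close> of \<open>D\<phi>\<close> is constant there. This makes
      the system for \<open>\<alpha>\<close> triangular.\<close>
    have OA: "(\<lambda>t. A k t - \<alpha> k l) \<in> O[at 0](\<lambda>t. t ^ p)" if k: "1 \<le> k" "k < m" for k
    proof -
      have "\<forall>\<^sub>F t in at 0. partial (e l) u (?\<gamma> t) $ e' k + (if l < m then P k l t - \<beta> k l else 0)
          + weight i' p * (t ^ p * P k (m - 1 + i') t) = A k t - \<alpha> k l"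
        using eq[of k]
      proof eventually_elim
        case (elim t)
        have "\<alpha> k l = (if l < m then \<beta> k l else 0)" using F1[OF k] F2[OF k l1(1)] l1(2) by auto
        then show ?case using elim unfolding Dh_low[OF k] A_def by auto
      qed
      moreover have "(\<lambda>t. partial (e l) u (?\<gamma> t) $ e' k + (if l < m then P k l t - \<beta> k l else 0)
          + weight i' p * (t ^ p * P k (m - 1 + i') t)) \<in> O[at 0](\<lambda>t. t ^ p)"
      proof (intro sum_in_bigo)
        show "(\<lambda>t. partial (e l) u (?\<gamma> t) $ e' k) \<in> O[at 0](\<lambda>t. t ^ p)"
          by (rule bigo_power_mono[OF Opu]) (use p in simp)
        show "(\<lambda>t. if l < m then P k l t - \<beta> k l else 0) \<in> O[at 0](\<lambda>t. t ^ p)"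
          using bigo_power_mono[OF OP, of p] p by (cases "l < m") simp_all
        have "(\<lambda>t. t ^ p * P k (m - 1 + i') t) \<in> O[at 0](\<lambda>t. t ^ p)"
          by (rule bigo_power_mult[where j=p, OF _ OP0]) simp_all
        then show "(\<lambda>t. weight i' p * (t ^ p * P k (m - 1 + i') t)) \<in> O[at 0](\<lambda>t. t ^ p)" by simp
      qed
      ultimately show ?thesis by (rule landau_o.big.in_cong[THEN iffD1])
    qed
    let ?K = "m - 1 + i"
    define R where "R t = remainder i (\<phi> (?\<gamma> t))" for t
    \<comment> \<open>Every summand contains a coordinate of \<open>\<phi>\<close> below
      \<open>m\<close>, which is \<open>O(t ^ (r + 1))\<close> by \<open>Olow\<close>.\<close>
    have OR: "R \<in> O[at 0](\<lambda>t. t ^ (r + 1))"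
      unfolding R_def remainder_def
    proof (rule big_sum_in_bigo)
      fix j assume j: "j \<in> {j. j \<in> {1..r} \<and> (i - 1) * r + j < m}"
      then have "(\<lambda>t. \<phi> (?\<gamma> t) $ e ((i - 1) * r + j)) \<in> O[at 0](\<lambda>t. t ^ (r + 1))" by (intro Olow) auto
      moreover have "(\<lambda>t. real j * \<phi> (?\<gamma> t) $ e m ^ (j - 1)) \<in> O[at 0](\<lambda>t. t ^ 0)"
        using bigo_power_mult[OF bigo_const_power[of "real j"] bigo_power_power[OF O\<phi>, of 0 "j - 1"]] by simp
      ultimately show "(\<lambda>t. \<phi> (?\<gamma> t) $ e ((i - 1) * r + j) * (real j * \<phi> (?\<gamma> t) $ e m ^ (j - 1))) \<in> O[at 0](\<lambda>t. t ^ (r + 1))"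
        by (rule bigo_power_mult) simp
    qed
    \<comment> \<open>All deviations from the leading terms: the error of the jets, the variation of
      the derivatives of \<open>\<Psi>\<close>, the remainder, and the variation of the column of
      the derivative of \<open>\<phi>\<close>.\<close>
    define E where "E t = partial (e l) u (?\<gamma> t) $ e' ?K + (if l < m then P ?K l t - \<beta> ?K l else 0)
        + weight i' p * (t ^ p * (P ?K (m - 1 + i') t - \<beta> ?K (m - 1 + i'))) - R t * A m t
        - (\<Sum>j=1..r. weight i j * ((A ((i - 1) * r + j) t - \<alpha> ((i - 1) * r + j) l) * \<tau> t ^ j))" for t
    have "\<forall>\<^sub>F t in at 0. E t = (\<Sum>j=1..r. (weight i j * \<alpha> ((i - 1) * r + j) l) * \<tau> t ^ j)
        - (\<beta> ?K (m - 1 + i') * weight i' p) * t ^ p"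
      using eq[of ?K]
    proof eventually_elim
      case (elim t)
      have b0: "(if l < m then P ?K l t - \<beta> ?K l else 0) = (if l < m then P ?K l t else 0)"
        using F3[OF i l1(1)] by simp
      have "(\<Sum>j=1..r. weight i j * A ((i - 1) * r + j) t * \<tau> t ^ j) + R t * A m t
        = partial (e l) u (?\<gamma> t) $ e' ?K + ((if l < m then P ?K l t else 0) + weight i' p * t ^ p * P ?K (m - 1 + i') t)"
        using elim unfolding Dh_high[OF meq i] A_def R_def \<tau>_def .
      moreover have "(\<Sum>j=1..r. weight i j * ((A ((i - 1) * r + j) t - \<alpha> ((i - 1) * r + j) l) * \<tau> t ^ j))
        = (\<Sum>j=1..r. weight i j * A ((i - 1) * r + j) t * \<tau> t ^ j) - (\<Sum>j=1..r. (weight i j * \<alpha> ((i - 1) * r + j) l) * \<tau> t ^ j)"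
        unfolding sum_subtractf[symmetric] by (rule sum.cong) (simp_all add: algebra_simps)
      ultimately show ?case unfolding E_def b0 by (simp add: algebra_simps)
    qed
    moreover have "E \<in> O[at 0](\<lambda>t. t ^ (p + 1))"
      unfolding E_def
    proof (intro sum_in_bigo big_sum_in_bigo)
      show "(\<lambda>t. partial (e l) u (?\<gamma> t) $ e' ?K) \<in> O[at 0](\<lambda>t. t ^ (p + 1))"
        by (rule bigo_power_mono[OF Opu]) (use p in simp)
      show "(\<lambda>t. if l < m then P ?K l t - \<beta> ?K l else 0) \<in> O[at 0](\<lambda>t. t ^ (p + 1))"
        using bigo_power_mono[OF OP, of "p + 1"] p by (cases "l < m") simp_all
      have "(\<lambda>t. t ^ p * (P ?K (m - 1 + i') t - \<beta> ?K (m - 1 + i'))) \<in> O[at 0](\<lambda>t. t ^ (p + 1))"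
        by (rule bigo_power_mult[where j=p, OF _ OP]) simp_all
      then show "(\<lambda>t. weight i' p * (t ^ p * (P ?K (m - 1 + i') t - \<beta> ?K (m - 1 + i')))) \<in> O[at 0](\<lambda>t. t ^ (p + 1))"
        by simp
      show "(\<lambda>t. R t * A m t) \<in> O[at 0](\<lambda>t. t ^ (p + 1))"
        by (rule bigo_power_mult[OF OR OA0]) (use p in simp)
      fix j assume j: "j \<in> {1..r}"
      let ?k = "(i - 1) * r + j"
      have "(\<lambda>t. (A ?k t - \<alpha> ?k l) * \<tau> t ^ j) \<in> O[at 0](\<lambda>t. t ^ (p + 1))"
      \<comment> \<open>Below \<open>m\<close> the column is constant up to \<open>O(t ^ p)\<close>
        and one factor \<open>\<tau> t\<close> supplies the missing order. The coordinate
        \<open>m\<close> is known only up to \<open>O(t)\<close>, but it occurs with the factor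
        \<open>\<tau> t ^ r\<close>, and \<open>p \<le> r\<close>.\<close>
      proof (cases "?k < m")
        case True
        have "1 \<le> ?k" using j by simp
        then show ?thesis
          by (rule bigo_power_mult[OF OA[OF _ True] bigo_power_power[OF O\<tau>, of 1 j]]) (use j in auto)
      next
        case False
        then have "j = r" using index_le[OF meq i, of j] j by simp
        then show ?thesis
          by (intro bigo_power_mult[OF OA1 bigo_power_power[OF O\<tau>, of r j]]) (use p in auto)
      qed
      then show "(\<lambda>t. weight i j * ((A ?k t - \<alpha> ?k l) * \<tau> t ^ j)) \<in> O[at 0](\<lambda>t. t ^ (p + 1))" by simp
    qed
    ultimately have "(\<lambda>t. (\<Sum>j=1..r. (weight i j * \<alpha> ((i - 1) * r + j) l) * \<tau> t ^ j)
        - (\<beta> ?K (m - 1 + i') * weight i' p) * t ^ p) \<in> O[at 0](\<lambda>t. t ^ (p + 1))"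
      by (rule landau_o.big.in_cong[THEN iffD1])
    from expansion_unique[OF lim\<tau> \<kappa> p this] show ?thesis unfolding l_def by blast
  qed
  have w: "weight i p \<noteq> 0" for i p by (simp add: weight_def)
  have n': "n = m - 1 + (a + 1)" using na m2 by simp
  have c: "1 \<le> a + 1" by simp
  have F4: "\<alpha> ((i - 1) * r + s) ((i' - 1) * r + p) = 0"
    if "1 \<le> i" "i \<le> a + 1" "1 \<le> i'" "i' \<le> a + 1" "1 \<le> s" "s < p" "p \<le> r" for i i' s p
    using main[OF that(1-4), of p] that(5-7) w[of i s] by auto
  have F5: "\<kappa> ^ p * weight i p * \<alpha> ((i - 1) * r + p) ((i' - 1) * r + p) = \<beta> (m - 1 + i) (m - 1 + i') * weight i' p"
    if "1 \<le> i" "i \<le> a + 1" "1 \<le> i'" "i' \<le> a + 1" "1 \<le> p" "p \<le> r" for i i' p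
    using main[OF that] by (simp add: mult_ac)
  obtain b D where bD: "minor_det {1..m} \<alpha> * \<kappa> ^ ((a + 1) * (r * (r + 1) div 2)) = b ^ r"
    "minor_det {1..m} \<alpha> = \<kappa> * D" "minor_det {1..n} \<beta> = D * b"
    using flag_determinants[of r "a + 1" m n weight \<alpha> \<kappa> \<beta>, OF r c meq n' w F1 \<kappa>_def[symmetric] F2 F3 F4 F5] .
  have "det (jacobian \<phi>) = minor_det {1..m} \<alpha>"
    unfolding minor_det_UNIV \<alpha>_def by (rule minor_det_reindex[OF e]) simp
  moreover have "det (jacobian \<Psi>) = minor_det {1..n} \<beta>"
    unfolding minor_det_UNIV \<beta>_def by (rule minor_det_reindex[OF e']) simp
  ultimately show ?thesis using that[OF \<kappa>] bD by metis
qed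

end

section \<open>Constraints on orientations and the final count\<close>

lemma oriented_equiv_all:
  assumes "oriented_equiv d x x' f f" "oriented_equiv d y y' f f"
    and "\<not> (x \<and> x')" "\<not> (y \<and> y')" "x \<noteq> y \<or> x' \<noteq> y'"
  shows "oriented_equiv d s s' f f"
proof -
  have sm: "smooth_germ f" using assms(1) unfolding oriented_equiv_def by blast
  have "(s, s') = (True, True) \<or> (s, s') = (x, x') \<or> (s, s') = (y, y') \<or> (s, s') = (x = y, x' = y')"
    using assms(3-5) by auto
  then show ?thesis
    using oriented_equiv_refl[OF sm, of d] assms(1,2) oriented_equiv_trans[OF assms(1,2)] by fastforce
qed

context morin
begin

text \<open>An even exponent of \<open>\<kappa>\<close> and an even exponent of \<open>b\<close>
  force a determinant to be positive. For even \<open>r\<close> this applies to the source; for odd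
  \<open>r\<close> the factor \<open>b / \<kappa>\<close> raises both exponents by one, and the
  parity condition then concerns the target.\<close>

lemma orientation_constraint:
  assumes meq: "m = r * (a + 1)" and d: "r + 1 \<le> d" and E: "oriented_equiv d s s' h h"
  defines "T \<equiv> r * (r + 1) div 2"
  shows "even r \<Longrightarrow> even ((a + 1) * T) \<Longrightarrow> s" and "odd r \<Longrightarrow> odd ((a + 1) * T) \<Longrightarrow> s'"
proof -
  obtain \<phi> \<Phi> where *: "diffeo_germ \<phi>" "diffeo_germ \<Phi>" "0 < det (jacobian \<phi>) \<longleftrightarrow> s"
    "0 < det (jacobian \<Phi>) \<longleftrightarrow> s'" "jet_eq d (\<Phi> \<circ> h \<circ> \<phi>) h"
    using E unfolding oriented_equiv_def by blast
  \<comment> \<open>Moving \<open>\<Phi>\<close> to the other side replaces it by its inverse, whose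
    jacobian determinant has the same sign.\<close>
  obtain \<Psi> where \<Psi>: "diffeo_germ \<Psi>" "\<forall>\<^sub>F x in nhds 0. \<Psi> (\<Phi> x) = x"
    using *(2) by (rule diffeo_germ_inverse)
  have sm: "smooth_germ (h \<circ> \<phi>)" by (rule smooth_germ_comp[OF diffeo_germ_smooth[OF *(1)] smooth_germ_h])
  have "jet_eq d (\<Psi> \<circ> (\<Phi> \<circ> h \<circ> \<phi>)) (\<Psi> \<circ> h)"
    using * \<Psi>(1) smooth_germ_h by (intro jet_eq_comp smooth_germ_comp3 diffeo_germ_smooth jet_eq_refl)
  moreover have "jet_eq d (\<Psi> \<circ> (\<Phi> \<circ> h \<circ> \<phi>)) (h \<circ> \<phi>)"
    using smooth_germ_eventually[OF sm \<Psi>(2)] by (intro jet_eq_cong) simp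
  ultimately have "jet_eq d (h \<circ> \<phi>) (\<Psi> \<circ> h)" using jet_eq_sym jet_eq_trans by blast
  then have "jet_eq (r + 1) (h \<circ> \<phi>) (\<Psi> \<circ> h)" using d by (rule jet_eq_mono)
  then obtain \<kappa> b D where k: "\<kappa> \<noteq> 0" "det (jacobian \<phi>) * \<kappa> ^ ((a + 1) * T) = b ^ r"
    "det (jacobian \<phi>) = \<kappa> * D" "det (jacobian \<Psi>) = D * b"
    unfolding T_def using obstruction[OF meq *(1) \<Psi>(1)] by blast
  have pos: "0 < x" if "x * y ^ i = z ^ j" "even i" "even j" "x \<noteq> 0" "y \<noteq> 0" for x y z :: real and i j
  proof -
    have "0 < y ^ i" "0 \<le> z ^ j" using that by (simp_all add: zero_less_power_eq zero_le_power_eq)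
    then show ?thesis using that(1,4) by (metis less_eq_real_def not_less zero_le_mult_iff)
  qed
  show s if "even r" "even ((a + 1) * T)"
    using pos[OF k(2)] that k(1) det_jacobian_nz[OF *(1)] *(3) by blast
  show s' if "odd r" "odd ((a + 1) * T)"
  proof -
    have "det (jacobian \<Psi>) * \<kappa> ^ ((a + 1) * T + 1) = b ^ (r + 1)"
      using k(2) unfolding k(3,4) by (simp add: algebra_simps)
    then have "0 < det (jacobian \<Psi>)"
      by (rule pos) (use that k(1) det_jacobian_nz[OF \<Psi>(1)] in simp_all)
    then show s' using det_inverse_sign[OF jacobian_inverse[OF *(2) \<Psi>]] *(4) by simp
  qed
qed

end

theorem mainTheorem3:
  fixes e :: "nat \<Rightarrow> 'm::finite" and e' :: "nat \<Rightarrow> 'n::finite"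
    and m n a r d N :: nat
    and f :: "real^'m \<Rightarrow> real^'n"
  assumes e: "bij_betw e {1..CARD('m)} UNIV"
    and e': "bij_betw e' {1..CARD('n)} UNIV"
    and m: "m = CARD('m)" and n: "n = CARD('n)" and a: "a = n - m"
    and "1 \<le> m" and "m < n" and "1 \<le> r" and "r * (n - m + 1) \<le> m"
    and f: "morin_singularity e e' r f"
    and d: "determined d f"
    and N: "N = card (A_isotopy_classes d {g. A_equivalent f g})"
  shows "(m > r * (n - m + 1) \<longrightarrow> N = 1) \<and>
    (m = r * (n - m + 1) \<longrightarrow>
       (r mod 4 = 0 \<longrightarrow> N = 2) \<and>
       (r mod 4 = 1 \<longrightarrow> (odd a \<longrightarrow> N = 1) \<and> (even a \<longrightarrow> N = 2)) \<and>
       (r mod 4 = 2 \<longrightarrow> (odd a \<longrightarrow> N = 2) \<and> (even a \<longrightarrow> N = 1)) \<and>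
       (r mod 4 = 3 \<longrightarrow> N = 1))"
proof -
  have na': "n - m + 1 = a + 1" using a by simp
  interpret morin e e' m n a r
    using assms by unfold_locales auto
  define T where "T = r * (r + 1) div 2"
  have fh: "A_equivalent f h" using f unfolding morin_singularity_def .
  have dh: "determined d h" by (rule determined_A_equivalent[OF d fh])
  have rd: "r + 1 \<le> d" by (rule determined_order[OF dh])
  then have d1: "1 \<le> d" by simp
  have "{g. A_equivalent f g} = {g. A_equivalent h g}"
    using fh A_equivalent_sym A_equivalent_trans by blast
  then have N': "N = card (A_isotopy_classes d {g. A_equivalent h g})" using N by simp
  note S1 = symmetry_flip_component[of d]
  note one = card_isotopy_classes_one[OF d1 dh oriented_equiv_all, folded N']
  note two = card_isotopy_classes_two[OF d1 dh, folded N']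
  show ?thesis unfolding na'
  proof (intro conjI impI)
    \<comment> \<open>One symmetry reverses both orientations and the other exactly one of them, so
      they generate all four pairs.\<close>
    assume "r * (a + 1) < m"
    then show "N = 1" by (rule one[OF symmetry_flip_unused S1]) auto
  next
    assume meq: "m = r * (a + 1)"
    note S2 = symmetry_flip_kernel[OF meq, of d, folded T_def]
    note C = orientation_constraint[OF meq rd, folded T_def]
    define q where "q = r div 4"
    \<comment> \<open>The factorisations of \<open>r * (r + 1)\<close> in terms of \<open>q\<close>
      reveal the parity of \<open>T\<close>.\<close>
    have r4: "r = 4 * q + r mod 4" unfolding q_def by simp
    {
      assume r0: "r mod 4 = 0"
      have "T = 2 * q * (4 * q + 1)" unfolding T_def using r4 r0 by simp
      then have "even r" "even T" using r4 r0 by simp_all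
      \<comment> \<open>For even \<open>r\<close> the symmetry \<open>S1\<close> is
        \<open>(True, False)\<close>, and \<open>C\<close> excludes \<open>(False, True)\<close>
        because \<open>(a + 1) * T\<close> is even.\<close>
      then show "N = 2" using two[OF S1, of False True] C(1)[of False True] by auto
    }
    {
      assume r1: "r mod 4 = 1"
      have "r * (r + 1) = 2 * ((4 * q + 1) * (2 * q + 1))" using r4 r1 by (simp add: algebra_simps)
      then have "T = (4 * q + 1) * (2 * q + 1)" unfolding T_def by simp
      then have p: "odd r" "odd T" using r4 r1 by simp_all
      \<comment> \<open>For odd \<open>r\<close> the symmetry \<open>S1\<close> is
        \<open>(False, True)\<close>. Odd \<open>a\<close> makes \<open>(a + 1) * T\<close> even and
        \<open>S2\<close> the pair \<open>(True, False)\<close>; for even \<open>a\<close> that pair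
        is excluded.\<close>
      show "N = 1" if "odd a"
        by (rule one[OF S1 S2]) (use p that in auto)
      show "N = 2" if "even a"
        using two[OF S1, of True False] C(2)[of True False] p that by auto
    }
    {
      assume r2: "r mod 4 = 2"
      have "r * (r + 1) = 2 * ((2 * q + 1) * (4 * q + 3))" using r4 r2 by (simp add: algebra_simps)
      then have "T = (2 * q + 1) * (4 * q + 3)" unfolding T_def by simp
      then have p: "even r" "odd T" using r4 r2 by simp_all
      show "N = 2" if "odd a"
        using two[OF S1, of False True] C(1)[of False True] p that by auto
      \<comment> \<open>Here \<open>(a + 1) * T\<close> is odd, so \<open>S2\<close> reverses both
        orientations while \<open>S1\<close> reverses only that of the target.\<close>
      show "N = 1" if "even a"
        by (rule one[OF S1 S2]) (use p that in auto)
    }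
    {
      assume r3: "r mod 4 = 3"
      have "r * (r + 1) = 2 * ((4 * q + 3) * (2 * q + 2))" using r4 r3 by (simp add: algebra_simps)
      then have "T = (4 * q + 3) * (2 * q + 2)" unfolding T_def by simp
      then have p: "odd r" "even T" using r4 r3 by simp_all
      show "N = 1"
        by (rule one[OF S1 S2]) (use p in auto)
    }
  qed
qed

end
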